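(* Let $\mathcal A$ be a Möbius covariant net on two-dimensional Minkowski space. Then for every bounded double cone $D=I\times J$ and every $x\in\mathcal A(D)$, $$\Phi_+^{\mathrm{out}}(x)=\Phi_+^{\mathrm{in}}(x)\quad\text{and}\quad\Phi_-^{\mathrm{out}}(x)=\Phi_-^{\mathrm{in}}(x).$$
   Context: **Poincaré covariant net.** Points of $\mathbb R^2$ are $(a_0,a_1)$ ($a_0$ time). A (local) Poincaré covariant net $\mathcal A$ assigns to each open bounded $O\subset\mathbb R^2$ a von Neumann algebra $\mathcal A(O)$ on a common separable Hilbert space $\mathcal H$ such that: (1) $O_1\subset O_2\Rightarrow\mathcal A(O_1)\subset\mathcal A(O_2)$; (2) $[\mathcal A(O_1),\mathcal A(O_2)]=0$ if $O_1,O_2$ are spacelike separated; (3) $O=\bigcup_iO_i\Rightarrow\mathcal A(O)=\bigvee_i\mathcal A(O_i)$; (4) there is a strongly continuous unitary representation $U$ of the proper orthochronous Poincaré group $\mathcal P_+^\uparrow$ with $U(g)\mathcal A(O)U(g)^*=\mathcal A(gO)$; (5) the joint spectrum of translations in $U$ lies in $\{(p_0,p_1):p_0+p_1\ge0,\ p_0-p_1\ge0\}$; (6) there is a unique (up to phase) unit vector $\Omega\in\mathcal H$ invariant under $U$, and it is cyclic for $\bigvee_O\mathcal A(O)$. **Möbius covariant net.** Write $\mathbb R^2=L_+\times L_-$ with $L_\pm=\{a_0\pm a_1=0\}$ (parametrized by $a_0-a_1$ on $L_+$ and $a_0+a_1$ on $L_-$); bounded double cones are products $I\times J$ of bounded open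 intervals $I\subset L_+$, $J\subset L_-$. $PSL(2,\mathbb R)$ acts on $\mathbb R\cup\{\infty\}$ by fractional linear maps, hence $\overline{PSL(2,\mathbb R)}\times\overline{PSL(2,\mathbb R)}$ (universal covers; first factor on $L_+$, second on $L_-$) acts locally on $\mathbb R^2$; it contains $\mathcal P_+^\uparrow$ and the dilations. $\mathcal A$ is Möbius covariant if $U$ extends to a unitary representation of this group such that for each $O$ there is a neighborhood $\mathcal U$ of the unit with $gO\subset\mathbb R^2$ and $U(g)\mathcal A(O)U(g)^*=\mathcal A(gO)$ for $g\in\mathcal U$. **Asymptotic fields.** $T(a)$ is the representative of translation by $a\in\mathbb R^2$; for $x\in\mathcal A(O)$, $O$ bounded, put $x(a)=T(a)xT(a)^*$. Fix $0<\varepsilon<1$ and a nonnegative symmetric smooth $h$ on $\mathbb R$ with $\int h=1$; put $h_{\mathcal T}(t)=|\mathcal T|^{-\varepsilon}h(|\mathcal T|^{-\varepsilon}(t-\mathcal T))$ and $x_\pm(h_{\mathcal T})=\int dt\,h_{\mathcal T}(t)\,x(t,\pm t)$. The strong limits $\Phi^{\mathrm{in}}_\pm(x)=\lim_{\mathcal T\to-\infty}x_\pm(h_{\mathcal T})$ and $\Phi^{\mathrm{out}}_\pm(x)=\lim_{\mathcal T\to+\infty}x_\pm(h_{\mathcal T})$ exist (Buchholz). *)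

theory Defs
  imports "HOL-Analysis.Analysis"
begin

section \<open>Complex Hilbert spaces and bounded operators\<close>

text \<open>
  The real inner product of \<^class>\<open>real_inner\<close> is the real part of the complex one, so norm,
  metric and topology are those of the library.  \<open>cinner\<close> is linear in the second argument.
\<close>

class complex_inner = real_inner +
  fixes scaleC :: "complex \<Rightarrow> 'a \<Rightarrow> 'a" (infixr "*\<^sub>C" 75)
    and cinner :: "'a \<Rightarrow> 'a \<Rightarrow> complex"
  assumes scaleC_add_right: "c *\<^sub>C (x + y) = c *\<^sub>C x + c *\<^sub>C y"
    and scaleC_add_left: "(c + d) *\<^sub>C x = c *\<^sub>C x + d *\<^sub>C x"
    and scaleC_scaleC: "c *\<^sub>C d *\<^sub>C x = (c * d) *\<^sub>C x"
    and scaleC_of_real: "complex_of_real r *\<^sub>C x = r *\<^sub>R x"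
    and cinner_commute: "cinner x y = cnj (cinner y x)"
    and cinner_add_right: "cinner x (y + z) = cinner x y + cinner x z"
    and cinner_scaleC_right: "cinner x (c *\<^sub>C y) = c * cinner x y"
    and Re_cinner: "Re (cinner x y) = inner x y"

class chilbert_space = complex_inner + banach

instantiation complex :: chilbert_space
begin
definition scaleC_complex :: "complex \<Rightarrow> complex \<Rightarrow> complex"
  where "scaleC_complex c x = c * x"
definition cinner_complex :: "complex \<Rightarrow> complex \<Rightarrow> complex"
  where "cinner_complex x y = cnj x * y"
instance
  by standard
    (auto simp: scaleC_complex_def cinner_complex_def algebra_simps scaleR_conv_of_real inner_complex_def)
end

definition bounded_clinear :: "('h::chilbert_space \<Rightarrow> 'h) \<Rightarrow> bool" where
  "bounded_clinear x \<longleftrightarrow> bounded_linear x \<and> (\<forall>c \<xi>. x (c *\<^sub>C \<xi>) = c *\<^sub>C x \<xi>)"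

definition cadjoint :: "('h::chilbert_space \<Rightarrow> 'h) \<Rightarrow> 'h \<Rightarrow> 'h" where
  "cadjoint x = (THE y. \<forall>\<xi> \<eta>. cinner (y \<xi>) \<eta> = cinner \<xi> (x \<eta>))"

definition unitary_op :: "('h::chilbert_space \<Rightarrow> 'h) \<Rightarrow> bool" where
  "unitary_op u \<longleftrightarrow> bounded_clinear u \<and> surj u \<and> (\<forall>\<xi> \<eta>. cinner (u \<xi>) (u \<eta>) = cinner \<xi> \<eta>)"

definition commutant :: "('h::chilbert_space \<Rightarrow> 'h) set \<Rightarrow> ('h \<Rightarrow> 'h) set" where
  "commutant S = {y. bounded_clinear y \<and> (\<forall>x\<in>S. x \<circ> y = y \<circ> x)}"

definition von_neumann_algebra :: "('h::chilbert_space \<Rightarrow> 'h) set \<Rightarrow> bool" where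
  "von_neumann_algebra M \<longleftrightarrow>
     (\<forall>x\<in>M. bounded_clinear x \<and> cadjoint x \<in> M) \<and> commutant (commutant M) = M"

definition vn_generated :: "('h::chilbert_space \<Rightarrow> 'h) set \<Rightarrow> ('h \<Rightarrow> 'h) set" where
  "vn_generated S = \<Inter>{M. von_neumann_algebra M \<and> S \<subseteq> M}"

text \<open>
  Strongly continuous unitary representation of the group with carrier \<open>G\<close> and multiplication
  \<open>gmul\<close>; the values outside \<open>G\<close> are irrelevant.
\<close>

definition unitary_rep ::
  "'g::topological_space set \<Rightarrow> ('g \<Rightarrow> 'g \<Rightarrow> 'g) \<Rightarrow> ('g \<Rightarrow> 'h::chilbert_space \<Rightarrow> 'h) \<Rightarrow> bool" where
  "unitary_rep G gmul V \<longleftrightarrow>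
     (\<forall>g\<in>G. unitary_op (V g)) \<and>
     (\<forall>g\<in>G. \<forall>k\<in>G. V (gmul g k) = V g \<circ> V k) \<and>
     (\<forall>\<xi>. continuous_on G (\<lambda>g. V g \<xi>))"

definition conj_op :: "('h::chilbert_space \<Rightarrow> 'h) \<Rightarrow> ('h \<Rightarrow> 'h) \<Rightarrow> 'h \<Rightarrow> 'h" where
  "conj_op u x = u \<circ> x \<circ> cadjoint u"


section \<open>Minkowski space and the Poincare group\<close>

text \<open>A point is a pair \<open>(a\<^sub>0, a\<^sub>1)\<close> with \<open>a\<^sub>0\<close> the time coordinate.\<close>

type_synonym spacetime = "real \<times> real"

definition mink :: "spacetime \<Rightarrow> spacetime \<Rightarrow> real" where
  "mink a b = fst a * fst b - snd a * snd b"

definition spacelike_separated :: "spacetime set \<Rightarrow> spacetime set \<Rightarrow> bool" where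
  "spacelike_separated S T \<longleftrightarrow> (\<forall>a\<in>S. \<forall>b\<in>T. mink (a - b) (a - b) < 0)"

definition double_cone :: "real set \<Rightarrow> real set \<Rightarrow> spacetime set" where
  "double_cone I J = {a. fst a - snd a \<in> I \<and> fst a + snd a \<in> J}"

definition proper_orthochronous_lorentz :: "(spacetime \<Rightarrow> spacetime) set" where
  "proper_orthochronous_lorentz = {\<Lambda>. linear \<Lambda> \<and> (\<forall>a b. mink (\<Lambda> a) (\<Lambda> b) = mink a b) \<and>
     fst (\<Lambda> (1, 0)) * snd (\<Lambda> (0, 1)) - fst (\<Lambda> (0, 1)) * snd (\<Lambda> (1, 0)) = 1 \<and>
     fst (\<Lambda> (1, 0)) > 0}"

text \<open>
  The group consists of maps and is topologized by the product topology on functions, that is,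
  by pointwise convergence; on affine maps this is the usual Lie group topology.
\<close>

definition poincare_group :: "(spacetime \<Rightarrow> spacetime) set" where
  "poincare_group = {\<lambda>b. a + \<Lambda> b | a \<Lambda>. \<Lambda> \<in> proper_orthochronous_lorentz}"

definition transl :: "((spacetime \<Rightarrow> spacetime) \<Rightarrow> 'h \<Rightarrow> 'h) \<Rightarrow> spacetime \<Rightarrow> 'h \<Rightarrow> 'h" where
  "transl U a = U (\<lambda>b. a + b)"


section \<open>The joint spectrum of the translations\<close>

text \<open>
  \<open>E\<close> is the projection-valued measure on momentum space with
  \<open>T(a) = \<integral> exp(i (p\<^sub>0 a\<^sub>0 - p\<^sub>1 a\<^sub>1)) dE(p)\<close>, which exists uniquely for a strongly continuous
  unitary representation of the translations (Stone-Naimark-Ambrose-Godement); the joint spectrum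
  is its support.
\<close>

definition spectral_distribution ::
  "(spacetime set \<Rightarrow> 'h::chilbert_space \<Rightarrow> 'h) \<Rightarrow> 'h \<Rightarrow> spacetime measure" where
  "spectral_distribution E \<xi> =
     measure_of UNIV (sets borel) (\<lambda>B. ennreal (Re (cinner \<xi> (E B \<xi>))))"

definition joint_spectral_measure ::
  "(spacetime \<Rightarrow> 'h::chilbert_space \<Rightarrow> 'h) \<Rightarrow> (spacetime set \<Rightarrow> 'h \<Rightarrow> 'h) \<Rightarrow> bool" where
  "joint_spectral_measure T E \<longleftrightarrow>
     (\<forall>B\<in>sets borel. bounded_clinear (E B) \<and> cadjoint (E B) = E B \<and> E B \<circ> E B = E B) \<and>
     E UNIV = id \<and>
     (\<forall>B \<xi>. range B \<subseteq> sets borel \<longrightarrow> disjoint_family B \<longrightarrow>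
        (\<lambda>n::nat. E (B n) \<xi>) sums E (\<Union>n. B n) \<xi>) \<and>
     (\<forall>a \<xi>. cinner \<xi> (T a \<xi>) =
        (LINT p|spectral_distribution E \<xi>. cis (mink p a)))"

definition spectral_support :: "(spacetime set \<Rightarrow> 'h::chilbert_space \<Rightarrow> 'h) \<Rightarrow> spacetime set" where
  "spectral_support E = {p. \<forall>N. open N \<and> p \<in> N \<longrightarrow> E N \<noteq> (\<lambda>\<xi>. 0)}"

definition forward_cone :: "spacetime set" where
  "forward_cone = {p. fst p + snd p \<ge> 0 \<and> fst p - snd p \<ge> 0}"


section \<open>Poincare covariant nets\<close>

definition invariant_vector ::
  "((spacetime \<Rightarrow> spacetime) \<Rightarrow> 'h::chilbert_space \<Rightarrow> 'h) \<Rightarrow> 'h \<Rightarrow> bool" where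
  "invariant_vector U \<psi> \<longleftrightarrow> (\<forall>g\<in>poincare_group. U g \<psi> = \<psi>)"

text \<open>
  Separability of the Hilbert space is expressed by \<^class>\<open>second_countable_topology\<close>, to which it
  is equivalent for metric spaces.  Only the algebras of open bounded regions are meaningful.
\<close>

locale poincare_covariant_net =
  fixes \<A> :: "spacetime set \<Rightarrow> ('h::{chilbert_space, second_countable_topology} \<Rightarrow> 'h) set"
    and U :: "(spacetime \<Rightarrow> spacetime) \<Rightarrow> 'h \<Rightarrow> 'h"
  assumes local_algebra: "\<And>S. open S \<Longrightarrow> bounded S \<Longrightarrow> von_neumann_algebra (\<A> S)"
    and isotony: "\<And>S T. open S \<Longrightarrow> bounded S \<Longrightarrow> open T \<Longrightarrow> bounded T \<Longrightarrow> S \<subseteq> T \<Longrightarrow> \<A> S \<subseteq> \<A> T"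
    and locality: "\<And>S T x y. open S \<Longrightarrow> bounded S \<Longrightarrow> open T \<Longrightarrow> bounded T \<Longrightarrow>
        spacelike_separated S T \<Longrightarrow> x \<in> \<A> S \<Longrightarrow> y \<in> \<A> T \<Longrightarrow> x \<circ> y = y \<circ> x"
    and additivity: "\<And>\<C>. (\<And>S. S \<in> \<C> \<Longrightarrow> open S) \<Longrightarrow> bounded (\<Union>\<C>) \<Longrightarrow>
        \<A> (\<Union>\<C>) = vn_generated (\<Union>S\<in>\<C>. \<A> S)"
    and representation: "unitary_rep poincare_group (\<circ>) U"
    and covariance: "\<And>g S. g \<in> poincare_group \<Longrightarrow> open S \<Longrightarrow> bounded S \<Longrightarrow>
        conj_op (U g) ` \<A> S = \<A> (g ` S)"
    and spectrum_condition:
        "\<exists>E. joint_spectral_measure (transl U) E \<and> spectral_support E \<subseteq> forward_cone"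
    and vacuum: "\<exists>\<Omega>. norm \<Omega> = 1 \<and> invariant_vector U \<Omega> \<and>
        (\<forall>\<psi>. norm \<psi> = 1 \<and> invariant_vector U \<psi> \<longrightarrow> (\<exists>c. cmod c = 1 \<and> \<psi> = c *\<^sub>C \<Omega>)) \<and>
        closure {x \<Omega> | x. x \<in> vn_generated (\<Union>S\<in>{S. open S \<and> bounded S}. \<A> S)} = UNIV"


section \<open>The universal cover of PSL(2,R) and Moebius covariant nets\<close>

text \<open>
  The circle \<open>\<real> \<union> {\<infinity>}\<close> is covered by the real line through \<open>\<theta> \<mapsto> tan \<theta>\<close>, with period \<open>\<pi>\<close> and
  \<open>\<theta> = \<pi>/2\<close> lying over \<open>\<infinity>\<close>; in homogeneous coordinates \<open>\<theta> \<mapsto> [sin \<theta> : cos \<theta>]\<close>.  The universal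
  cover of \<open>PSL(2,\<real>)\<close> is realized as the group (under composition) of all continuous lifts to the
  line of the fractional linear maps \<open>x \<mapsto> (a x + b) / (c x + d)\<close>, \<open>a d - b c = 1\<close>: the equation
  below says that \<open>[sin (f \<theta>) : cos (f \<theta>)] = [a sin \<theta> + b cos \<theta> : c sin \<theta> + d cos \<theta>]\<close>.  The
  covering homomorphism sends \<open>f\<close> to the fractional linear map; its kernel consists of the
  translations by multiples of \<open>\<pi>\<close>.  The group topology is again that of pointwise convergence.
\<close>

definition moebius_cover :: "(real \<Rightarrow> real) set" where
  "moebius_cover = {f. continuous_on UNIV f \<and>
     (\<exists>a b c d. a * d - b * c = 1 \<and>
       (\<forall>\<theta>. sin (f \<theta>) * (c * sin \<theta> + d * cos \<theta>) = cos (f \<theta>) * (a * sin \<theta> + b * cos \<theta>)))}"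

lemma moebius_cover_id: "id \<in> moebius_cover"
proof -
  have "(1::real) * 1 - 0 * 0 = 1 \<and>
    (\<forall>\<theta>. sin (id \<theta>) * (0 * sin \<theta> + 1 * cos \<theta>) = cos (id \<theta>) * (1 * sin \<theta> + 0 * cos (\<theta>::real)))"
    by simp
  then show ?thesis
    unfolding moebius_cover_def by (blast intro: continuous_on_id')
qed

lemma moebius_cover_shift:
  assumes "f \<in> moebius_cover" shows "(\<lambda>\<theta>. f \<theta> + pi) \<in> moebius_cover"
  using assms unfolding moebius_cover_def by (auto intro!: continuous_intros)

lemma moebius_cover_comp:
  assumes "f \<in> moebius_cover" "g \<in> moebius_cover" shows "f \<circ> g \<in> moebius_cover"
proof -
  obtain a b c d where 1: "a * d - b * c = 1" and f: "continuous_on UNIV f"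
    "\<And>\<theta>. sin (f \<theta>) * (c * sin \<theta> + d * cos \<theta>) = cos (f \<theta>) * (a * sin \<theta> + b * cos \<theta>)"
    using assms(1) unfolding moebius_cover_def by blast
  obtain a' b' c' d' where 2: "a' * d' - b' * c' = 1" and g: "continuous_on UNIV g"
    "\<And>\<theta>. sin (g \<theta>) * (c' * sin \<theta> + d' * cos \<theta>) = cos (g \<theta>) * (a' * sin \<theta> + b' * cos \<theta>)"
    using assms(2) unfolding moebius_cover_def by blast
  have "sin (f (g \<theta>)) * ((c*a'+d*c') * sin \<theta> + (c*b'+d*d') * cos \<theta>)
      = cos (f (g \<theta>)) * ((a*a'+b*c') * sin \<theta> + (a*b'+b*d') * cos \<theta>)" for \<theta>
  proof -
    define p where "p = a' * sin \<theta> + b' * cos \<theta>"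
    define q where "q = c' * sin \<theta> + d' * cos \<theta>"
    define r where "r = sin (g \<theta>) * p + cos (g \<theta>) * q"
    have "sin (g \<theta>) * q = cos (g \<theta>) * p" using g(2)[of \<theta>] by (simp add: p_def q_def)
    moreover have s: "sin (g \<theta>)^2 + cos (g \<theta>)^2 = 1" by simp
    ultimately have "p = r * sin (g \<theta>)" "q = r * cos (g \<theta>)"
      unfolding r_def by algebra+
    then have "sin (f (g \<theta>)) * (c * p + d * q) = cos (f (g \<theta>)) * (a * p + b * q)"
      using f(2)[of "g \<theta>"] by algebra
    then show ?thesis by (simp add: p_def q_def algebra_simps)
  qed
  moreover have "(a*a'+b*c') * (c*b'+d*d') - (a*b'+b*d') * (c*a'+d*c') = 1"
    using 1 2 by algebra
  moreover have "continuous_on UNIV (f \<circ> g)"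
    using f(1) g(1) by (metis continuous_on_compose continuous_on_subset subset_UNIV)
  ultimately show ?thesis unfolding moebius_cover_def by fastforce
qed

abbreviation conformal_group :: "((real \<Rightarrow> real) \<times> (real \<Rightarrow> real)) set" where
  "conformal_group \<equiv> moebius_cover \<times> moebius_cover"

definition conformal_mult ::
  "(real \<Rightarrow> real) \<times> (real \<Rightarrow> real) \<Rightarrow> (real \<Rightarrow> real) \<times> (real \<Rightarrow> real) \<Rightarrow> (real \<Rightarrow> real) \<times> (real \<Rightarrow> real)"
  where "conformal_mult g k = (fst g \<circ> fst k, snd g \<circ> snd k)"

text \<open>
  \<open>compactify\<close> embeds Minkowski space, in the light-ray coordinates \<open>a\<^sub>0 - a\<^sub>1\<close> on \<open>L\<^sub>+\<close> and
  \<open>a\<^sub>0 + a\<^sub>1\<close> on \<open>L\<^sub>-\<close>, into the plane covering the product of the two circles, as the square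
  \<open>(-\<pi>/2, \<pi>/2)\<^sup>2\<close>.  The group acts on this plane, hence locally on Minkowski space.
\<close>

definition compactify :: "spacetime \<Rightarrow> real \<times> real" where
  "compactify a = (arctan (fst a - snd a), arctan (fst a + snd a))"

definition stays_in_minkowski :: "(real \<Rightarrow> real) \<times> (real \<Rightarrow> real) \<Rightarrow> spacetime set \<Rightarrow> bool" where
  "stays_in_minkowski g S \<longleftrightarrow> map_prod (fst g) (snd g) ` compactify ` S \<subseteq> range compactify"

definition local_action :: "(real \<Rightarrow> real) \<times> (real \<Rightarrow> real) \<Rightarrow> spacetime set \<Rightarrow> spacetime set" where
  "local_action g S = compactify -` (map_prod (fst g) (snd g) ` compactify ` S)"

text \<open>\<open>g\<close> is the image of the Poincare transformation \<open>p\<close> in the conformal group.  Such a \<open>g\<close> exists for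
  every \<open>p\<close> (lemma \<open>lifts_poincare_exists\<close>) and is unique, the affine maps \<open>x \<mapsto> l x + s\<close> being
  lifted so as to fix \<open>\<pi>/2\<close>.\<close>

definition lifts_poincare ::
  "(real \<Rightarrow> real) \<times> (real \<Rightarrow> real) \<Rightarrow> (spacetime \<Rightarrow> spacetime) \<Rightarrow> bool" where
  "lifts_poincare g p \<longleftrightarrow> g \<in> conformal_group \<and> p \<in> poincare_group \<and>
     (\<forall>a. map_prod (fst g) (snd g) (compactify a) = compactify (p a))"

lemma affine_lift_exists:
  assumes "l > 0"
  shows "\<exists>f\<in>moebius_cover. \<forall>x. f (arctan x) = arctan (l * x + s)"
proof -
  define a where "a = sqrt l"
  define b where "b = s / sqrt l"
  define d where "d = 1 / sqrt l"
  have a: "a > 0" and d: "d > 0" and ad: "a * d = 1" and la: "a = l * d" "b = s * d"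
    using assms by (auto simp: a_def b_def d_def real_div_sqrt)
  define w where "w \<theta> = Complex (d * cos \<theta>) (a * sin \<theta> + b * cos \<theta>) * cis (- \<theta>)" for \<theta>
  have w: "w \<theta> \<notin> \<real>\<^sub>\<le>\<^sub>0" for \<theta>
  proof
    assume "w \<theta> \<in> \<real>\<^sub>\<le>\<^sub>0"
    then have *: "Im (w \<theta>) = 0" "Re (w \<theta>) \<le> 0" by (auto simp: complex_nonpos_Reals_iff)
    have "Complex (d * cos \<theta>) (a * sin \<theta> + b * cos \<theta>) = w \<theta> * cis \<theta>"
      by (simp add: w_def mult.assoc cis_mult)
    then have e: "d * cos \<theta> = Re (w \<theta>) * cos \<theta>" "a * sin \<theta> + b * cos \<theta> = Re (w \<theta>) * sin \<theta>"
      using * by (auto simp: complex_eq_iff)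
    have "cos \<theta> = 0" using e(1) * d by (metis mult_right_cancel not_le)
    moreover have "sin \<theta> = 0" using e(2) * a calculation
      by (metis add.right_neutral mult_right_cancel mult_zero_right not_le)
    ultimately show False using sin_zero_abs_cos_one by fastforce
  qed
  define f where "f \<theta> = \<theta> + Im (Ln (w \<theta>))" for \<theta>
  have wc: "continuous_on UNIV w"
    unfolding w_def Complex_eq by (intro continuous_intros)
  have fc: "continuous_on UNIV f"
    unfolding f_def using w wc by (intro continuous_intros) auto
  have z: "Complex (d * cos \<theta>) (a * sin \<theta> + b * cos \<theta>) = of_real (cmod (w \<theta>)) * cis (f \<theta>)" for \<theta>
  proof -
    have nz: "w \<theta> \<noteq> 0" using w[of \<theta>] by auto
    have "Complex (d * cos \<theta>) (a * sin \<theta> + b * cos \<theta>) = w \<theta> * cis \<theta>"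
      by (simp add: w_def mult.assoc cis_mult)
    also have "w \<theta> = of_real (cmod (w \<theta>)) * cis (Im (Ln (w \<theta>)))"
      using nz by (metis Arg_eq_Im_Ln rcis_cmod_Arg rcis_def)
    also have "\<dots> * cis \<theta> = of_real (cmod (w \<theta>)) * cis (f \<theta>)"
      by (simp add: mult.assoc cis_mult f_def add.commute)
    finally show ?thesis .
  qed
  have z': "d * cos \<theta> = cmod (w \<theta>) * cos (f \<theta>)" "a * sin \<theta> + b * cos \<theta> = cmod (w \<theta>) * sin (f \<theta>)" for \<theta>
    using z[of \<theta>] by (auto simp: complex_eq_iff)
  have "f \<in> moebius_cover"
    unfolding moebius_cover_def
    by (safe, rule fc, rule exI[of _ a], rule exI[of _ b], rule exI[of _ 0], rule exI[of _ d])
      (use ad in \<open>auto simp: z'\<close>)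
  moreover have "f (arctan x) = arctan (l * x + s)" for x
  proof -
    let ?t = "arctan x"
    have cp: "cos ?t > 0" using cos_gt_zero_pi[of "arctan x"] arctan_lbound[of x] arctan_ubound[of x] by simp
    have np: "cmod (w ?t) > 0" using w[of ?t] by auto
    have fp: "cos (f ?t) > 0" using z'(1)[of ?t] cp d np
      by (metis mult_pos_pos zero_less_mult_pos)
    have b3: "\<bar>f ?t\<bar> < 3 * pi / 2"
    proof -
      have "\<bar>Im (Ln (w ?t))\<bar> \<le> pi"
        using np Im_Ln_le_pi[of "w ?t"] mpi_less_Im_Ln[of "w ?t"] by auto
      then show ?thesis using arctan_bounded[of x] unfolding f_def by linarith
    qed
    have fb: "\<bar>f ?t\<bar> < pi / 2"
    proof (rule ccontr)
      assume "\<not> ?thesis"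
      then have "cos (\<bar>f ?t\<bar> - pi) \<ge> 0" using b3 by (intro cos_ge_zero) auto
      then show False using fp by (simp add: cos_diff abs_if split: if_splits)
    qed
    have "tan (f ?t) = (a * sin ?t + b * cos ?t) / (d * cos ?t)"
      using np by (simp add: z' tan_def)
    also have "\<dots> = l * tan ?t + s"
      using d cp by (simp add: la tan_def field_simps)
    finally have "tan (f ?t) = l * x + s" by (simp add: tan_arctan)
    then show ?thesis using fb by (metis abs_less_iff arctan_tan minus_less_iff)
  qed
  ultimately show ?thesis by blast
qed

lemma lifts_poincare_exists:
  assumes "p \<in> poincare_group"
  shows "\<exists>g. lifts_poincare g p"
proof -
  obtain a L where p: "p = (\<lambda>b. a + L b)" and L: "L \<in> proper_orthochronous_lorentz"
    using assms unfolding poincare_group_def by blast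
  define A B C D where "A = fst (L (1,0))" and "B = fst (L (0,1))" and "C = snd (L (1,0))" and "D = snd (L (0,1))"
  have lin: "linear L" and A0: "A > 0" and det: "A * D - B * C = 1"
    and m: "\<And>a b. mink (L a) (L b) = mink a b"
    using L by (auto simp: proper_orthochronous_lorentz_def A_def B_def C_def D_def)
  have m1: "A*A - C*C = 1" using m[of "(1,0)" "(1,0)"] by (simp add: mink_def A_def C_def)
  have m2: "A*B - C*D = 0" using m[of "(1,0)" "(0,1)"] by (simp add: mink_def A_def B_def C_def D_def)
  have m3: "B*B - D*D = -1" using m[of "(0,1)" "(0,1)"] by (simp add: mink_def B_def D_def)
  have DA: "D = A" using det m1 m2 m3 by algebra
  have BC: "B = C" using det m1 m2 m3 by algebra
  have Lv: "L v = (A * fst v + B * snd v, C * fst v + D * snd v)" for v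
  proof -
    have "L v = L (fst v *\<^sub>R (1,0) + snd v *\<^sub>R (0,1))" by simp
    also have "\<dots> = fst v *\<^sub>R L (1,0) + snd v *\<^sub>R L (0,1)"
      using lin by (simp only: linear_add linear_scale)
    finally show ?thesis by (simp add: A_def B_def C_def D_def prod_eq_iff)
  qed
  have "(A - C) * (A + C) = 1" using m1 by (simp add: algebra_simps)
  then have pos: "A - C > 0" "A + C > 0"
    using A0 by (smt (verit) zero_less_mult_iff)+
  obtain f1 where f1: "f1 \<in> moebius_cover" "\<And>x. f1 (arctan x) = arctan ((A - C) * x + (fst a - snd a))"
    using affine_lift_exists[OF pos(1)] by blast
  obtain f2 where f2: "f2 \<in> moebius_cover" "\<And>x. f2 (arctan x) = arctan ((A + C) * x + (fst a + snd a))"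
    using affine_lift_exists[OF pos(2)] by blast
  have "lifts_poincare (f1, f2) p"
    unfolding lifts_poincare_def using assms f1 f2
    by (auto simp: compactify_def p Lv DA BC algebra_simps)
  then show ?thesis ..
qed

locale moebius_covariant_net = poincare_covariant_net +
  assumes conformal_extension:
    "\<exists>V. unitary_rep conformal_group conformal_mult V \<and>
       (\<forall>g p. lifts_poincare g p \<longrightarrow> V g = U p) \<and>
       (\<forall>S. open S \<and> bounded S \<longrightarrow>
          (\<exists>N. open N \<and> (id, id) \<in> N \<and>
             (\<forall>g\<in>N \<inter> conformal_group. stays_in_minkowski g S \<and>
                conj_op (V g) ` \<A> S = \<A> (local_action g S))))"


section \<open>Asymptotic fields\<close>

definition smooth :: "(real \<Rightarrow> real) \<Rightarrow> bool" where
  "smooth h \<longleftrightarrow> (\<forall>n. (deriv ^^ n) h differentiable_on UNIV)"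

definition averaging_function :: "(real \<Rightarrow> real) \<Rightarrow> bool" where
  "averaging_function h \<longleftrightarrow> smooth h \<and> (\<forall>t. h t \<ge> 0) \<and> (\<forall>t. h (- t) = h t) \<and>
     integrable lborel h \<and> (LINT t|lborel. h t) = 1"

definition scaled :: "(real \<Rightarrow> real) \<Rightarrow> real \<Rightarrow> real \<Rightarrow> real \<Rightarrow> real" where
  "scaled h \<epsilon> \<T> t = \<bar>\<T>\<bar> powr (- \<epsilon>) * h (\<bar>\<T>\<bar> powr (- \<epsilon>) * (t - \<T>))"

definition translate_op ::
  "((spacetime \<Rightarrow> spacetime) \<Rightarrow> 'h::chilbert_space \<Rightarrow> 'h) \<Rightarrow> spacetime \<Rightarrow> ('h \<Rightarrow> 'h) \<Rightarrow> 'h \<Rightarrow> 'h" where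
  "translate_op U a x = conj_op (transl U a) x"

text \<open>
  The sign \<open>\<sigma> = 1\<close> or \<open>\<sigma> = -1\<close> selects \<open>x\<^sub>+\<close> or \<open>x\<^sub>-\<close>.  The operator-valued integral is taken in
  the strong sense.
\<close>

definition light_ray_average ::
  "((spacetime \<Rightarrow> spacetime) \<Rightarrow> 'h::{chilbert_space, second_countable_topology} \<Rightarrow> 'h) \<Rightarrow>
     (real \<Rightarrow> real) \<Rightarrow> real \<Rightarrow> real \<Rightarrow> ('h \<Rightarrow> 'h) \<Rightarrow> real \<Rightarrow> 'h \<Rightarrow> 'h" where
  "light_ray_average U h \<epsilon> \<sigma> x \<T> \<xi> =
     (LINT t|lborel. scaled h \<epsilon> \<T> t *\<^sub>R translate_op U (t, \<sigma> * t) x \<xi>)"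

definition strongly_convergent :: "(real \<Rightarrow> 'h \<Rightarrow> 'h::chilbert_space) \<Rightarrow> real filter \<Rightarrow> bool" where
  "strongly_convergent X F \<longleftrightarrow> (\<forall>\<xi>. \<exists>\<eta>. ((\<lambda>s. X s \<xi>) \<longlongrightarrow> \<eta>) F)"

definition strong_limit :: "(real \<Rightarrow> 'h \<Rightarrow> 'h::chilbert_space) \<Rightarrow> real filter \<Rightarrow> 'h \<Rightarrow> 'h" where
  "strong_limit X F \<xi> = Lim F (\<lambda>s. X s \<xi>)"

definition Phi_in ::
  "((spacetime \<Rightarrow> spacetime) \<Rightarrow> 'h::{chilbert_space, second_countable_topology} \<Rightarrow> 'h) \<Rightarrow>
     (real \<Rightarrow> real) \<Rightarrow> real \<Rightarrow> real \<Rightarrow> ('h \<Rightarrow> 'h) \<Rightarrow> 'h \<Rightarrow> 'h" where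
  "Phi_in U h \<epsilon> \<sigma> x = strong_limit (light_ray_average U h \<epsilon> \<sigma> x) at_bot"

definition Phi_out ::
  "((spacetime \<Rightarrow> spacetime) \<Rightarrow> 'h::{chilbert_space, second_countable_topology} \<Rightarrow> 'h) \<Rightarrow>
     (real \<Rightarrow> real) \<Rightarrow> real \<Rightarrow> real \<Rightarrow> ('h \<Rightarrow> 'h) \<Rightarrow> 'h \<Rightarrow> 'h" where
  "Phi_out U h \<epsilon> \<sigma> x = strong_limit (light_ray_average U h \<epsilon> \<sigma> x) at_top"

end

theory Submission
  imports Defs "HOL-Complex_Analysis.Complex_Analysis"
begin

text \<open>
  Consider \<open>\<sigma> = 1\<close>, where \<open>x(t, t)\<close> is translated along \<open>L\<^sub>-\<close> only, and let \<open>P\<close> project onto the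
  vectors invariant under these translations.  For \<open>t \<rightarrow> \<infinity>\<close> the operator \<open>x(t, t)\<close> commutes with
  any \<open>y \<in> \<A>(I' \<times> J')\<close> if \<open>I'\<close> is to the right of \<open>I\<close>, so by the mean ergodic theorem the averages
  of \<open>x(t, t) y \<Omega>\<close> converge to \<open>y P x \<Omega>\<close>; such vectors are dense (Reeh-Schlieder).  For
  \<open>t \<rightarrow> - \<infinity>\<close> the same holds with \<open>z \<in> \<A>(I'' \<times> J'')\<close> and \<open>I''\<close> to the left of \<open>I\<close>.  Conformal
  covariance supplies the dilations of \<open>L\<^sub>-\<close> alone.  By the Mautner phenomenon they have the same
  invariant vectors, and contracting \<open>J\<close> to the point \<open>0\<close> they make \<open>x\<close> commute with \<open>y\<close> and \<open>z\<close>
  at the same time if \<open>J' < 0 < J''\<close>.  Averaging over the dilations hence gives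
  \<open>\<langle>P x\<^sup>* \<Omega>, z\<^sup>* y \<Omega>\<rangle> = \<langle>z \<Omega>, y P x \<Omega>\<rangle>\<close>, whose two sides are the matrix elements between
  \<open>z \<Omega>\<close> and \<open>y \<Omega>\<close> of the limits at \<open>- \<infinity>\<close> and at \<open>\<infinity>\<close>.
\<close>

section \<open>Complex Hilbert spaces\<close>

text \<open>Translations alone do not link the two limits: locality makes \<open>x(t, t)\<close>
  commute with \<open>y\<close> for late \<open>t\<close> and with \<open>z\<close> for early
  \<open>t\<close>, so the formula with \<open>y\<close> and the formula with \<open>z\<close> hold
  at opposite ends of the orbit. Both formulas see the group only through the projection
  \<open>P\<close> onto its invariant vectors. Any one-parameter group with the same invariant
  vectors, averaged with the same weights, therefore produces the same values, and the dilations are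
  chosen because one end of their orbit satisfies both commutation requirements. Agreement of matrix
  elements between \<open>z \<Omega>\<close> and \<open>y \<Omega>\<close> suffices because the
  averaged operators are bounded by the norm of \<open>x\<close> uniformly in the averaging time;
  the same bound yields existence of the limits on all vectors, which is thus proved and not
  presupposed. One obstacle is specific to conformal covariance: it is available only for group
  elements near the identity, in a neighborhood depending on the region, and has to be propagated
  along the whole dilation group.\<close>

lemma cinner_add_left: "cinner (x + y) z = cinner x z + cinner y z"
  by (metis cinner_commute cinner_add_right complex_cnj_add)

lemma cinner_scaleC_left: "cinner (c *\<^sub>C x) y = cnj c * cinner x y"
  by (metis cinner_commute cinner_scaleC_right complex_cnj_mult)

lemma Im_cinner: "Im (cinner x y) = inner (\<i> *\<^sub>C x) y"
  by (simp flip: Re_cinner add: cinner_scaleC_left)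

text \<open>Expresses the complex form through real inner products, so that boundedness and
  continuity of \<open>cinner x\<close> are inherited from \<open>inner\<close>.\<close>

lemma cinner_eq: "cinner x y = of_real (inner x y) + \<i> * of_real (inner (\<i> *\<^sub>C x) y)"
  by (simp add: complex_eq_iff Re_cinner Im_cinner)

lemma bounded_linear_cinner_right: "bounded_linear (cinner x)"
  unfolding cinner_eq
  by (intro bounded_linear_add bounded_linear_compose[OF bounded_linear_of_real]
      bounded_linear_inner_right
      bounded_linear_compose[OF bounded_linear_mult_right bounded_linear_compose[OF bounded_linear_of_real]])

lemmas continuous_on_cinner_right = bounded_linear.continuous_on[OF bounded_linear_cinner_right]
lemmas tendsto_cinner_right = bounded_linear.tendsto[OF bounded_linear_cinner_right]
lemmas cinner_diff_right = linear_diff[OF bounded_linear.linear[OF bounded_linear_cinner_right]]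
lemmas cinner_zero_right = linear_0[OF bounded_linear.linear[OF bounded_linear_cinner_right]]

lemma cinner_zero_left [simp]: "cinner 0 x = 0"
  by (metis cinner_commute cinner_zero_right complex_cnj_zero)

declare cinner_zero_right [simp]

lemma cinner_diff_left: "cinner (x - y) z = cinner x z - cinner y z"
  by (metis cinner_commute cinner_diff_right complex_cnj_diff)

lemma cinner_self: "cinner x x = of_real ((norm x)\<^sup>2)"
proof -
  have "Im (cinner x x) = 0"
    using arg_cong[OF cinner_commute[of x x], of Im] by simp
  then show ?thesis by (simp add: complex_eq_iff Re_cinner power2_norm_eq_inner)
qed

lemma cmod_cinner_self: "cmod (cinner x x) = (norm x)\<^sup>2"
  unfolding cinner_self norm_of_real by simp

lemma cinner_self_eq_0 [simp]: "cinner x x = 0 \<longleftrightarrow> x = 0"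
  by (simp add: cinner_self)

lemma cinner_ext: "(\<And>z. cinner z x = cinner z y) \<Longrightarrow> x = y"
  by (metis cinner_diff_right cinner_self_eq_0 diff_self eq_iff_diff_eq_0)

lemma cinner_ext_left: "(\<And>z. cinner x z = cinner y z) \<Longrightarrow> x = y"
  by (metis cinner_commute cinner_ext)

lemma scaleC_zero_right [simp]: "c *\<^sub>C 0 = 0"
  by (metis add_cancel_right_left scaleC_add_right)

lemma norm_scaleC: "norm (c *\<^sub>C x) = cmod c * norm x"
proof -
  have "complex_of_real ((norm (c *\<^sub>C x))\<^sup>2) = of_real ((cmod c * norm x)\<^sup>2)"
    unfolding cinner_self[symmetric] cinner_scaleC_left cinner_scaleC_right
    by (simp add: cinner_self power_mult_distrib flip: mult.assoc complex_norm_square)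
  then show ?thesis
    by (metis norm_ge_zero of_real_eq_iff power2_eq_imp_eq zero_le_mult_iff)
qed

lemma bounded_linear_scaleC: "bounded_linear (\<lambda>x::'a::complex_inner. c *\<^sub>C x)"
proof (rule bounded_linear_intro)
  show "c *\<^sub>C (r *\<^sub>R x) = r *\<^sub>R c *\<^sub>C x" for r and x :: 'a
    by (simp add: scaleC_scaleC mult.commute flip: scaleC_of_real)
  show "norm (c *\<^sub>C x) \<le> norm x * cmod c" for x :: 'a by (simp add: norm_scaleC)
qed (rule scaleC_add_right)

lemma scaleC_minus_one: "(-1) *\<^sub>C x = - x"
  using scaleC_of_real[of "-1" x] by simp

text \<open>Multiplying \<open>y\<close> by a phase makes the product real and nonnegative, which
  reduces the bound to the real Cauchy-Schwarz inequality.\<close>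

lemma cmod_cinner_le: "cmod (cinner x y) \<le> norm x * norm y"
proof (cases "cinner x y = 0")
  case False
  define c where "c = cnj (sgn (cinner x y))"
  have "c * cinner x y = of_real (cmod (cinner x y))"
    using False by (simp add: c_def sgn_eq complex_norm_square[symmetric] power2_eq_square mult.commute)
  then have "cmod (cinner x y) = Re (cinner x (c *\<^sub>C y))"
    by (simp add: cinner_scaleC_right)
  also have "\<dots> \<le> norm x * norm (c *\<^sub>C y)"
    unfolding Re_cinner by (rule norm_cauchy_schwarz)
  also have "\<dots> = norm x * norm y" using False by (simp add: norm_scaleC c_def norm_sgn)
  finally show ?thesis .
qed auto

subsection \<open>Orthogonal projections and adjoints\<close>

definition csubspace :: "'h::chilbert_space set \<Rightarrow> bool" where
  "csubspace K \<longleftrightarrow> 0 \<in> K \<and> (\<forall>x\<in>K. \<forall>y\<in>K. x + y \<in> K) \<and> (\<forall>c. \<forall>x\<in>K. c *\<^sub>C x \<in> K)"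

lemma csubspaceD:
  assumes "csubspace K"
  shows "0 \<in> K" "x \<in> K \<Longrightarrow> y \<in> K \<Longrightarrow> x + y \<in> K" "x \<in> K \<Longrightarrow> c *\<^sub>C x \<in> K"
    "x \<in> K \<Longrightarrow> y \<in> K \<Longrightarrow> x - y \<in> K" "x \<in> K \<Longrightarrow> r *\<^sub>R x \<in> K"
proof -
  show *: "0 \<in> K" "x \<in> K \<Longrightarrow> y \<in> K \<Longrightarrow> x + y \<in> K" "x \<in> K \<Longrightarrow> c *\<^sub>C x \<in> K" for x y c
    using assms by (auto simp: csubspace_def)
  show "x \<in> K \<Longrightarrow> y \<in> K \<Longrightarrow> x - y \<in> K"
    using *(2)[of x "(-1) *\<^sub>C y"] *(3)[of y "-1"] by (simp add: scaleC_minus_one)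
  show "x \<in> K \<Longrightarrow> r *\<^sub>R x \<in> K" using *(3)[of x "of_real r"] by (simp add: scaleC_of_real)
qed

text \<open>A minimizing sequence is Cauchy by the parallelogram law, because midpoints stay in
  \<open>K\<close> and cannot be closer to \<open>x\<close> than the infimum.\<close>

lemma closed_subspace_minimizer:
  fixes K :: "'h::chilbert_space set"
  assumes K: "csubspace K" "closed K"
  obtains p where "p \<in> K" "\<And>k. k \<in> K \<Longrightarrow> norm (x - p) \<le> norm (x - k)"
proof -
  define d where "d = infdist x K"
  have ne: "K \<noteq> {}" using csubspaceD(1)[OF K(1)] by auto
  have dle: "d \<le> norm (x - k)" if "k \<in> K" for k
    using infdist_le[OF that, of x] by (simp add: d_def dist_norm)
  have d0: "d \<ge> 0" by (simp add: d_def infdist_nonneg)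
  have "\<exists>k\<in>K. norm (x - k) < d + 1 / Suc n" for n :: nat
  proof -
    have "(INF k\<in>K. dist x k) < d + 1 / Suc n"
      using infdist_notempty[OF ne, of x] by (simp add: d_def)
    then obtain k where "k \<in> K" "dist x k < d + 1 / Suc n"
      using cINF_less_iff[OF ne bdd_belowI2[of K 0 "dist x"]] by (metis zero_le_dist)
    then show ?thesis by (auto simp: dist_norm)
  qed
  then obtain k where k: "\<And>n. k n \<in> K" "\<And>n. norm (x - k n) < d + 1 / Suc n" by metis
  have lim: "(\<lambda>n. norm (x - k n)) \<longlonglongrightarrow> d"
  proof (rule tendsto_sandwich[of "\<lambda>_. d" _ _ "\<lambda>n. d + 1 / Suc n"])
    show "(\<lambda>n. d + 1 / real (Suc n)) \<longlonglongrightarrow> d"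
      using tendsto_add[OF tendsto_const LIMSEQ_inverse_real_of_nat, of d] by (simp add: inverse_eq_divide)
  qed (use k dle in \<open>auto intro!: eventuallyI less_imp_le simp del: of_nat_Suc\<close>)
  have par: "(norm (k m - k n))\<^sup>2 \<le> 2 * (norm (x - k m))\<^sup>2 + 2 * (norm (x - k n))\<^sup>2 - 4 * d\<^sup>2" for m n
  proof -
    let ?c = "(1/2) *\<^sub>R (k m + k n)"
    have "?c \<in> K" using K(1) k(1) by (intro csubspaceD) auto
    then have "d\<^sup>2 \<le> (norm (x - ?c))\<^sup>2" using dle d0 by (intro power_mono)
    moreover have "(norm (k m - k n))\<^sup>2 = 2 * (norm (x - k m))\<^sup>2 + 2 * (norm (x - k n))\<^sup>2 - 4 * (norm (x - ?c))\<^sup>2"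
      by (simp add: power2_norm_eq_inner algebra_simps inner_commute)
    ultimately show ?thesis by linarith
  qed
  have "Cauchy k"
  proof (rule CauchyI)
    fix e :: real assume "e > 0"
    have "(\<lambda>n. 2 * (norm (x - k n))\<^sup>2 - 2 * d\<^sup>2) \<longlonglongrightarrow> 2 * d\<^sup>2 - 2 * d\<^sup>2"
      by (intro tendsto_intros lim)
    then have "(\<lambda>n. 2 * (norm (x - k n))\<^sup>2 - 2 * d\<^sup>2) \<longlonglongrightarrow> 0" by simp
    then have "eventually (\<lambda>n. 2 * (norm (x - k n))\<^sup>2 - 2 * d\<^sup>2 < e\<^sup>2 / 2) sequentially"
      using \<open>e > 0\<close> by (intro order_tendstoD(2)) auto
    then obtain M where M: "\<And>n. n \<ge> M \<Longrightarrow> 2 * (norm (x - k n))\<^sup>2 - 2 * d\<^sup>2 < e\<^sup>2 / 2"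
      by (auto simp: eventually_sequentially)
    have "norm (k m - k n) < e" if "m \<ge> M" "n \<ge> M" for m n
    proof -
      have "(norm (k m - k n))\<^sup>2 < e\<^sup>2" using par[of m n] M[OF that(1)] M[OF that(2)] by linarith
      then show ?thesis using \<open>e > 0\<close> power_less_imp_less_base by fastforce
    qed
    then show "\<exists>M. \<forall>m\<ge>M. \<forall>n\<ge>M. norm (k m - k n) < e" by blast
  qed
  then obtain p where p: "k \<longlonglongrightarrow> p" using Cauchy_convergent convergent_def by blast
  have "p \<in> K" using closed_sequentially[OF K(2)] k(1) p by blast
  moreover have "norm (x - p) = d"
    using tendsto_norm[OF tendsto_diff[OF tendsto_const p]] lim LIMSEQ_unique by blast
  ultimately show ?thesis using dle that by blast
qed

lemma orthogonal_decomposition: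
  fixes K :: "'h::chilbert_space set"
  assumes K: "csubspace K" "closed K"
  shows "\<exists>!p. p \<in> K \<and> (\<forall>k\<in>K. cinner k (x - p) = 0)"
proof -
  obtain p where p: "p \<in> K" "\<And>k. k \<in> K \<Longrightarrow> norm (x - p) \<le> norm (x - k)"
    using closed_subspace_minimizer[OF assms] by blast
  have re: "inner k (x - p) = 0" if k: "k \<in> K" for k
  proof (rule ccontr)
    assume n: "inner k (x - p) \<noteq> 0"
    then have kk: "inner k k > 0" by auto
    \<comment> \<open>The best step from \<open>p\<close> in the direction \<open>k\<close>; it
      would strictly decrease the distance if \<open>k\<close> were not orthogonal to
      \<open>x - p\<close>.\<close>
    define t where "t = inner k (x - p) / inner k k"
    have "(norm (x - p))\<^sup>2 \<le> (norm (x - (p + t *\<^sub>R k)))\<^sup>2"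
      using p k by (intro power_mono p(2) csubspaceD[OF K(1)]) auto
    also have "\<dots> = (norm (x - p))\<^sup>2 - 2 * t * inner k (x - p) + t * t * inner k k"
      by (simp add: power2_norm_eq_inner algebra_simps inner_commute)
    also have "t * t * inner k k = t * inner k (x - p)" using kk by (simp add: t_def)
    finally have "t * inner k (x - p) \<le> 0" by simp
    moreover have "t * inner k (x - p) > 0"
      using n kk by (simp add: t_def zero_less_mult_iff zero_less_divide_iff)
        (metis linorder_neqE_linordered_idom)
    ultimately show False by simp
  qed
  \<comment> \<open>\<open>re\<close> settles the real part; its instance at
    \<open>\<i> *\<^sub>C k\<close>, again in \<open>K\<close>, settles the imaginary part.\<close>
  have "\<forall>k\<in>K. cinner k (x - p) = 0"
    using re csubspaceD(3)[OF K(1)] by (simp add: cinner_eq)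
  moreover have "q = p" if q: "q \<in> K" "\<forall>k\<in>K. cinner k (x - q) = 0" for q
  proof -
    have "q - p \<in> K" by (intro csubspaceD[OF K(1)] q p)
    then have "cinner (q - p) (x - p) - cinner (q - p) (x - q) = 0"
      using q calculation by simp
    then have "cinner (q - p) (q - p) = 0" by (simp add: cinner_diff_right)
    then show ?thesis by simp
  qed
  ultimately show ?thesis using p(1) by blast
qed

definition oproj :: "'h::chilbert_space set \<Rightarrow> 'h \<Rightarrow> 'h" where
  "oproj K x = (THE p. p \<in> K \<and> (\<forall>k\<in>K. cinner k (x - p) = 0))"

context
  fixes K :: "'h::chilbert_space set"
  assumes K: "csubspace K" "closed K"
begin

lemma oproj_mem: "oproj K x \<in> K"
  and oproj_orth: "k \<in> K \<Longrightarrow> cinner k (x - oproj K x) = 0"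
  using theI'[OF orthogonal_decomposition[OF K, of x]] unfolding oproj_def by auto

lemma oproj_eqI: "p \<in> K \<Longrightarrow> (\<And>k. k \<in> K \<Longrightarrow> cinner k (x - p) = 0) \<Longrightarrow> oproj K x = p"
  using orthogonal_decomposition[OF K, of x] oproj_mem oproj_orth by blast

text \<open>Both sides equal \<open>cinner (oproj K x) (oproj K y)\<close>.\<close>

lemma oproj_selfadjoint: "cinner (oproj K x) y = cinner x (oproj K y)"
proof -
  have "cinner (oproj K x) y = cinner (oproj K x) (oproj K y)"
    using oproj_orth[OF oproj_mem, of x y] by (simp add: cinner_diff_right)
  moreover have "cinner (oproj K y) x = cinner (oproj K y) (oproj K x)"
    using oproj_orth[OF oproj_mem, of y x] by (simp add: cinner_diff_right)
  ultimately show ?thesis by (metis cinner_commute)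
qed

text \<open>Linearity follows from self-adjointness by testing against all vectors; the bound is
  Cauchy-Schwarz applied to \<open>cinner (oproj K x) x\<close>.\<close>

lemma bounded_clinear_oproj: "bounded_clinear (oproj K)"
proof -
  have add: "oproj K (x + y) = oproj K x + oproj K y" for x y
    by (rule cinner_ext_left) (simp add: oproj_selfadjoint cinner_add_left)
  have sc: "oproj K (c *\<^sub>C x) = c *\<^sub>C oproj K x" for c x
    by (rule cinner_ext_left) (simp add: oproj_selfadjoint cinner_scaleC_left)
  have le: "norm (oproj K x) \<le> norm x" for x
  proof -
    have "(norm (oproj K x))\<^sup>2 = cmod (cinner (oproj K x) (oproj K x))"
      by (simp add: cmod_cinner_self)
    also have "\<dots> = cmod (cinner (oproj K x) x)"
      using oproj_orth[OF oproj_mem, of x x] by (simp add: cinner_diff_right)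
    also have "\<dots> \<le> norm (oproj K x) * norm x" by (rule cmod_cinner_le)
    finally show ?thesis by (cases "oproj K x = 0") (auto simp: power2_eq_square)
  qed
  have "bounded_linear (oproj K)"
    by (rule bounded_linear_intro[of _ 1]) (use add sc[of "of_real _"] le in \<open>auto simp: scaleC_of_real\<close>)
  then show ?thesis using sc by (simp add: bounded_clinear_def)
qed

end

section \<open>Riesz representation and adjoint operators\<close>

lemma bounded_clinearD:
  assumes "bounded_clinear x"
  shows "bounded_linear x" "x (c *\<^sub>C \<xi>) = c *\<^sub>C x \<xi>"
  using assms by (auto simp: bounded_clinear_def)

text \<open>If \<open>f\<close> is not zero, its kernel is a closed subspace whose orthogonal
  complement is spanned by one vector, found as the component \<open>v\<close> of any
  \<open>u\<close> with \<open>f u \<noteq> 0\<close>.\<close>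

lemma riesz:
  fixes f :: "'h::chilbert_space \<Rightarrow> complex"
  assumes f: "bounded_linear f" and fc: "\<And>c x. f (c *\<^sub>C x) = c * f x"
  shows "\<exists>y. \<forall>x. f x = cinner y x"
proof (cases "\<forall>x. f x = 0")
  case True
  then show ?thesis by (intro exI[of _ 0]) auto
next
  case False
  then obtain u where u: "f u \<noteq> 0" by blast
  interpret f: bounded_linear f by fact
  define K where "K = {x. f x = 0}"
  have "csubspace K" by (auto simp: csubspace_def K_def f.zero f.add fc)
  moreover have "closed K" unfolding K_def
    by (intro closed_Collect_eq f.continuous_on continuous_on_id continuous_on_const)
  ultimately have K: "csubspace K" "closed K" .
  define v where "v = u - oproj K u"
  have fv: "f v = f u" using oproj_mem[OF K, of u] by (simp add: v_def K_def f.diff)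
  then have v0: "v \<noteq> 0" using u f.zero by auto
  have orth: "cinner v k = 0" if "k \<in> K" for k
    using oproj_orth[OF K that, of u] cinner_commute[of k v] by (simp add: v_def)
  \<comment> \<open>The factor is chosen to give \<open>cinner y v = f v\<close>.\<close>
  define y where "y = cnj (f v / cinner v v) *\<^sub>C v"
  have "f x = cinner y x" for x
  proof -
    have "x - (f x / f v) *\<^sub>C v \<in> K" using u by (simp add: K_def f.diff fc fv)
    from orth[OF this] have "cinner v x = (f x / f v) * cinner v v"
      by (simp add: cinner_diff_right cinner_scaleC_right)
    then show ?thesis using v0 u by (simp add: y_def cinner_scaleC_left fv)
  qed
  then show ?thesis by blast
qed

lemma cadjoint_eqI:
  assumes "\<And>\<xi> \<eta>. cinner (y \<xi>) \<eta> = cinner \<xi> (x \<eta>)"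
  shows "cadjoint x = y"
  unfolding cadjoint_def
proof (rule the_equality)
  fix z assume "\<forall>\<xi> \<eta>. cinner (z \<xi>) \<eta> = cinner \<xi> (x \<eta>)"
  then show "z = y" using assms by (metis cinner_ext_left ext)
qed (use assms in auto)

text \<open>The definite description in \<open>cadjoint\<close> becomes usable here: Riesz supplies
  a candidate, and its linearity and boundedness are read off from the defining relation.\<close>

lemma cadjoint_props:
  fixes x :: "'h::chilbert_space \<Rightarrow> 'h"
  assumes x: "bounded_clinear x"
  shows cinner_cadjoint: "cinner (cadjoint x \<xi>) \<eta> = cinner \<xi> (x \<eta>)"
    and bounded_clinear_cadjoint: "bounded_clinear (cadjoint x)"
proof -
  interpret x: bounded_linear x using x by (rule bounded_clinearD)
  have "\<exists>y. \<forall>\<eta>. cinner \<xi> (x \<eta>) = cinner y \<eta>" for \<xi>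
    by (rule riesz) (use bounded_linear_compose[OF bounded_linear_cinner_right x.bounded_linear_axioms]
      in \<open>auto simp: o_def bounded_clinearD(2)[OF x] cinner_scaleC_right\<close>)
  then obtain y where y: "\<And>\<xi> \<eta>. cinner \<xi> (x \<eta>) = cinner (y \<xi>) \<eta>" by metis
  have cy: "cadjoint x = y" by (rule cadjoint_eqI) (simp add: y)
  show "cinner (cadjoint x \<xi>) \<eta> = cinner \<xi> (x \<eta>)" by (simp add: cy y)
  have add: "y (a + b) = y a + y b" for a b
    by (rule cinner_ext_left) (simp add: cinner_add_left flip: y)
  have sc: "y (c *\<^sub>C a) = c *\<^sub>C y a" for a c
    by (rule cinner_ext_left) (simp add: cinner_scaleC_left flip: y)
  obtain B where B: "\<And>a. norm (x a) \<le> norm a * B" "B \<ge> 0" using x.nonneg_bounded by blast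
  have "norm (y a) \<le> norm a * B" for a
  proof -
    have "(norm (y a))\<^sup>2 = cmod (cinner a (x (y a)))" by (simp add: y cmod_cinner_self)
    also have "\<dots> \<le> norm a * norm (x (y a))" by (rule cmod_cinner_le)
    also have "\<dots> \<le> norm a * (norm (y a) * B)" by (intro mult_left_mono B) auto
    finally have "norm (y a) * norm (y a) \<le> norm (y a) * (norm a * B)"
      by (simp add: power2_eq_square mult_ac)
    then show ?thesis using B(2) by (cases "y a = 0") auto
  qed
  then have "bounded_linear y"
    by (intro bounded_linear_intro[of _ B]) (use add sc[of "of_real _"] in \<open>auto simp: scaleC_of_real\<close>)
  then show "bounded_clinear (cadjoint x)" using sc by (simp add: bounded_clinear_def cy)
qed

lemma cinner_cadjoint': "bounded_clinear x \<Longrightarrow> cinner \<xi> (cadjoint x \<eta>) = cinner (x \<xi>) \<eta>"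
  by (metis cinner_cadjoint cinner_commute)

lemma cadjoint_cadjoint: "bounded_clinear x \<Longrightarrow> cadjoint (cadjoint x) = x"
  by (rule cadjoint_eqI) (simp add: cinner_cadjoint')

lemma bounded_clinear_comp: "bounded_clinear x \<Longrightarrow> bounded_clinear y \<Longrightarrow> bounded_clinear (x \<circ> y)"
  unfolding bounded_clinear_def o_def using bounded_linear_compose by auto

lemma cadjoint_comp:
  "bounded_clinear x \<Longrightarrow> bounded_clinear y \<Longrightarrow> cadjoint (x \<circ> y) = cadjoint y \<circ> cadjoint x"
  by (rule cadjoint_eqI) (simp add: cinner_cadjoint)

lemma unitary_opD:
  assumes "unitary_op u"
  shows "bounded_clinear u" "cinner (u \<xi>) (u \<eta>) = cinner \<xi> \<eta>" "norm (u \<xi>) = norm \<xi>"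
    "cadjoint u (u \<xi>) = \<xi>" "u (cadjoint u \<xi>) = \<xi>"
proof -
  show b: "bounded_clinear u" and i: "cinner (u \<xi>) (u \<eta>) = cinner \<xi> \<eta>" for \<xi> \<eta>
    using assms by (auto simp: unitary_op_def)
  show "norm (u \<xi>) = norm \<xi>" using i[of \<xi> \<xi>] by (simp add: norm_eq_sqrt_inner flip: Re_cinner)
  show *: "cadjoint u (u \<xi>) = \<xi>" for \<xi>
    by (rule cinner_ext_left) (simp add: cinner_cadjoint[OF b] i)
  obtain \<zeta> where "\<xi> = u \<zeta>" using assms by (metis unitary_op_def surj_def)
  then show "u (cadjoint u \<xi>) = \<xi>" by (simp add: *)
qed

subsection \<open>Von Neumann algebras\<close>

lemma commutant_antimono: "S \<subseteq> T \<Longrightarrow> commutant T \<subseteq> commutant S"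
  by (auto simp: commutant_def)

lemma subset_bicommutant: "(\<And>x. x \<in> S \<Longrightarrow> bounded_clinear x) \<Longrightarrow> S \<subseteq> commutant (commutant S)"
  by (auto simp: commutant_def)

text \<open>Triple commutants collapse to commutants, and closure of \<open>S\<close> under adjoints
  allows commutation relations to be conjugated.\<close>

lemma von_neumann_commutant:
  assumes S: "\<And>x. x \<in> S \<Longrightarrow> bounded_clinear x" "\<And>x. x \<in> S \<Longrightarrow> cadjoint x \<in> S"
  shows "von_neumann_algebra (commutant S)"
  unfolding von_neumann_algebra_def
proof (intro conjI ballI)
  fix y assume y: "y \<in> commutant S"
  then show bc: "bounded_clinear y" by (auto simp: commutant_def)
  have "x \<circ> cadjoint y = cadjoint y \<circ> x" if "x \<in> S" for x
  proof -
    have "cadjoint x \<circ> y = y \<circ> cadjoint x" using y S(2)[OF that] by (auto simp: commutant_def)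
    then have "cadjoint (cadjoint x \<circ> y) = cadjoint (y \<circ> cadjoint x)" by (rule arg_cong)
    then show ?thesis
      unfolding cadjoint_comp[OF S(1)[OF S(2)[OF that]] bc] cadjoint_comp[OF bc S(1)[OF S(2)[OF that]]]
        cadjoint_cadjoint[OF S(1)[OF that]] by (rule sym)
  qed
  then show "cadjoint y \<in> commutant S" using bounded_clinear_cadjoint[OF bc] by (auto simp: commutant_def)
next
  show "commutant (commutant (commutant S)) = commutant S"
  proof
    show "commutant (commutant (commutant S)) \<subseteq> commutant S"
      by (intro commutant_antimono subset_bicommutant S(1))
    show "commutant S \<subseteq> commutant (commutant (commutant S))"
      by (rule subset_bicommutant) (simp add: commutant_def)
  qed
qed

lemma von_neumann_algebraD:
  assumes M: "von_neumann_algebra M"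
  shows "x \<in> M \<Longrightarrow> bounded_clinear x" "x \<in> M \<Longrightarrow> cadjoint x \<in> M" "id \<in> M"
    "x \<in> M \<Longrightarrow> y \<in> M \<Longrightarrow> x \<circ> y \<in> M" "x \<in> M \<Longrightarrow> y \<in> M \<Longrightarrow> (\<lambda>\<xi>. x \<xi> + y \<xi>) \<in> M"
    "x \<in> M \<Longrightarrow> (\<lambda>\<xi>. c *\<^sub>C x \<xi>) \<in> M"
proof -
  show a: "x \<in> M \<Longrightarrow> bounded_clinear x" "x \<in> M \<Longrightarrow> cadjoint x \<in> M" for x
    using M by (auto simp: von_neumann_algebra_def)
  define C where "C = commutant M"
  \<comment> \<open>Closure under the algebra operations is not part of the definition; it is
    inherited from \<open>M\<close> being a commutant.\<close>
  have m: "M = commutant C" using M by (simp add: von_neumann_algebra_def C_def)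
  have C: "bounded_clinear z" if "z \<in> C" for z using that by (auto simp: C_def commutant_def)
  have id: "bounded_clinear (id :: 'a \<Rightarrow> 'a)" by (simp add: bounded_clinear_def id_def bounded_linear_ident)
  show "id \<in> M" using id by (simp add: m commutant_def)
  show "x \<circ> y \<in> M" if "x \<in> M" "y \<in> M"
    using that bounded_clinear_comp unfolding m commutant_def by (auto simp: o_def fun_eq_iff)
  show "(\<lambda>\<xi>. x \<xi> + y \<xi>) \<in> M" if "x \<in> M" "y \<in> M"
    using that C unfolding m commutant_def
    by (auto simp: o_def fun_eq_iff bounded_clinear_def bounded_linear_add scaleC_add_right
        linear_add[OF bounded_linear.linear])
  show "(\<lambda>\<xi>. c *\<^sub>C x \<xi>) \<in> M" if "x \<in> M"
    using that C unfolding m commutant_def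
    by (auto simp: o_def fun_eq_iff bounded_clinear_def scaleC_scaleC mult.commute
        intro: bounded_linear_compose[OF bounded_linear_scaleC])
qed

lemma csubspace_orbit:
  assumes "von_neumann_algebra M"
  shows "csubspace {x \<Omega> | x. x \<in> M}"
  unfolding csubspace_def
proof (safe)
  have "(\<lambda>\<xi>. 0 *\<^sub>C id \<xi>) \<in> M" by (intro von_neumann_algebraD[OF assms])
  moreover have "0 *\<^sub>C \<xi> = 0" for \<xi> :: 'a using scaleC_of_real[of 0 \<xi>] by simp
  ultimately show "\<exists>x. 0 = x \<Omega> \<and> x \<in> M" by (metis (no_types, lifting))
  show "\<exists>z. x \<Omega> + y \<Omega> = z \<Omega> \<and> z \<in> M" if "x \<in> M" "y \<in> M" for x y
    using von_neumann_algebraD(5)[OF assms that] by (metis (no_types, lifting))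
  show "\<exists>z. c *\<^sub>C x \<Omega> = z \<Omega> \<and> z \<in> M" if "x \<in> M" for c x
    using von_neumann_algebraD(6)[OF assms that] by (metis (no_types, lifting))
qed

text \<open>\<open>M\<close> is the commutant of the projection onto \<open>L\<close>.\<close>

lemma von_neumann_algebra_orthogonal_vector:
  assumes S: "\<And>x. x \<in> S \<Longrightarrow> bounded_clinear x" "\<And>x. x \<in> S \<Longrightarrow> cadjoint x \<in> S"
    and L: "csubspace L" "closed L" "\<And>x \<psi>. x \<in> S \<Longrightarrow> \<psi> \<in> L \<Longrightarrow> x \<psi> \<in> L"
    and \<Omega>: "\<And>\<psi>. \<psi> \<in> L \<Longrightarrow> cinner \<psi> \<Omega> = 0"
  shows "\<exists>M. von_neumann_algebra M \<and> S \<subseteq> M \<and> (\<forall>x\<in>M. \<forall>\<psi>\<in>L. cinner \<psi> (x \<Omega>) = 0)"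
proof -
  let ?M = "commutant {oproj L}"
  note bL = bounded_clinear_oproj[OF L(1,2)]
  have ad: "cadjoint (oproj L) = oproj L" by (rule cadjoint_eqI) (rule oproj_selfadjoint[OF L(1,2)])
  have 1: "von_neumann_algebra ?M" by (rule von_neumann_commutant) (auto simp only: singleton_iff bL ad)
  have 2: "S \<subseteq> ?M"
  proof
    fix x assume x: "x \<in> S"
    have "oproj L (x \<xi>) = x (oproj L \<xi>)" for \<xi>
    proof (rule oproj_eqI[OF L(1,2)])
      show "x (oproj L \<xi>) \<in> L" by (rule L(3)[OF x oproj_mem[OF L(1,2)]])
      fix k assume "k \<in> L"
      then have "cadjoint x k \<in> L" by (rule L(3)[OF S(2)[OF x]])
      from oproj_orth[OF L(1,2) this, of \<xi>] have "cinner k (x (\<xi> - oproj L \<xi>)) = 0"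
        unfolding cinner_cadjoint[OF S(1)[OF x]] .
      then show "cinner k (x \<xi> - x (oproj L \<xi>)) = 0"
        unfolding linear_diff[OF bounded_linear.linear[OF bounded_clinearD(1)[OF S(1)[OF x]]]] .
    qed
    then show "x \<in> ?M" using S(1)[OF x] by (simp add: commutant_def fun_eq_iff)
  qed
  have 3: "cinner \<psi> (x \<Omega>) = 0" if x: "x \<in> ?M" and \<psi>: "\<psi> \<in> L" for x \<psi>
  proof -
    have bx: "bounded_clinear x" using x by (simp add: commutant_def)
    have "oproj L \<Omega> = 0"
      by (rule oproj_eqI[OF L(1,2)]) (use \<Omega> csubspaceD(1)[OF L(1)] in auto)
    then have "x (oproj L \<Omega>) = 0"
      using linear_0[OF bounded_linear.linear[OF bounded_clinearD(1)[OF bx]]] by simp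
    moreover have "oproj L (x \<Omega>) = x (oproj L \<Omega>)"
      using x by (simp add: commutant_def) (metis comp_apply)
    ultimately show ?thesis using oproj_orth[OF L(1,2) \<psi>, of "x \<Omega>"] by simp
  qed
  show ?thesis using 1 2 3 by blast
qed

section \<open>Averages and the mean ergodic theorem\<close>

locale averaging =
  fixes h :: "real \<Rightarrow> real" and \<epsilon> :: real
  assumes eps: "0 < \<epsilon>" "\<epsilon> < 1" and h: "averaging_function h"
begin

text \<open>The weights of \<open>light_ray_average\<close> for functions with arbitrary Banach
  space values, so that operator orbits, orbits of vectors and matrix elements are averaged
  alike.\<close>

definition avg :: "real \<Rightarrow> (real \<Rightarrow> 'b::{banach, second_countable_topology}) \<Rightarrow> 'b" where
  "avg \<T> f = (LINT t|lborel. scaled h \<epsilon> \<T> t *\<^sub>R f t)"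

lemma h_nonneg: "h t \<ge> 0" and h_even: "h (- t) = h t"
  and h_integrable: "integrable lborel h" and h_integral: "(LINT t|lborel. h t) = 1"
  and h_cont: "continuous_on UNIV h"
proof -
  show "h t \<ge> 0" "h (- t) = h t" "integrable lborel h" "(LINT t|lborel. h t) = 1"
    using h by (auto simp: averaging_function_def)
  have "(deriv ^^ 0) h differentiable_on UNIV"
    using h unfolding averaging_function_def smooth_def by blast
  then show "continuous_on UNIV h" by (simp add: differentiable_imp_continuous_on)
qed

text \<open>The substitution of \<open>\<T> + \<bar>\<T>\<bar> powr \<epsilon> * s\<close> for
  \<open>t\<close> replaces the moving weight by the fixed density \<open>h\<close>, which supplies
  integrable majorants independent of \<open>\<T>\<close>.\<close>

lemma avg_eq:
  assumes "\<T> \<noteq> 0"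
  shows "avg \<T> f = (LINT s|lborel. h s *\<^sub>R f (\<T> + \<bar>\<T>\<bar> powr \<epsilon> * s))"
proof -
  let ?c = "\<bar>\<T>\<bar> powr \<epsilon>"
  have c: "?c > 0" "\<bar>\<T>\<bar> powr (- \<epsilon>) = inverse ?c" using assms by (auto simp: powr_minus)
  have "avg \<T> f = ?c *\<^sub>R (LINT s|lborel. scaled h \<epsilon> \<T> (\<T> + ?c * s) *\<^sub>R f (\<T> + ?c * s))"
    unfolding avg_def by (subst lborel_integral_real_affine[of ?c _ \<T>]) (use c in auto)
  also have "\<dots> = (LINT s|lborel. h s *\<^sub>R f (\<T> + ?c * s))"
    by (subst integral_scaleR_right[symmetric])
      (use c in \<open>simp add: scaled_def c(2) mult.assoc[symmetric] flip: mult.assoc\<close>)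
  finally show ?thesis .
qed

text \<open>Evenness of \<open>h\<close> turns limits at \<open>at_bot\<close> into limits at
  \<open>at_top\<close> for the time-reversed function, so that only the latter have to be
  studied.\<close>

lemma avg_uminus: "avg (- \<T>) f = avg \<T> (\<lambda>t. f (- t))"
proof -
  have "avg (- \<T>) f = (LINT t|lborel. scaled h \<epsilon> (- \<T>) (0 + (-1) * t) *\<^sub>R f (0 + (-1) * t))"
    unfolding avg_def by (subst lborel_integral_real_affine[of "-1" _ 0]) auto
  moreover have "scaled h \<epsilon> (- \<T>) (- t) = scaled h \<epsilon> \<T> t" for t
    using h_even[of "\<bar>\<T>\<bar> powr - \<epsilon> * (t - \<T>)"] by (simp add: scaled_def algebra_simps)
  ultimately show ?thesis by (simp add: avg_def)
qed

lemma norm_weight: "norm (h s *\<^sub>R v) = h s * norm v"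
  by (simp add: h_nonneg)

lemma weighted_integrable:
  fixes f :: "real \<Rightarrow> 'b::{banach, second_countable_topology}"
  assumes "continuous_on UNIV f" "\<And>t. norm (f t) \<le> B"
  shows "integrable lborel (\<lambda>s. h s *\<^sub>R f (a + c * s))"
proof (rule Bochner_Integration.integrable_bound)
  show "integrable lborel (\<lambda>s. B * h s)" using h_integrable by simp
  have "continuous_on UNIV (\<lambda>s. h s *\<^sub>R f (a + c * s))"
    by (intro continuous_on_scaleR h_cont continuous_on_compose2[OF assms(1)] continuous_intros) auto
  then show "(\<lambda>s. h s *\<^sub>R f (a + c * s)) \<in> borel_measurable lborel"
    using borel_measurable_continuous_onI by auto
  show "AE x in lborel. norm (h x *\<^sub>R f (a + c * x)) \<le> norm (B * h x)"
  proof (rule AE_I2)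
    fix x
    have "norm (f (a + c * x)) \<le> \<bar>B\<bar>" using assms(2)[of "a + c * x"] by linarith
    then show "norm (h x *\<^sub>R f (a + c * x)) \<le> norm (B * h x)"
      by (simp add: norm_weight abs_mult h_nonneg mult.commute[of "\<bar>B\<bar>"] mult_left_mono)
  qed
qed

lemma avg_add:
  assumes "continuous_on UNIV f" "\<And>t. norm (f t) \<le> B" "continuous_on UNIV g" "\<And>t. norm (g t) \<le> C" "\<T> \<noteq> 0"
  shows "avg \<T> (\<lambda>t. f t + g t) = avg \<T> f + avg \<T> g"
  unfolding avg_eq[OF assms(5)] scaleR_add_right
  by (rule Bochner_Integration.integral_add) (rule weighted_integrable assms)+

lemma avg_const: "\<T> \<noteq> 0 \<Longrightarrow> avg \<T> (\<lambda>t. c) = c"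
  by (simp add: avg_eq h_integral h_integrable)

lemma avg_linear:
  assumes "bounded_linear L" "continuous_on UNIV f" "\<And>t. norm (f t) \<le> B" "\<T> \<noteq> 0"
  shows "avg \<T> (\<lambda>t. L (f t)) = L (avg \<T> f)"
  unfolding avg_eq[OF assms(4)]
  by (subst integral_bounded_linear[OF assms(1) weighted_integrable[OF assms(2,3)], symmetric])
    (simp add: linear_scale[OF bounded_linear.linear[OF assms(1)]])

lemma avg_norm_le:
  assumes "\<And>t. norm (f t) \<le> B" "\<T> \<noteq> 0"
  shows "norm (avg \<T> f) \<le> B"
proof -
  let ?g = "\<lambda>s. h s *\<^sub>R f (\<T> + \<bar>\<T>\<bar> powr \<epsilon> * s)"
  have "norm (avg \<T> f) \<le> (LINT s|lborel. norm (?g s))" unfolding avg_eq[OF assms(2)] by (rule integral_norm_bound)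
  also have "\<dots> \<le> (LINT s|lborel. B * h s)"
  proof (rule integral_mono')
    show "integrable lborel (\<lambda>s. B * h s)" using h_integrable by simp
    have "0 \<le> B" using assms(1)[of 0] norm_ge_zero order_trans by blast
    then show "0 \<le> B * h s" for s by (simp add: h_nonneg)
  qed (use mult_left_mono[OF assms(1) h_nonneg] in \<open>simp only: norm_weight mult.commute[of B]\<close>)
  also have "\<dots> = B" by (simp add: h_integral)
  finally show ?thesis .
qed

text \<open>Since \<open>\<epsilon> < 1\<close>, the center \<open>\<T>\<close> of the weight
  outruns its width \<open>\<bar>\<T>\<bar> powr \<epsilon>\<close>.\<close>

lemma escape_at_top: "eventually (\<lambda>\<T>. \<T> + \<bar>\<T>\<bar> powr \<epsilon> * s \<ge> t0) at_top"
proof -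
  have "((\<lambda>\<T>. 1 + \<T> powr (\<epsilon> - 1) * s) \<longlongrightarrow> 1 + 0 * s) at_top"
    using eps by (intro tendsto_intros tendsto_neg_powr filterlim_ident) auto
  then have "filterlim (\<lambda>\<T>. (1 + \<T> powr (\<epsilon> - 1) * s) * \<T>) at_top at_top"
    by (intro filterlim_tendsto_pos_mult_at_top filterlim_ident) auto
  then have "eventually (\<lambda>\<T>. t0 \<le> (1 + \<T> powr (\<epsilon> - 1) * s) * \<T>) at_top"
    by (simp add: filterlim_at_top)
  then show ?thesis using eventually_gt_at_top[of 0]
  proof eventually_elim
    case (elim \<T>)
    then have "(1 + \<T> powr (\<epsilon> - 1) * s) * \<T> = \<T> + \<T> powr \<epsilon> * s"
      by (simp add: powr_diff field_simps)
    then show ?case using elim by simp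
  qed
qed

text \<open>The weight may have unbounded support, so the average need not vanish for large
  \<open>\<T>\<close>. For each fixed \<open>s\<close> the rescaled integrand eventually does, and
  \<open>B * h s\<close> dominates it.\<close>

lemma avg_tail:
  fixes f :: "real \<Rightarrow> 'b::{banach, second_countable_topology}"
  assumes "continuous_on UNIV f" "\<And>t. norm (f t) \<le> B" "\<And>t. t \<ge> t0 \<Longrightarrow> f t = 0"
  shows "((\<lambda>\<T>. avg \<T> f) \<longlongrightarrow> 0) at_top"
proof -
  have "((\<lambda>\<T>. LINT s|lborel. h s *\<^sub>R f (\<T> + \<bar>\<T>\<bar> powr \<epsilon> * s)) \<longlongrightarrow> (LINT s::real|lborel. 0)) at_top"
  proof (rule integral_dominated_convergence_at_top)
    show "integrable lborel (\<lambda>s. B * h s)" using h_integrable by simp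
    show "(\<lambda>s. h s *\<^sub>R f (t + \<bar>t\<bar> powr \<epsilon> * s)) \<in> borel_measurable lborel" for t
      using weighted_integrable[OF assms(1,2)] by (rule borel_measurable_integrable)
    have "norm (h s *\<^sub>R f t) \<le> B * h s" for s t
      using mult_left_mono[OF assms(2) h_nonneg] by (simp only: norm_weight mult.commute[of B])
    then show "\<forall>\<^sub>F t in at_top. AE s in lborel. norm (h s *\<^sub>R f (t + \<bar>t\<bar> powr \<epsilon> * s)) \<le> B * h s" by auto
    show "AE s in lborel. ((\<lambda>t. h s *\<^sub>R f (t + \<bar>t\<bar> powr \<epsilon> * s)) \<longlongrightarrow> 0) at_top"
    proof (rule AE_I2, rule tendsto_eventually)
      fix s show "\<forall>\<^sub>F t in at_top. h s *\<^sub>R f (t + \<bar>t\<bar> powr \<epsilon> * s) = 0"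
        using escape_at_top[of t0 s] by eventually_elim (simp add: assms(3))
    qed
  qed simp
  then have "((\<lambda>\<T>. LINT s|lborel. h s *\<^sub>R f (\<T> + \<bar>\<T>\<bar> powr \<epsilon> * s)) \<longlongrightarrow> 0) at_top" by simp
  then show ?thesis
    by (rule Lim_transform_eventually)
      (use eventually_gt_at_top[of "0::real"] in eventually_elim, simp add: avg_eq)
qed

text \<open>Locality makes two integrands agree from some time on; the earlier discrepancy is
  removed by \<open>avg_tail\<close> applied to the difference.\<close>

lemma avg_tendsto_cong:
  fixes f g :: "real \<Rightarrow> 'b::{banach, second_countable_topology}"
  assumes f: "continuous_on UNIV f" "\<And>t. norm (f t) \<le> B"
    and g: "continuous_on UNIV g" "\<And>t. norm (g t) \<le> C"
    and eq: "\<And>t. t \<ge> t0 \<Longrightarrow> f t = g t"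
    and lim: "((\<lambda>\<T>. avg \<T> f) \<longlongrightarrow> l) at_top"
  shows "((\<lambda>\<T>. avg \<T> g) \<longlongrightarrow> l) at_top"
proof -
  let ?d = "\<lambda>t. g t - f t"
  have d: "continuous_on UNIV ?d" "norm (?d t) \<le> C + B" for t
    using f g norm_triangle_ineq4[of "g t" "f t"] by (auto intro!: continuous_intros add_mono intro: order_trans)
  have "((\<lambda>\<T>. avg \<T> f + avg \<T> ?d) \<longlongrightarrow> l + 0) at_top"
    using eq by (intro tendsto_add lim avg_tail[OF d, of t0]) auto
  moreover have "\<forall>\<^sub>F \<T> in at_top. avg \<T> f + avg \<T> ?d = avg \<T> g"
    using eventually_gt_at_top[of 0]
    by eventually_elim (subst avg_add[OF f d, symmetric], auto)
  ultimately show ?thesis by (simp add: tendsto_cong)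
qed

text \<open>Scheffe's lemma: the translates converge pointwise by continuity and all have integral
  1.\<close>

lemma translation_L1_continuous:
  assumes "r \<longlonglongrightarrow> 0"
  shows "(\<lambda>n. LINT s|lborel. \<bar>h (s - r n) - h s\<bar>) \<longlonglongrightarrow> 0"
proof -
  have i: "integrable lborel (\<lambda>s. h (s - r n))" for n
    using lborel_integrable_real_affine[OF h_integrable, of 1 "- r n"] by simp
  have e: "(LINT s|lborel. h (s - r n)) = 1" for n
    using lborel_integral_real_affine[of 1 h "- r n"] by (simp add: h_integral)
  have "(\<lambda>n. \<integral>\<^sup>+ s. norm (h (s - r n) - h s) \<partial>lborel) \<longlonglongrightarrow> 0"
  proof (rule Scheffe_lemma2[OF borel_measurable_integrable[OF i] h_integrable])
    show "AE s in lborel. (\<lambda>n. h (s - r n)) \<longlonglongrightarrow> h s"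
    proof (rule AE_I2)
      fix s
      have "(\<lambda>n. s - r n) \<longlonglongrightarrow> s - 0" by (intro tendsto_intros assms)
      then show "(\<lambda>n. h (s - r n)) \<longlonglongrightarrow> h s"
        using continuous_on_tendsto_compose[OF h_cont, of "\<lambda>n. s - r n" s] by simp
    qed
    show "(\<integral>\<^sup>+ s. norm (h (s - r n)) \<partial>lborel) \<le> (\<integral>\<^sup>+ s. norm (h s) \<partial>lborel)" for n
      using nn_integral_eq_integral[OF i] nn_integral_eq_integral[OF h_integrable]
      by (simp add: h_nonneg e h_integral)
  qed
  moreover have "(\<integral>\<^sup>+ s. norm (h (s - r n) - h s) \<partial>lborel) = ennreal (LINT s|lborel. \<bar>h (s - r n) - h s\<bar>)" for n
    by (subst nn_integral_eq_integral[symmetric]) (use i h_integrable in auto)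
  ultimately show ?thesis
    by (simp add: tendsto_ennreal_iff[of _ _ 0, simplified])
qed

text \<open>After rescaling, the shift of \<open>k\<close> by \<open>r\<close> becomes a shift of
  \<open>h\<close> by \<open>r\<close> divided by the width of the weight. As
  \<open>\<epsilon> > 0\<close>, the width grows and the shift of \<open>h\<close> vanishes in
  L1.\<close>

lemma avg_coboundary:
  fixes k :: "real \<Rightarrow> 'b::{banach, second_countable_topology}"
  assumes k: "continuous_on UNIV k" "\<And>t. norm (k t) \<le> B"
  shows "((\<lambda>\<T>. avg \<T> (\<lambda>t. k (t + r) - k t)) \<longlongrightarrow> 0) at_top"
proof (rule tendsto_at_topI_sequentially)
  fix X :: "nat \<Rightarrow> real" assume X: "filterlim X at_top sequentially"
  define c where "c n = \<bar>X n\<bar> powr \<epsilon>" for n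
  have "filterlim (\<lambda>n. \<bar>X n\<bar>) at_top sequentially"
    by (rule filterlim_at_top_mono[OF X]) (simp add: abs_ge_self)
  then have "(\<lambda>n. \<bar>X n\<bar> powr (-\<epsilon>)) \<longlonglongrightarrow> 0"
    using eps tendsto_neg_powr[of "-\<epsilon>"] by auto
  then have "(\<lambda>n. r * \<bar>X n\<bar> powr (-\<epsilon>)) \<longlonglongrightarrow> 0" by (rule tendsto_mult_right_zero)
  then have "(\<lambda>n. r / c n) \<longlonglongrightarrow> 0" by (simp add: c_def powr_minus divide_inverse)
  from tendsto_mult_right_zero[OF translation_L1_continuous[OF this], of "B"]
  have lim: "(\<lambda>n. B * (LINT s|lborel. \<bar>h (s - r / c n) - h s\<bar>)) \<longlonglongrightarrow> 0" .
  have bound: "norm (avg (X n) (\<lambda>t. k (t + r) - k t)) \<le> B * (LINT s|lborel. \<bar>h (s - r / c n) - h s\<bar>)"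
    if "X n > 0" for n
  proof -
    have c: "c n > 0" using that by (simp add: c_def)
    let ?k = "\<lambda>s. k (X n + c n * s)"
    have i1: "integrable lborel (\<lambda>s. h s *\<^sub>R ?k s)" by (rule weighted_integrable[OF k])
    have i0: "integrable lborel (\<lambda>s. h s *\<^sub>R k ((X n + r) + c n * s))" by (rule weighted_integrable[OF k])
    from lborel_integrable_real_affine[OF this, of 1 "- r / c n"] c
    have i2: "integrable lborel (\<lambda>s. h (s - r / c n) *\<^sub>R ?k s)" by (simp add: algebra_simps)
    have "avg (X n) (\<lambda>t. k (t + r) - k t) =
        (LINT s|lborel. h s *\<^sub>R k ((X n + r) + c n * s)) - (LINT s|lborel. h s *\<^sub>R ?k s)"
      unfolding avg_eq[OF less_imp_neq[OF that, symmetric]] c_def[symmetric] scaleR_diff_right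
      by (subst Bochner_Integration.integral_diff[OF i0 i1, symmetric]) (simp add: add_ac)
    also have "(LINT s|lborel. h s *\<^sub>R k ((X n + r) + c n * s)) = (LINT s|lborel. h (s - r / c n) *\<^sub>R ?k s)"
      by (subst lborel_integral_real_affine[of 1 _ "- r / c n"]) (use c in \<open>auto simp: algebra_simps\<close>)
    also have "\<dots> - (LINT s|lborel. h s *\<^sub>R ?k s) = (LINT s|lborel. (h (s - r / c n) - h s) *\<^sub>R ?k s)"
      using i1 i2 by (simp add: scaleR_diff_left)
    also have "norm \<dots> \<le> (LINT s|lborel. norm ((h (s - r / c n) - h s) *\<^sub>R ?k s))"
      by (rule integral_norm_bound)
    also have "\<dots> \<le> (LINT s|lborel. B * \<bar>h (s - r / c n) - h s\<bar>)"
    proof (rule integral_mono')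
      show "integrable lborel (\<lambda>s. B * \<bar>h (s - r / c n) - h s\<bar>)"
        using lborel_integrable_real_affine[OF h_integrable, of 1 "- r / c n"] h_integrable by auto
      have "0 \<le> B" using k(2)[of 0] norm_ge_zero order_trans by blast
      then show "0 \<le> B * \<bar>h (s - r / c n) - h s\<bar>" for s by simp
    qed (use mult_left_mono[OF k(2) abs_ge_zero] in \<open>simp only: norm_scaleR real_norm_def mult.commute[of B]\<close>)
    finally show ?thesis by simp
  qed
  show "(\<lambda>n. avg (X n) (\<lambda>t. k (t + r) - k t)) \<longlonglongrightarrow> 0"
    by (rule Lim_null_comparison[OF _ lim])
      (use filterlim_at_top_dense[THEN iffD1, OF X, rule_format, of 0] in eventually_elim, rule bound)
qed

end

subsection \<open>One-parameter unitary groups\<close>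

definition unitary_group :: "(real \<Rightarrow> 'h::chilbert_space \<Rightarrow> 'h) \<Rightarrow> bool" where
  "unitary_group W \<longleftrightarrow> (\<forall>t. unitary_op (W t)) \<and> (\<forall>s t. W (s + t) = W s \<circ> W t) \<and>
     (\<forall>\<xi>. continuous_on UNIV (\<lambda>t. W t \<xi>))"

definition invariants :: "(real \<Rightarrow> 'h::chilbert_space \<Rightarrow> 'h) \<Rightarrow> 'h set" where
  "invariants W = {\<xi>. \<forall>t. W t \<xi> = \<xi>}"

lemma unitary_groupD:
  assumes "unitary_group W"
  shows "unitary_op (W t)" "W (s + t) \<xi> = W s (W t \<xi>)" "continuous_on UNIV (\<lambda>t. W t \<xi>)"
    "W 0 \<xi> = \<xi>" "cadjoint (W t) = W (- t)" "cinner (W t \<xi>) \<eta> = cinner \<xi> (W (- t) \<eta>)"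
    "norm (W t \<xi>) = norm \<xi>" "bounded_linear (W t)" "W t (c *\<^sub>C \<xi>) = c *\<^sub>C W t \<xi>"
proof -
  show u: "unitary_op (W t)" and a: "W (s + t) \<xi> = W s (W t \<xi>)"
    and "continuous_on UNIV (\<lambda>t. W t \<xi>)" for s t \<xi>
    using assms by (auto simp: unitary_group_def)
  show z: "W 0 \<xi> = \<xi>" for \<xi>
    using a[of 0 0 \<xi>] unitary_opD(4)[OF u[of 0]] by (metis add_0)
  show i: "cinner (W t \<xi>) \<eta> = cinner \<xi> (W (- t) \<eta>)" for t \<xi> \<eta>
    using unitary_opD(2)[OF u[of "-t"], of "W t \<xi>" \<eta>] a[of "-t" t \<xi>] by (simp add: z)
  show "cadjoint (W t) = W (- t)" by (rule cadjoint_eqI) (simp add: i)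
  show "norm (W t \<xi>) = norm \<xi>" "bounded_linear (W t)" "W t (c *\<^sub>C \<xi>) = c *\<^sub>C W t \<xi>"
    using unitary_opD[OF u[of t]] bounded_clinearD by auto
qed

lemma unitary_group_reverse:
  assumes "unitary_group W"
  shows "unitary_group (\<lambda>t. W (- t))"
proof -
  have "W (- (s + t)) = W (- s) \<circ> W (- t)" for s t
    using unitary_groupD(2)[OF assms, of "- s" "- t"] by (auto simp: fun_eq_iff)
  moreover have "continuous_on UNIV (\<lambda>t. W (- t) \<xi>)" for \<xi>
    by (rule continuous_on_compose2[OF unitary_groupD(3)[OF assms]]) (auto intro: continuous_intros)
  ultimately show ?thesis using unitary_groupD(1)[OF assms] by (simp add: unitary_group_def)
qed

lemma invariants_reverse: "invariants (\<lambda>t. W (- t)) = invariants W"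
  unfolding invariants_def by (metis minus_minus)

lemma invariants_closed_csubspace:
  assumes "unitary_group W"
  shows "csubspace (invariants W)" "closed (invariants W)"
proof -
  note W = unitary_groupD[OF assms]
  show "csubspace (invariants W)"
    using W(8) by (auto simp: csubspace_def invariants_def W(9) linear_0 linear_add bounded_linear.linear)
  show "closed (invariants W)"
    unfolding invariants_def
    by (intro closed_Collect_all closed_Collect_eq continuous_on_id bounded_linear.continuous_on[OF W(8)])
qed

context averaging
begin

text \<open>Differences \<open>W (- r) \<zeta> - \<zeta>\<close> average to 0, and a vector
  orthogonal to all of them is invariant. Hence the vectors that average to 0 exhaust the orthogonal
  complement of the invariants.\<close>

lemma mean_ergodic:
  fixes W :: "real \<Rightarrow> 'h::{chilbert_space, second_countable_topology} \<Rightarrow> 'h"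
  assumes W: "unitary_group W"
  shows "((\<lambda>\<T>. avg \<T> (\<lambda>t. W t \<xi>)) \<longlongrightarrow> oproj (invariants W) \<xi>) at_top"
proof -
  note W' = unitary_groupD[OF W] and K = invariants_closed_csubspace[OF W]
  have linW: "W t (a + b) = W t a + W t b" "W t (a - b) = W t a - W t b" for t a b
    using W'(8) by (simp_all add: linear_add linear_diff bounded_linear.linear)
  have c: "continuous_on UNIV (\<lambda>t. W t \<zeta>)" "norm (W t \<zeta>) \<le> norm \<zeta>" for t \<zeta> using W'(3,7) by auto
  have av_add: "avg \<T> (\<lambda>t. W t (a + b)) = avg \<T> (\<lambda>t. W t a) + avg \<T> (\<lambda>t. W t b)" if "\<T> \<noteq> 0" for \<T> a b
    unfolding linW by (rule avg_add[OF c c that])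
  \<comment> \<open>Closed because averaging does not increase the bound on a function, and a
    complex subspace, so that one can project onto it.\<close>
  define N where "N = {\<zeta>. ((\<lambda>\<T>. avg \<T> (\<lambda>t. W t \<zeta>)) \<longlongrightarrow> 0) at_top}"
  have pos: "\<forall>\<^sub>F \<T>::real in at_top. \<T> \<noteq> 0" using eventually_gt_at_top[of 0] by eventually_elim auto
  have "a + b \<in> N" if "a \<in> N" "b \<in> N" for a b
  proof -
    have "((\<lambda>\<T>. avg \<T> (\<lambda>t. W t a) + avg \<T> (\<lambda>t. W t b)) \<longlongrightarrow> 0 + 0) at_top"
      using that unfolding N_def by (intro tendsto_add) auto
    then have "((\<lambda>\<T>. avg \<T> (\<lambda>t. W t a) + avg \<T> (\<lambda>t. W t b)) \<longlongrightarrow> 0) at_top" by simp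
    then show ?thesis unfolding N_def mem_Collect_eq
      by (rule Lim_transform_eventually)
        (use pos in eventually_elim, simp add: av_add)
  qed
  moreover have "d *\<^sub>C a \<in> N" if "a \<in> N" for a d
  proof -
    have "((\<lambda>\<T>. d *\<^sub>C avg \<T> (\<lambda>t. W t a)) \<longlongrightarrow> d *\<^sub>C 0) at_top"
      using that unfolding N_def by (intro bounded_linear.tendsto[OF bounded_linear_scaleC]) auto
    then have "((\<lambda>\<T>. d *\<^sub>C avg \<T> (\<lambda>t. W t a)) \<longlongrightarrow> 0) at_top" by simp
    then show ?thesis unfolding N_def mem_Collect_eq
      by (rule Lim_transform_eventually)
        (use pos in eventually_elim, simp add: W'(9) avg_linear[OF bounded_linear_scaleC c])
  qed
  moreover have "0 \<in> N" using W'(8) by (simp add: N_def avg_def linear_0 bounded_linear.linear)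
  ultimately have sN: "csubspace N" by (simp add: csubspace_def)
  have cN: "closed N"
    unfolding closed_sequential_limits
  proof (intro allI impI, elim conjE)
    fix X \<zeta> assume X: "\<forall>n. X n \<in> N" "X \<longlonglongrightarrow> \<zeta>"
    have "((\<lambda>\<T>. avg \<T> (\<lambda>t. W t \<zeta>)) \<longlongrightarrow> 0) at_top"
    proof (rule tendstoI)
      fix e :: real assume "e > 0"
      then obtain n where n: "dist (X n) \<zeta> < e / 2"
        using X(2) unfolding LIMSEQ_def by (metis half_gt_zero order_refl)
      have "\<forall>\<^sub>F \<T> in at_top. dist (avg \<T> (\<lambda>t. W t (X n))) 0 < e / 2"
        using X(1) \<open>e > 0\<close> unfolding N_def by (intro tendstoD) auto
      then show "\<forall>\<^sub>F \<T> in at_top. dist (avg \<T> (\<lambda>t. W t \<zeta>)) 0 < e"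
        using pos
      proof eventually_elim
        case (elim \<T>)
        have "avg \<T> (\<lambda>t. W t \<zeta>) = avg \<T> (\<lambda>t. W t (X n)) + avg \<T> (\<lambda>t. W t (\<zeta> - X n))"
          using av_add[OF elim(2), of "X n" "\<zeta> - X n"] by simp
        moreover have "norm (avg \<T> (\<lambda>t. W t (\<zeta> - X n))) \<le> norm (\<zeta> - X n)"
          by (rule avg_norm_le[OF c(2) elim(2)])
        moreover have "norm (\<zeta> - X n) < e / 2" using n by (simp add: dist_norm norm_minus_commute)
        ultimately show ?case using elim(1) norm_triangle_ineq by (smt (verit) dist_0_norm dist_commute field_sum_of_halves)
      qed
    qed
    then show "\<zeta> \<in> N" by (simp add: N_def)
  qed
  define \<eta> where "\<eta> = oproj (invariants W) \<xi>"
  \<comment> \<open>The part of \<open>\<xi> - \<eta>\<close> orthogonal to \<open>N\<close>. It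
    turns out to be invariant, hence orthogonal to \<open>\<xi> - \<eta>\<close> too, and therefore
    to itself.\<close>
  define m where "m = (\<xi> - \<eta>) - oproj N (\<xi> - \<eta>)"
  have "W r m = m" for r
  proof (rule cinner_ext)
    fix \<zeta>
    have "((\<lambda>\<T>. avg \<T> (\<lambda>t. W (t + (- r)) \<zeta> - W t \<zeta>)) \<longlongrightarrow> 0) at_top"
      by (rule avg_coboundary[OF c])
    moreover have "W (t + (- r)) \<zeta> = W t (W (- r) \<zeta>)" for t by (rule W'(2))
    ultimately have "W (- r) \<zeta> - \<zeta> \<in> N" unfolding N_def by (simp only: linW mem_Collect_eq)
    from oproj_orth[OF sN cN this, of "\<xi> - \<eta>"] show "cinner \<zeta> (W r m) = cinner \<zeta> m"
      by (simp add: m_def[symmetric] cinner_diff_left W'(6))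
  qed
  then have mK: "m \<in> invariants W" by (simp add: invariants_def)
  have "cinner m (oproj N (\<xi> - \<eta>)) = 0"
    using oproj_orth[OF sN cN oproj_mem[OF sN cN], of "\<xi> - \<eta>" "\<xi> - \<eta>"]
    by (metis cinner_commute complex_cnj_zero m_def)
  moreover have "cinner m (\<xi> - \<eta>) = 0" using oproj_orth[OF K mK] by (simp add: \<eta>_def)
  ultimately have "cinner m m = 0" by (subst (2) m_def) (simp add: cinner_diff_right)
  then have "\<xi> - \<eta> = oproj N (\<xi> - \<eta>)" by (simp add: m_def)
  then have "\<xi> - \<eta> \<in> N" by (metis oproj_mem[OF sN cN])
  then have "((\<lambda>\<T>. \<eta> + avg \<T> (\<lambda>t. W t (\<xi> - \<eta>))) \<longlongrightarrow> \<eta> + 0) at_top"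
    unfolding N_def by (intro tendsto_add tendsto_const) auto
  then have "((\<lambda>\<T>. \<eta> + avg \<T> (\<lambda>t. W t (\<xi> - \<eta>))) \<longlongrightarrow> \<eta>) at_top" by simp
  moreover have "\<forall>\<^sub>F \<T> in at_top. \<eta> + avg \<T> (\<lambda>t. W t (\<xi> - \<eta>)) = avg \<T> (\<lambda>t. W t \<xi>)"
    using pos
  proof eventually_elim
    case (elim \<T>)
    have "W t \<eta> = \<eta>" for t using oproj_mem[OF K, of \<xi>] by (simp add: \<eta>_def invariants_def)
    then show ?case using av_add[OF elim, of \<eta> "\<xi> - \<eta>"] by (simp add: avg_const[OF elim])
  qed
  ultimately show ?thesis unfolding \<eta>_def[symmetric] by (rule Lim_transform_eventually)
qed

end

section \<open>Asymptotic limits of averaged operators\<close>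

lemma csubspace_closure:
  fixes S :: "'h::chilbert_space set"
  assumes "csubspace S"
  shows "csubspace (closure S)"
  unfolding csubspace_def
proof (intro conjI ballI allI)
  show "0 \<in> closure S" using csubspaceD(1)[OF assms] closure_subset by blast
  show "x + y \<in> closure S" if "x \<in> closure S" "y \<in> closure S" for x y
  proof -
    obtain a where "\<forall>n. a n \<in> S" "a \<longlonglongrightarrow> x" using \<open>x \<in> closure S\<close> by (auto simp: closure_sequential)
    moreover obtain b where "\<forall>n. b n \<in> S" "b \<longlonglongrightarrow> y" using \<open>y \<in> closure S\<close> by (auto simp: closure_sequential)
    ultimately show ?thesis
      unfolding closure_sequential
      by (intro exI[of _ "\<lambda>n. a n + b n"]) (auto intro: csubspaceD(2)[OF assms] tendsto_add)
  qed
  show "c *\<^sub>C x \<in> closure S" if "x \<in> closure S" for c x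
  proof -
    obtain a where "\<forall>n. a n \<in> S" "a \<longlonglongrightarrow> x" using \<open>x \<in> closure S\<close> by (auto simp: closure_sequential)
    then show ?thesis
      unfolding closure_sequential
      by (intro exI[of _ "\<lambda>n. c *\<^sub>C a n"])
        (auto intro: csubspaceD(3)[OF assms] bounded_linear.tendsto[OF bounded_linear_scaleC])
  qed
qed

text \<open>The component of a vector orthogonal to the closure of \<open>S\<close> is orthogonal to
  \<open>S\<close>, hence zero.\<close>

lemma dense_if_total:
  fixes S :: "'h::chilbert_space set"
  assumes "csubspace S" "\<And>\<psi>. (\<And>s. s \<in> S \<Longrightarrow> cinner \<psi> s = 0) \<Longrightarrow> \<psi> = 0"
  shows "closure S = UNIV"
proof -
  note K = csubspace_closure[OF assms(1)] closed_closure[of S]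
  have "\<xi> \<in> closure S" for \<xi>
  proof -
    have "\<xi> - oproj (closure S) \<xi> = 0"
    proof (rule assms(2))
      fix s assume "s \<in> S"
      then have "cinner s (\<xi> - oproj (closure S) \<xi>) = 0" using oproj_orth[OF K] closure_subset by blast
      then show "cinner (\<xi> - oproj (closure S) \<xi>) s = 0" by (metis cinner_commute complex_cnj_zero)
    qed
    then show ?thesis using oproj_mem[OF K, of \<xi>] by simp
  qed
  then show ?thesis by auto
qed

text \<open>Strong continuity extends to a moving argument because each \<open>W t\<close> is
  isometric and does not amplify \<open>v t - v s\<close>.\<close>

lemma unitary_group_continuous:
  assumes "unitary_group W" "continuous_on UNIV v"
  shows "continuous_on UNIV (\<lambda>t. W t (v t))"
  unfolding continuous_on_def
proof (intro ballI)
  note W = unitary_groupD[OF assms(1)]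
  fix s
  have v: "(v \<longlongrightarrow> v s) (at s)" using assms(2) by (simp add: continuous_on_def)
  have "((\<lambda>t. norm (v t - v s) + norm (W t (v s) - W s (v s))) \<longlongrightarrow> 0 + 0) (at s)"
    using W(3)[of "v s"] by (intro tendsto_add LIM_zero tendsto_norm_zero v) (auto simp: continuous_on_def)
  then have lim: "((\<lambda>t. norm (v t - v s) + norm (W t (v s) - W s (v s))) \<longlongrightarrow> 0) (at s)" by simp
  have "((\<lambda>t. W t (v t) - W s (v s)) \<longlongrightarrow> 0) (at s)"
  proof (rule Lim_null_comparison[OF _ lim])
    show "\<forall>\<^sub>F t in at s. norm (W t (v t) - W s (v s)) \<le> norm (v t - v s) + norm (W t (v s) - W s (v s))"
    proof (rule eventuallyI)
      fix t
      have "W t (v t) - W s (v s) = W t (v t - v s) + (W t (v s) - W s (v s))"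
        using W(8) by (simp add: linear_diff bounded_linear.linear)
      then show "norm (W t (v t) - W s (v s)) \<le> norm (v t - v s) + norm (W t (v s) - W s (v s))"
        by (metis norm_triangle_ineq W(7))
    qed
  qed
  then show "((\<lambda>t. W t (v t)) \<longlongrightarrow> W s (v s)) (at s within UNIV)" by (simp add: LIM_zero_cancel)
qed

lemma conj_op_unitary_group:
  assumes "unitary_group W"
  shows "conj_op (W t) x \<xi> = W t (x (W (- t) \<xi>))"
  by (simp add: conj_op_def unitary_groupD(5)[OF assms])

context averaging
begin

context
  fixes W :: "real \<Rightarrow> 'h::{chilbert_space, second_countable_topology} \<Rightarrow> 'h" and x :: "'h \<Rightarrow> 'h"
  assumes W: "unitary_group W" and x: "bounded_clinear x"
begin

lemma orbit_continuous: "continuous_on UNIV (\<lambda>t. conj_op (W t) x \<xi>)"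
  unfolding conj_op_unitary_group[OF W]
  by (intro unitary_group_continuous[OF W] bounded_linear.continuous_on[OF bounded_clinearD(1)[OF x]]
      unitary_groupD(3)[OF unitary_group_reverse[OF W]])

lemma orbit_bound: "norm (conj_op (W t) x \<xi>) \<le> onorm x * norm \<xi>"
  using onorm[OF bounded_clinearD(1)[OF x], of "W (- t) \<xi>"]
  by (simp add: conj_op_unitary_group[OF W] unitary_groupD(7)[OF W])

lemma orbit_linear: "bounded_linear (conj_op (W t) x)"
  using bounded_linear_compose[OF unitary_groupD(8)[OF W] bounded_linear_compose[OF bounded_clinearD(1)[OF x] unitary_groupD(8)[OF W]]]
  by (auto simp: conj_op_unitary_group[OF W, abs_def])

text \<open>A Lipschitz bound independent of \<open>\<T>\<close>; it carries both convergence and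
  agreement of limits from a dense set to all vectors.\<close>

lemma averaged_orbit_diff:
  assumes "\<T> \<noteq> 0"
  shows "norm (avg \<T> (\<lambda>t. conj_op (W t) x \<xi>) - avg \<T> (\<lambda>t. conj_op (W t) x \<zeta>)) \<le> onorm x * norm (\<xi> - \<zeta>)"
proof -
  have "conj_op (W t) x \<xi> = conj_op (W t) x (\<xi> - \<zeta>) + conj_op (W t) x \<zeta>" for t
    using linear_add[OF bounded_linear.linear[OF orbit_linear], of t "\<xi> - \<zeta>" \<zeta>] by simp
  then have "avg \<T> (\<lambda>t. conj_op (W t) x \<xi>) = avg \<T> (\<lambda>t. conj_op (W t) x (\<xi> - \<zeta>)) + avg \<T> (\<lambda>t. conj_op (W t) x \<zeta>)"
    by (subst avg_add[OF orbit_continuous orbit_bound orbit_continuous orbit_bound assms, symmetric]) presburger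
  then show ?thesis using avg_norm_le[OF orbit_bound[where \<xi> = "\<xi> - \<zeta>"] assms] by simp
qed

lemma averaged_orbit_convergent_closed:
  "closed {\<xi>. \<exists>\<eta>. ((\<lambda>\<T>. avg \<T> (\<lambda>t. conj_op (W t) x \<xi>)) \<longlongrightarrow> \<eta>) at_top}" (is "closed ?G")
  unfolding closed_sequential_limits
proof (intro allI impI, elim conjE)
  let ?A = "\<lambda>\<xi> \<T>. avg \<T> (\<lambda>t. conj_op (W t) x \<xi>)"
  \<comment> \<open>The summand 1 makes the constant positive even for \<open>x = 0\<close>, so that
    it can be divided by.\<close>
  let ?C = "onorm x + 1"
  have C: "?C > 0" using onorm_pos_le[OF bounded_clinearD(1)[OF x]] by linarith
  have pos: "\<forall>\<^sub>F \<T>::real in at_top. \<T> \<noteq> 0" using eventually_gt_at_top[of 0] by eventually_elim auto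
  have diff: "norm (?A \<xi> \<T> - ?A \<zeta> \<T>) \<le> ?C * norm (\<xi> - \<zeta>)" if "\<T> \<noteq> 0" for \<xi> \<zeta> \<T>
    using averaged_orbit_diff[OF that, of \<xi> \<zeta>] by (simp add: distrib_right add_increasing2)
  fix \<xi> :: "nat \<Rightarrow> 'h" and l assume "\<forall>n. \<xi> n \<in> ?G" and l: "\<xi> \<longlonglongrightarrow> l"
  then obtain \<eta> where \<eta>: "\<And>n. (?A (\<xi> n) \<longlongrightarrow> \<eta> n) at_top" by simp metis
  have d\<eta>: "norm (\<eta> m - \<eta> n) \<le> ?C * norm (\<xi> m - \<xi> n)" for m n
    by (rule tendsto_upperbound[OF tendsto_norm[OF tendsto_diff[OF \<eta> \<eta>]]])
      (rule eventually_mono[OF pos diff], assumption, simp)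
  have "Cauchy \<eta>"
  proof (rule CauchyI)
    fix e :: real assume "e > 0"
    then obtain M where "\<forall>m\<ge>M. \<forall>n\<ge>M. norm (\<xi> m - \<xi> n) < e / ?C"
      using CauchyD[OF LIMSEQ_imp_Cauchy[OF l], of "e / ?C"] C by auto
    then show "\<exists>M. \<forall>m\<ge>M. \<forall>n\<ge>M. norm (\<eta> m - \<eta> n) < e"
      using C by (intro exI[of _ M]) (auto simp: pos_less_divide_eq mult.commute intro: le_less_trans[OF d\<eta>])
  qed
  then obtain k where k: "\<eta> \<longlonglongrightarrow> k" using Cauchy_convergent convergent_def by blast
  have "(?A l \<longlongrightarrow> k) at_top"
  proof (rule tendstoI)
    fix e :: real assume e: "e > 0"
    have "\<forall>\<^sub>F n in sequentially. dist (\<eta> n) k < e / 3 \<and> dist (\<xi> n) l < e / 3 / ?C"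
      using e C by (intro eventually_conj tendstoD k l) auto
    then obtain n where n: "dist (\<eta> n) k < e / 3" "dist (\<xi> n) l < e / 3 / ?C"
      using eventually_happens'[OF sequentially_bot] by blast
    have n2: "?C * norm (l - \<xi> n) < e / 3"
      using n(2) unfolding pos_less_divide_eq[OF C] dist_norm norm_minus_commute[of l]
      by (simp only: mult.commute)
    have "\<forall>\<^sub>F \<T> in at_top. dist (?A (\<xi> n) \<T>) (\<eta> n) < e / 3" using e by (intro tendstoD \<eta>) auto
    then show "\<forall>\<^sub>F \<T> in at_top. dist (?A l \<T>) k < e"
      using pos
    proof eventually_elim
      case (elim \<T>)
      have "dist (?A l \<T>) (?A (\<xi> n) \<T>) < e / 3"
        using diff[OF elim(2), of l "\<xi> n"] n2 by (simp add: dist_norm)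
      then show ?case using elim(1) n(1) dist_triangle[of "?A l \<T>" k "?A (\<xi> n) \<T>"]
          dist_triangle[of "?A (\<xi> n) \<T>" k "\<eta> n"] by linarith
    qed
  qed
  then show "l \<in> ?G" by blast
qed

context
  fixes \<Omega> :: 'h
  assumes \<Omega>: "\<Omega> \<in> invariants W"
begin

lemma orbit_vacuum: "conj_op (W t) x \<Omega> = W t (x \<Omega>)"
  using \<Omega> by (simp add: conj_op_unitary_group[OF W] invariants_def)

text \<open>At late times the orbit of \<open>x\<close> passes through \<open>y\<close> and meets
  \<open>\<Omega>\<close>, which \<open>W\<close> fixes. What remains is \<open>y\<close> applied to
  \<open>W t (x \<Omega>)\<close>, a case of the mean ergodic theorem.\<close>

lemma averaged_orbit_right:
  assumes y: "bounded_clinear y" and comm: "\<And>t. t \<ge> t0 \<Longrightarrow> conj_op (W t) x \<circ> y = y \<circ> conj_op (W t) x"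
  shows "((\<lambda>\<T>. avg \<T> (\<lambda>t. conj_op (W t) x (y \<Omega>))) \<longlongrightarrow> y (oproj (invariants W) (x \<Omega>))) at_top"
proof (rule avg_tendsto_cong)
  note ly = bounded_clinearD(1)[OF y] and W' = unitary_groupD[OF W]
  have b: "continuous_on UNIV (\<lambda>t. W t (x \<Omega>))" "norm (W t (x \<Omega>)) \<le> norm (x \<Omega>)" for t using W' by auto
  show "continuous_on UNIV (\<lambda>t. y (W t (x \<Omega>)))" by (intro bounded_linear.continuous_on[OF ly] b)
  show "norm (y (W t (x \<Omega>))) \<le> onorm y * norm (x \<Omega>)" for t
    using onorm[OF ly, of "W t (x \<Omega>)"] by (simp add: W'(7))
  show "((\<lambda>\<T>. avg \<T> (\<lambda>t. y (W t (x \<Omega>)))) \<longlongrightarrow> y (oproj (invariants W) (x \<Omega>))) at_top"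
    by (rule Lim_transform_eventually[OF bounded_linear.tendsto[OF ly mean_ergodic[OF W]]])
      (use eventually_gt_at_top[of 0] in eventually_elim, simp add: avg_linear[OF ly b])
  show "y (W t (x \<Omega>)) = conj_op (W t) x (y \<Omega>)" if "t \<ge> t0" for t
    using fun_cong[OF comm[OF that], of \<Omega>] by (simp add: orbit_vacuum)
qed (rule orbit_continuous orbit_bound)+

text \<open>The mirror image of \<open>averaged_orbit_right\<close>: after \<open>z\<close> is moved
  over as \<open>cadjoint z\<close> and commuted past the orbit of \<open>x\<close>, the latter
  meets \<open>\<Omega>\<close> in the left argument, where it acts as \<open>cadjoint x\<close>.
  The vector \<open>\<xi>\<close> can therefore be arbitrary.\<close>

lemma averaged_orbit_left:
  assumes z: "bounded_clinear z"
    and comm: "\<And>t. t \<ge> t0 \<Longrightarrow> conj_op (W t) x \<circ> cadjoint z = cadjoint z \<circ> conj_op (W t) x"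
  shows "((\<lambda>\<T>. avg \<T> (\<lambda>t. cinner (z \<Omega>) (conj_op (W t) x \<xi>))) \<longlongrightarrow>
    cinner (oproj (invariants W) (cadjoint x \<Omega>)) (cadjoint z \<xi>)) at_top"
proof (rule avg_tendsto_cong)
  note W' = unitary_groupD[OF W] and l = bounded_linear_cinner_right
  define \<omega> where "\<omega> = cadjoint x \<Omega>"
  define \<phi> where "\<phi> = cadjoint z \<xi>"
  \<comment> \<open>\<open>cinner\<close> is antilinear in its first argument;
    \<open>bounded_linear\<close> means real linearity, so the conjugated functional may still be
    exchanged with \<open>avg\<close>.\<close>
  have cl: "bounded_linear (\<lambda>v. cnj (cinner \<phi> v))"
    by (rule bounded_linear_compose[OF bounded_linear_cnj l])
  have eq: "cnj (cinner \<phi> v) = cinner v \<phi>" for v by (metis cinner_commute)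
  have b: "continuous_on UNIV (\<lambda>t. W t \<omega>)" "norm (W t \<omega>) \<le> norm \<omega>" for t using W' by auto
  show "continuous_on UNIV (\<lambda>t. cnj (cinner \<phi> (W t \<omega>)))"
    by (rule bounded_linear.continuous_on[OF cl b(1)])
  show "norm (cnj (cinner \<phi> (W t \<omega>))) \<le> norm \<phi> * norm \<omega>" for t
    using cmod_cinner_le[of \<phi> "W t \<omega>"] by (simp add: W'(7))
  have "((\<lambda>\<T>. avg \<T> (\<lambda>t. cnj (cinner \<phi> (W t \<omega>)))) \<longlongrightarrow> cnj (cinner \<phi> (oproj (invariants W) \<omega>))) at_top"
    by (rule Lim_transform_eventually[OF bounded_linear.tendsto[OF cl mean_ergodic[OF W]]])
      (use eventually_gt_at_top[of 0] in eventually_elim, simp add: avg_linear[OF cl b])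
  then show "((\<lambda>\<T>. avg \<T> (\<lambda>t. cnj (cinner \<phi> (W t \<omega>)))) \<longlongrightarrow>
    cinner (oproj (invariants W) (cadjoint x \<Omega>)) (cadjoint z \<xi>)) at_top"
    unfolding eq unfolding \<omega>_def \<phi>_def .
  show "cnj (cinner \<phi> (W t \<omega>)) = cinner (z \<Omega>) (conj_op (W t) x \<xi>)" if "t \<ge> t0" for t
  proof -
    have inv: "W (- t) \<Omega> = \<Omega>" using \<Omega> by (simp add: invariants_def)
    have "cinner (z \<Omega>) (conj_op (W t) x \<xi>) = cinner \<Omega> (cadjoint z (conj_op (W t) x \<xi>))"
      by (rule cinner_cadjoint'[OF z, symmetric])
    also have "\<dots> = cinner \<Omega> (conj_op (W t) x \<phi>)"
      using fun_cong[OF comm[OF that], of \<xi>] by (simp add: \<phi>_def)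
    also have "\<dots> = cinner \<Omega> (x (W (- t) \<phi>))"
      using W'(6)[of "-t" \<Omega> "x (W (- t) \<phi>)"] by (simp add: conj_op_unitary_group[OF W] inv)
    also have "\<dots> = cinner (W t \<omega>) \<phi>" by (simp add: W'(6) \<omega>_def cinner_cadjoint[OF x])
    finally show ?thesis by (simp add: eq)
  qed
  show "continuous_on UNIV (\<lambda>t. cinner (z \<Omega>) (conj_op (W t) x \<xi>))"
    by (intro bounded_linear.continuous_on[OF l] orbit_continuous)
  show "norm (cinner (z \<Omega>) (conj_op (W t) x \<xi>)) \<le> norm (z \<Omega>) * (onorm x * norm \<xi>)" for t
    by (rule order_trans[OF cmod_cinner_le mult_left_mono[OF orbit_bound]]) simp
qed

lemma averaged_orbit_convergent:
  assumes M: "von_neumann_algebra M" "closure {y \<Omega> | y. y \<in> M} = UNIV"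
    and comm: "\<And>y. y \<in> M \<Longrightarrow> \<exists>t0. \<forall>t\<ge>t0. conj_op (W t) x \<circ> y = y \<circ> conj_op (W t) x"
  shows "\<exists>\<eta>. ((\<lambda>\<T>. avg \<T> (\<lambda>t. conj_op (W t) x \<xi>)) \<longlongrightarrow> \<eta>) at_top"
proof -
  let ?G = "{\<xi>. \<exists>\<eta>. ((\<lambda>\<T>. avg \<T> (\<lambda>t. conj_op (W t) x \<xi>)) \<longlongrightarrow> \<eta>) at_top}"
  have "{y \<Omega> | y. y \<in> M} \<subseteq> ?G"
  proof safe
    fix y assume y: "y \<in> M"
    obtain t0 where "\<And>t. t \<ge> t0 \<Longrightarrow> conj_op (W t) x \<circ> y = y \<circ> conj_op (W t) x" using comm[OF y] by blast
    from averaged_orbit_right[OF von_neumann_algebraD(1)[OF M(1) y] this]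
    show "\<exists>\<eta>. ((\<lambda>\<T>. avg \<T> (\<lambda>t. conj_op (W t) x (y \<Omega>))) \<longlongrightarrow> \<eta>) at_top" by blast
  qed
  from closure_minimal[OF this averaged_orbit_convergent_closed] show ?thesis using M(2) by blast
qed

end

end

text \<open>
  Under \<open>D\<close> the operator \<open>x\<close> becomes commuting with \<open>Y\<close> and with \<open>Z\<close> simultaneously, which
  identifies the limit along \<open>W\<close> at \<open>+\<infinity>\<close>, controlled by \<open>Y\<close>, with that at \<open>-\<infinity>\<close>, controlled
  by \<open>Z\<close>.
\<close>

theorem averaged_orbit_limits_agree:
  fixes W D :: "real \<Rightarrow> 'h::{chilbert_space, second_countable_topology} \<Rightarrow> 'h"
  assumes W: "unitary_group W" and D: "unitary_group D" and inv: "invariants D = invariants W"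
    and \<Omega>: "\<Omega> \<in> invariants W" and x: "bounded_clinear x"
    and Y: "von_neumann_algebra Y" "closure {y \<Omega> | y. y \<in> Y} = UNIV"
    and Z: "von_neumann_algebra Z" "closure {z \<Omega> | z. z \<in> Z} = UNIV"
    and commY: "\<And>y. y \<in> Y \<Longrightarrow> \<exists>t0. \<forall>t\<ge>t0. conj_op (W t) x \<circ> y = y \<circ> conj_op (W t) x"
    and commZ: "\<And>z. z \<in> Z \<Longrightarrow> \<exists>t0. \<forall>t\<le>t0. conj_op (W t) x \<circ> z = z \<circ> conj_op (W t) x"
    and commD: "\<And>y. y \<in> Y \<union> Z \<Longrightarrow> \<exists>t0. \<forall>t\<le>t0. conj_op (D t) x \<circ> y = y \<circ> conj_op (D t) x"
  shows "\<exists>\<eta>. ((\<lambda>\<T>. avg \<T> (\<lambda>t. conj_op (W t) x \<xi>)) \<longlongrightarrow> \<eta>) at_top \<and>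
             ((\<lambda>\<T>. avg \<T> (\<lambda>t. conj_op (W t) x \<xi>)) \<longlongrightarrow> \<eta>) at_bot"
proof -
  define W' where "W' t = W (- t)" for t
  define D' where "D' t = D (- t)" for t
  have W': "unitary_group W'" and D': "unitary_group D'"
    unfolding W'_def D'_def by (intro unitary_group_reverse W D)+
  have i: "invariants W' = invariants W" "invariants D' = invariants W"
    unfolding W'_def D'_def using inv by (simp_all add: invariants_reverse)
  have \<Omega>': "\<Omega> \<in> invariants W'" "\<Omega> \<in> invariants D'" using \<Omega> i by auto
  have neg: "\<exists>t0. \<forall>t\<ge>t0. P (- t)" if ex: "\<exists>t0. \<forall>t\<le>t0. P t" for P :: "real \<Rightarrow> bool"
  proof -
    obtain t0 where t0: "\<forall>t\<le>t0. P t" using ex by blast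
    have "\<forall>t\<ge>-t0. P (- t)" using t0 by auto
    then show ?thesis by blast
  qed
  have commZ': "\<exists>t0. \<forall>t\<ge>t0. conj_op (W' t) x \<circ> z = z \<circ> conj_op (W' t) x" if "z \<in> Z" for z
    unfolding W'_def by (rule neg[OF commZ[OF that]])
  have commD': "\<exists>t0. \<forall>t\<ge>t0. conj_op (D' t) x \<circ> z = z \<circ> conj_op (D' t) x" if "z \<in> Y \<union> Z" for z
    unfolding D'_def by (rule neg[OF commD[OF that]])
  have ev: "\<forall>\<^sub>F \<T>::real in at_top. \<T> \<noteq> 0" using eventually_gt_at_top[of 0] by eventually_elim auto
  obtain F where F: "\<And>\<xi>. ((\<lambda>\<T>. avg \<T> (\<lambda>t. conj_op (W t) x \<xi>)) \<longlongrightarrow> F \<xi>) at_top"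
    using averaged_orbit_convergent[OF W x \<Omega> Y commY] by metis
  obtain G where G: "\<And>\<xi>. ((\<lambda>\<T>. avg \<T> (\<lambda>t. conj_op (W' t) x \<xi>)) \<longlongrightarrow> G \<xi>) at_top"
    using averaged_orbit_convergent[OF W' x \<Omega>'(1) Z commZ'] by metis
  define \<eta> where "\<eta> = oproj (invariants W) (x \<Omega>)"
  define \<eta>' where "\<eta>' = oproj (invariants W) (cadjoint x \<Omega>)"
  have agree: "F (y \<Omega>) = G (y \<Omega>)" if y: "y \<in> Y" for y
  proof -
    have yb: "bounded_clinear y" using von_neumann_algebraD(1)[OF Y(1) y] .
    have Fy: "F (y \<Omega>) = y \<eta>"
      using commY[OF y] averaged_orbit_right[OF W x \<Omega> yb] F[of "y \<Omega>"]
        tendsto_unique[OF trivial_limit_at_top_linorder] unfolding \<eta>_def by blast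
    have "cinner (z \<Omega>) (F (y \<Omega>)) = cinner (z \<Omega>) (G (y \<Omega>))" if z: "z \<in> Z" for z
    proof -
      have zb: "bounded_clinear z" and zz: "cadjoint z \<in> Z"
        using von_neumann_algebraD(1,2)[OF Z(1) z] by auto
      have lin: "avg \<T> (\<lambda>t. cinner (z \<Omega>) (conj_op (V t) x (y \<Omega>)))
          = cinner (z \<Omega>) (avg \<T> (\<lambda>t. conj_op (V t) x (y \<Omega>)))"
        if "unitary_group V" "\<T> \<noteq> 0" for \<T> V
        by (rule avg_linear[OF bounded_linear_cinner_right orbit_continuous[OF that(1) x] orbit_bound[OF that(1) x] that(2)])
      \<comment> \<open>The left formula gives the same value along \<open>W'\<close> and
        \<open>D'\<close>, since their invariants coincide. Along \<open>D'\<close> the right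
        formula is available for the same averages, and uniqueness of limits equates the
        two.\<close>
      have "((\<lambda>\<T>. avg \<T> (\<lambda>t. cinner (z \<Omega>) (conj_op (W' t) x (y \<Omega>)))) \<longlongrightarrow> cinner (z \<Omega>) (G (y \<Omega>))) at_top"
        by (rule Lim_transform_eventually[OF tendsto_cinner_right[OF G]])
          (use ev in eventually_elim, simp add: lin[OF W'])
      moreover have "((\<lambda>\<T>. avg \<T> (\<lambda>t. cinner (z \<Omega>) (conj_op (W' t) x (y \<Omega>)))) \<longlongrightarrow>
          cinner \<eta>' (cadjoint z (y \<Omega>))) at_top"
        using commZ'[OF zz] averaged_orbit_left[OF W' x \<Omega>'(1) zb] unfolding \<eta>'_def i by blast
      moreover have "((\<lambda>\<T>. avg \<T> (\<lambda>t. cinner (z \<Omega>) (conj_op (D' t) x (y \<Omega>)))) \<longlongrightarrow>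
          cinner \<eta>' (cadjoint z (y \<Omega>))) at_top"
        using commD'[of "cadjoint z"] zz averaged_orbit_left[OF D' x \<Omega>'(2) zb] unfolding \<eta>'_def i by blast
      moreover have "((\<lambda>\<T>. avg \<T> (\<lambda>t. conj_op (D' t) x (y \<Omega>))) \<longlongrightarrow> y \<eta>) at_top"
        using commD'[of y] y averaged_orbit_right[OF D' x \<Omega>'(2) yb] unfolding \<eta>_def i by blast
      then have "((\<lambda>\<T>. avg \<T> (\<lambda>t. cinner (z \<Omega>) (conj_op (D' t) x (y \<Omega>)))) \<longlongrightarrow> cinner (z \<Omega>) (y \<eta>)) at_top"
        by (rule Lim_transform_eventually[OF tendsto_cinner_right])
          (use ev in eventually_elim, simp add: lin[OF D'])
      ultimately have "cinner (z \<Omega>) (G (y \<Omega>)) = cinner (z \<Omega>) (y \<eta>)"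
        using tendsto_unique[OF trivial_limit_at_top_linorder] by metis
      then show ?thesis by (simp add: Fy)
    qed
    then have "{z \<Omega> | z. z \<in> Z} \<subseteq> {v. cinner (F (y \<Omega>) - G (y \<Omega>)) v = 0}"
      by (auto simp: cinner_diff_left) (metis cinner_commute)
    moreover have "closed {v. cinner (F (y \<Omega>) - G (y \<Omega>)) v = 0}"
      by (intro closed_Collect_eq continuous_on_cinner_right continuous_on_id continuous_on_const)
    ultimately have "cinner (F (y \<Omega>) - G (y \<Omega>)) v = 0" for v using closure_minimal Z(2) by blast
    then show ?thesis by (metis cinner_self_eq_0 eq_iff_diff_eq_0)
  qed
  \<comment> \<open>The limit maps inherit the uniform bound, so their agreement on the dense set of
    all \<open>y \<Omega>\<close> extends by continuity.\<close>
  have lip: "(onorm x)-lipschitz_on UNIV F" "(onorm x)-lipschitz_on UNIV G"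
  proof -
    show "(onorm x)-lipschitz_on UNIV F"
    proof (rule lipschitz_onI)
      show "dist (F a) (F b) \<le> onorm x * dist a b" for a b
        unfolding dist_norm
        by (rule tendsto_upperbound[OF tendsto_norm[OF tendsto_diff[OF F F]]])
          (rule eventually_mono[OF ev averaged_orbit_diff[OF W x]], assumption, simp)
    qed (rule onorm_pos_le[OF bounded_clinearD(1)[OF x]])
    show "(onorm x)-lipschitz_on UNIV G"
    proof (rule lipschitz_onI)
      show "dist (G a) (G b) \<le> onorm x * dist a b" for a b
        unfolding dist_norm
        by (rule tendsto_upperbound[OF tendsto_norm[OF tendsto_diff[OF G G]]])
          (rule eventually_mono[OF ev averaged_orbit_diff[OF W' x]], assumption, simp)
    qed (rule onorm_pos_le[OF bounded_clinearD(1)[OF x]])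
  qed
  have "closed {\<xi>. F \<xi> = G \<xi>}"
    by (intro closed_Collect_eq lipschitz_on_continuous_on[OF lip(1)] lipschitz_on_continuous_on[OF lip(2)])
  then have "F \<xi> = G \<xi>"
    using closure_minimal[of "{y \<Omega> | y. y \<in> Y}" "{\<xi>. F \<xi> = G \<xi>}"] agree Y(2) by auto
  moreover have "((\<lambda>\<T>. avg \<T> (\<lambda>t. conj_op (W t) x \<xi>)) \<longlongrightarrow> G \<xi>) at_bot"
    using G[of \<xi>] unfolding filterlim_at_bot_mirror avg_uminus W'_def .
  ultimately show ?thesis using F[of \<xi>] by auto
qed

end

section \<open>The Reeh-Schlieder property\<close>

subsection \<open>Positive energy and analytic continuation\<close>

text \<open>Extending \<open>g\<close> by 0 below a real interval of zeros gives a function that is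
  continuous on a disc and holomorphic off the real axis, hence holomorphic. It vanishes on the
  lower half disc, so the identity theorem annihilates \<open>g\<close> on the upper half-plane, and
  continuity reaches the whole real axis.\<close>

lemma half_plane_uniqueness:
  fixes g :: "complex \<Rightarrow> complex"
  assumes cont: "continuous_on {z. Im z \<ge> 0} g" and hol: "g holomorphic_on {z. Im z > 0}"
    and r: "r > 0" and zero: "\<And>t. \<bar>t\<bar> < r \<Longrightarrow> g (of_real t) = 0"
  shows "g (of_real t) = 0"
proof -
  define f where "f z = (if Im z \<ge> 0 then g z else 0)" for z
  \<comment> \<open>Half the radius keeps the real points of the closed disc inside the interval
    where \<open>g\<close> is known to vanish.\<close>
  let ?B = "ball (0::complex) (r / 2)" and ?C = "cball (0::complex) (r / 2)"
  have real0: "g z = 0" if "Im z = 0" "cmod z \<le> r / 2" for z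
  proof -
    have "z = of_real (Re z)" using that by (simp add: complex_eq_iff)
    moreover have "\<bar>Re z\<bar> < r" using abs_Re_le_cmod[of z] that(2) r by linarith
    ultimately show ?thesis using zero by metis
  qed
  have "continuous_on ({z \<in> ?C. Im z \<ge> 0} \<union> {z \<in> ?C. Im z \<le> 0}) f"
    unfolding f_def
  proof (rule continuous_on_cases)
    have e: "{z \<in> ?C. Im z \<ge> 0} = ?C \<inter> {z. Im z \<ge> 0}" "{z \<in> ?C. Im z \<le> 0} = ?C \<inter> {z. Im z \<le> 0}" by auto
    show "closed {z \<in> ?C. Im z \<ge> 0}" "closed {z \<in> ?C. Im z \<le> 0}"
      unfolding e by (intro closed_Int closed_cball closed_halfspace_Im_ge closed_halfspace_Im_le)+
    show "continuous_on {z \<in> ?C. Im z \<ge> 0} g" by (rule continuous_on_subset[OF cont]) auto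
  qed (use real0 in auto)
  then have fc: "continuous_on ?B f" by (rule continuous_on_subset) auto
  have fh: "f holomorphic_on ?B"
  proof (rule holomorphic_on_paste_across_line[where d = \<i> and k = 0, OF _ _ _ _ fc])
    have "(\<lambda>z. 0) holomorphic_on ?B \<inter> {z. \<i> \<bullet> z < 0}" by simp
    then show "f holomorphic_on ?B \<inter> {z. \<i> \<bullet> z < 0}"
      by (rule holomorphic_transform) (auto simp: f_def inner_complex_def)
    have "g holomorphic_on ?B \<inter> {z. 0 < \<i> \<bullet> z}"
      by (rule holomorphic_on_subset[OF hol]) (auto simp: inner_complex_def)
    then show "f holomorphic_on ?B \<inter> {z. 0 < \<i> \<bullet> z}"
      by (rule holomorphic_transform) (auto simp: f_def inner_complex_def)
  qed auto
  have f0: "f z = 0" if "z \<in> ?B" for z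
  proof (rule analytic_continuation_open[of "?B \<inter> {z. Im z < 0}" ?B f "\<lambda>z. 0"])
    have "Complex 0 (- r / 4) \<in> ?B \<inter> {z. Im z < 0}" using r by (simp add: complex_norm)
    then show "?B \<inter> {z. Im z < 0} \<noteq> {}" by blast
  qed (use fh that in \<open>auto intro: open_halfspace_Im_lt simp: f_def\<close>)
  have g0: "g z = 0" if "Im z > 0" for z
  proof (rule analytic_continuation_open[of "?B \<inter> {z. Im z > 0}" "{z. Im z > 0}" g "\<lambda>z. 0"])
    have "Complex 0 (r / 4) \<in> ?B \<inter> {z. Im z > 0}" using r by (simp add: complex_norm)
    then show "?B \<inter> {z. Im z > 0} \<noteq> {}" by blast
    show "g z = 0" if "z \<in> ?B \<inter> {z. Im z > 0}" for z using f0[of z] that by (auto simp: f_def)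
    show "connected {z. Im z > 0}" by (intro convex_connected convex_halfspace_Im_gt)
  qed (use hol that in \<open>auto intro: open_halfspace_Im_gt\<close>)
  define X where "X n = Complex t (inverse (Suc n))" for n
  have X: "X \<longlonglongrightarrow> Complex t 0"
    unfolding X_def by (intro tendsto_Complex tendsto_const LIMSEQ_inverse_real_of_nat)
  have "(\<lambda>n. g (X n)) \<longlonglongrightarrow> g (Complex t 0)"
    by (rule continuous_on_tendsto_compose[OF cont X]) (simp_all add: X_def)
  moreover have "g (X n) = 0" for n by (rule g0) (simp add: X_def)
  ultimately show ?thesis by (simp add: LIMSEQ_const_iff complex_of_real_def)
qed

section \<open>Laplace transforms of nonnegative functions on a finite measure space\<close>

context
  fixes M :: "'a measure" and l :: "'a \<Rightarrow> real" and G :: "complex \<Rightarrow> complex"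
  assumes M: "finite_measure M" and l[measurable]: "l \<in> borel_measurable M" and pos: "AE x in M. l x \<ge> 0"
  defines "G \<equiv> \<lambda>z. LINT x|M. exp (\<i> * z * of_real (l x))"
begin

text \<open>For \<open>Im z \<ge> 0\<close> and \<open>l x \<ge> 0\<close> the integrand has modulus
  at most 1, an integrable majorant on a finite measure space.\<close>

lemma laplace_continuous: "continuous_on {z. Im z \<ge> 0} G"
  unfolding continuous_on_sequentially
proof (intro allI impI ballI, elim conjE)
  interpret finite_measure M by (rule M)
  fix X and z :: complex assume X: "\<forall>n. X n \<in> {z. Im z \<ge> 0}" "X \<longlonglongrightarrow> z"
  show "(G \<circ> X) \<longlonglongrightarrow> G z"
    unfolding o_def G_def
  proof (rule integral_dominated_convergence[where w = "\<lambda>_. 1"])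
    show "AE x in M. (\<lambda>n. exp (\<i> * X n * of_real (l x))) \<longlonglongrightarrow> exp (\<i> * z * of_real (l x))"
      by (intro AE_I2 tendsto_intros X)
    show "AE x in M. norm (exp (\<i> * X n * of_real (l x))) \<le> 1" for n
      using pos by eventually_elim (use X(1) in \<open>auto simp: mult_nonneg_nonneg\<close>)
  qed auto
qed

text \<open>Differentiation under the integral. Although \<open>l\<close> may be unbounded, the
  exponential decay in \<open>Im z > 0\<close> bounds the difference quotients uniformly in
  \<open>x\<close>.\<close>

lemma laplace_holomorphic: "G holomorphic_on {z. Im z > 0}"
proof -
  interpret finite_measure M by (rule M)
  let ?e = "\<lambda>x z. exp (\<i> * z * of_real (l x))"
  have int: "integrable M (\<lambda>x. ?e x z)" if "Im z \<ge> 0" for z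
  proof (rule integrable_const_bound[where B = 1])
    show "AE x in M. norm (?e x z) \<le> 1"
      using pos by eventually_elim (use that in \<open>auto simp: mult_nonneg_nonneg\<close>)
  qed auto
  have "G field_differentiable at z" if z: "Im z > 0" for z
  proof -
    \<comment> \<open>The half-plane \<open>Im w > \<delta>\<close> contains \<open>z\<close> and is
      convex; on it the derivative in \<open>z\<close> is at most
      \<open>exp (- (\<delta> * l x)) * l x\<close>, hence at most
      \<open>1 / \<delta>\<close>.\<close>
    define \<delta> where "\<delta> = Im z / 2"
    have \<delta>: "\<delta> > 0" using z by (simp add: \<delta>_def)
    define S where "S = {w. Im w > \<delta>}"
    have S: "convex S" "open S" "z \<in> S"
      unfolding S_def using z by (auto intro: convex_halfspace_Im_gt open_halfspace_Im_gt) (simp add: \<delta>_def)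
    have quot: "norm ((?e x w - ?e x z) / (w - z)) \<le> 1 / \<delta>" if x: "l x \<ge> 0" and w: "w \<in> S" "w \<noteq> z" for x w
    proof -
      have "norm (?e x w - ?e x z) \<le> (1 / \<delta>) * norm (w - z)"
      proof (rule field_differentiable_bound[OF S(1), where f' = "\<lambda>w. ?e x w * (\<i> * of_real (l x))"])
        show "((?e x) has_field_derivative ?e x u * (\<i> * of_real (l x))) (at u within S)" for u
          by (auto intro!: derivative_eq_intros)
        show "norm (?e x u * (\<i> * of_real (l x))) \<le> 1 / \<delta>" if "u \<in> S" for u
        proof -
          have "norm (?e x u * (\<i> * of_real (l x))) = exp (- (Im u * l x)) * l x"
            using x by (simp add: norm_mult)
          also have "\<dots> \<le> exp (- (\<delta> * l x)) * l x"
            using x that by (intro mult_right_mono) (auto simp: S_def intro: mult_right_mono)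
          also have "\<dots> \<le> 1 / \<delta>"
          proof -
            have "\<delta> * l x \<le> exp (\<delta> * l x)" using exp_ge_add_one_self[of "\<delta> * l x"] by linarith
            then show ?thesis using \<delta> by (simp add: exp_minus field_simps)
          qed
          finally show ?thesis .
        qed
      qed (use w S in auto)
      then show ?thesis using w by (simp add: norm_divide pos_divide_le_eq)
    qed
    have "(G has_field_derivative (LINT x|M. ?e x z * (\<i> * of_real (l x)))) (at z within S)"
      unfolding has_field_derivative_iff tendsto_at_iff_sequentially
    proof (intro allI impI)
      fix X assume X: "\<forall>i::nat. X i \<in> S - {z}" "X \<longlonglongrightarrow> z"
      have eq: "(G (X n) - G z) / (X n - z) = (LINT x|M. (?e x (X n) - ?e x z) / (X n - z))" for n
      proof -
        have "Im (X n) \<ge> 0" using X(1)[rule_format, of n] \<delta> by (auto simp: S_def)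
        then show ?thesis
          using int[of "X n"] int[of z] z by (simp add: G_def)
      qed
      show "((\<lambda>w. (G w - G z) / (w - z)) \<circ> X) \<longlonglongrightarrow> (LINT x|M. ?e x z * (\<i> * of_real (l x)))"
        unfolding o_def eq
      proof (rule integral_dominated_convergence[where w = "\<lambda>_. 1 / \<delta>"])
        show "AE x in M. norm ((?e x (X n) - ?e x z) / (X n - z)) \<le> 1 / \<delta>" for n
          using pos by eventually_elim (rule quot, use X(1) in auto)
        show "AE x in M. (\<lambda>n. (?e x (X n) - ?e x z) / (X n - z)) \<longlonglongrightarrow> ?e x z * (\<i> * of_real (l x))"
        proof (rule AE_I2)
          fix x
          have "((?e x) has_field_derivative ?e x z * (\<i> * of_real (l x))) (at z within S)"
            by (auto intro!: derivative_eq_intros)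
          then show "(\<lambda>n. (?e x (X n) - ?e x z) / (X n - z)) \<longlonglongrightarrow> ?e x z * (\<i> * of_real (l x))"
            unfolding has_field_derivative_iff tendsto_at_iff_sequentially using X by (auto simp: o_def)
        qed
      qed auto
    qed
    then show ?thesis
      using S by (metis at_within_open field_differentiable_def)
  qed
  then show ?thesis
    by (simp add: holomorphic_on_open field_differentiable_def open_halfspace_Im_gt)
qed

end

section \<open>Spectral measures of the translations and positivity of the energy\<close>

context
  fixes T :: "spacetime \<Rightarrow> 'h::chilbert_space \<Rightarrow> 'h" and E
  assumes E: "joint_spectral_measure T E"
begin

lemma spectral_projection:
  assumes "B \<in> sets borel"
  shows "bounded_clinear (E B)" "cinner \<xi> (E B \<xi>) = of_real ((norm (E B \<xi>))\<^sup>2)"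
proof -
  show b: "bounded_clinear (E B)" using E assms by (auto simp: joint_spectral_measure_def)
  have "cadjoint (E B) = E B" "E B (E B \<xi>) = E B \<xi>"
    using E assms unfolding joint_spectral_measure_def by (auto simp: fun_eq_iff)
  then show "cinner \<xi> (E B \<xi>) = of_real ((norm (E B \<xi>))\<^sup>2)"
    using cinner_cadjoint[OF b, of \<xi> "E B \<xi>"] by (simp add: cinner_self)
qed

lemma spectral_sums:
  "range B \<subseteq> sets borel \<Longrightarrow> disjoint_family B \<Longrightarrow> (\<lambda>n::nat. E (B n) \<xi>) sums E (\<Union>n. B n) \<xi>"
  using E by (auto simp: joint_spectral_measure_def)

text \<open>\<open>measure_of\<close> takes the prescribed values only once these are known to form
  a measure; countable additivity comes from the strong sums of \<open>E\<close>.\<close>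

lemma emeasure_spectral_distribution:
  assumes "B \<in> sets borel"
  shows "emeasure (spectral_distribution E \<xi>) B = ennreal ((norm (E B \<xi>))\<^sup>2)"
proof -
  have "emeasure (spectral_distribution E \<xi>) B = ennreal (Re (cinner \<xi> (E B \<xi>)))"
    unfolding spectral_distribution_def
  proof (rule emeasure_measure_of_sigma[OF _ _ _ assms])
    show "sigma_algebra UNIV (sets borel :: spacetime set set)"
      using sets.sigma_algebra_axioms[of "borel :: spacetime measure"] by simp
    \<comment> \<open>\<open>E {} = 0\<close> is not postulated; it follows because a convergent
      series with constant terms must have zero terms.\<close>
    have "(\<lambda>n::nat. E {} \<xi>) sums E {} \<xi>"
      using spectral_sums[of "\<lambda>_. {}" \<xi>] by (simp add: disjoint_family_on_def)
    then have "(\<lambda>n::nat. E {} \<xi>) \<longlonglongrightarrow> 0" by (intro summable_LIMSEQ_zero) (auto simp: summable_def)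
    then have "E {} \<xi> = 0" by (simp add: LIMSEQ_const_iff)
    then show "positive (sets borel) (\<lambda>B. ennreal (Re (cinner \<xi> (E B \<xi>))))"
      by (simp add: positive_def)
    show "countably_additive (sets borel) (\<lambda>B. ennreal (Re (cinner \<xi> (E B \<xi>))))"
      unfolding countably_additive_def
    proof (intro allI impI)
      fix B :: "nat \<Rightarrow> spacetime set"
      assume B: "range B \<subseteq> sets borel" "disjoint_family B"
      show "(\<Sum>n. ennreal (Re (cinner \<xi> (E (B n) \<xi>)))) = ennreal (Re (cinner \<xi> (E (\<Union>n. B n) \<xi>)))"
      proof (rule suminf_ennreal_eq)
        show "0 \<le> Re (cinner \<xi> (E (B n) \<xi>))" for n
          using spectral_projection(2)[of "B n" \<xi>] B(1) by auto
        show "(\<lambda>n. Re (cinner \<xi> (E (B n) \<xi>))) sums Re (cinner \<xi> (E (\<Union>n. B n) \<xi>))"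
          unfolding Re_cinner
          by (rule bounded_linear.sums[OF bounded_linear_inner_right spectral_sums[OF B]])
      qed
    qed
  qed
  then show ?thesis by (simp add: spectral_projection(2)[OF assms])
qed

lemma space_sets_spectral_distribution [simp]:
  "space (spectral_distribution E \<xi>) = UNIV" "sets (spectral_distribution E \<xi>) = sets borel"
  unfolding spectral_distribution_def
  by (auto simp: space_measure_of_conv sets.sigma_sets_eq[of borel, simplified])

lemma finite_spectral_distribution: "finite_measure (spectral_distribution E \<xi>)"
  by (rule finite_measureI) (simp add: emeasure_spectral_distribution)

text \<open>Outside the support every point has an open neighborhood of measure 0; by the Lindelof
  property countably many of them cover the complement of the cone.\<close>

lemma spectral_distribution_AE:
  assumes supp: "spectral_support E \<subseteq> forward_cone"
  shows "AE p in spectral_distribution E \<xi>. p \<in> forward_cone"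
proof -
  let ?M = "spectral_distribution E \<xi>"
  define F where "F = {N. open N \<and> E N = (\<lambda>\<xi>. 0)}"
  obtain F' where F': "F' \<subseteq> F" "countable F'" "\<Union>F' = \<Union>F"
    using Lindelof[of F] by (auto simp: F_def)
  have "N \<in> null_sets ?M" if "N \<in> F" for N
    using that by (auto simp: null_sets_def F_def emeasure_spectral_distribution)
  then have "(\<Union>N\<in>F'. N) \<in> null_sets ?M" using F' by (intro null_sets_UN') auto
  then have null: "\<Union>F \<in> null_sets ?M" using F'(3) by simp
  have "p \<in> \<Union>F" if "p \<notin> forward_cone" for p
    using that supp unfolding spectral_support_def F_def by auto
  then show ?thesis by (intro AE_I'[OF null]) auto
qed

text \<open>Nonnegativity of \<open>mink p e\<close> on the spectrum makes the matrix element, as a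
  function of \<open>t\<close>, the boundary value of a holomorphic function on the upper
  half-plane. Vanishing near 0 then forces vanishing everywhere.\<close>

lemma positive_energy_uniqueness:
  assumes supp: "spectral_support E \<subseteq> forward_cone" and T: "\<And>a. bounded_clinear (T a)"
    and e: "\<And>p. p \<in> forward_cone \<Longrightarrow> mink p e \<ge> 0"
    and r: "r > 0" "\<And>t. \<bar>t\<bar> < r \<Longrightarrow> cinner \<psi> (T (t *\<^sub>R e) \<phi>) = 0"
  shows "cinner \<psi> (T (t *\<^sub>R e) \<phi>) = 0"
proof -
  let ?\<mu> = "spectral_distribution E"
  define G where "G \<xi> z = (LINT p|?\<mu> \<xi>. exp (\<i> * z * of_real (mink p e)))" for \<xi> z
  have meas: "(\<lambda>p. mink p e) \<in> borel_measurable (?\<mu> \<xi>)" for \<xi>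
  proof -
    have "(\<lambda>p. mink p e) \<in> borel_measurable borel"
      unfolding mink_def by (intro borel_measurable_continuous_onI continuous_intros)
    then show ?thesis by (simp cong: measurable_cong_sets)
  qed
  have ae: "AE p in ?\<mu> \<xi>. mink p e \<ge> 0" for \<xi>
    using spectral_distribution_AE[OF supp] by eventually_elim (rule e)
  have Gc: "continuous_on {z. Im z \<ge> 0} (G \<xi>)" and Gh: "G \<xi> holomorphic_on {z. Im z > 0}" for \<xi>
    unfolding G_def
    by (rule laplace_continuous[OF finite_spectral_distribution meas ae]
        laplace_holomorphic[OF finite_spectral_distribution meas ae])+
  have Gt: "G \<xi> (of_real t) = cinner \<xi> (T (t *\<^sub>R e) \<xi>)" for \<xi> t
  proof -
    have "mink p (t *\<^sub>R e) = t * mink p e" for p by (simp add: mink_def algebra_simps)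
    moreover have "cinner \<xi> (T a \<xi>) = (LINT p|?\<mu> \<xi>. cis (mink p a))" for a
      using E unfolding joint_spectral_measure_def by blast
    ultimately show ?thesis by (simp add: G_def cis_conv_exp mult.assoc)
  qed
  \<comment> \<open>Spectral distributions describe diagonal matrix elements; polarization recovers
    the mixed one from four of them.\<close>
  have polar: "4 * cinner \<psi> (T a \<phi>) =
      cinner (\<psi> + \<phi>) (T a (\<psi> + \<phi>)) - cinner (\<psi> + (-1) *\<^sub>C \<phi>) (T a (\<psi> + (-1) *\<^sub>C \<phi>))
      - \<i> * cinner (\<psi> + \<i> *\<^sub>C \<phi>) (T a (\<psi> + \<i> *\<^sub>C \<phi>)) + \<i> * cinner (\<psi> + (- \<i>) *\<^sub>C \<phi>) (T a (\<psi> + (- \<i>) *\<^sub>C \<phi>))" for a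
    using bounded_clinearD[OF T[of a]]
    by (simp add: linear_add bounded_linear.linear cinner_add_left cinner_add_right
        cinner_scaleC_left cinner_scaleC_right algebra_simps)
  define g where "g z = G (\<psi> + \<phi>) z - G (\<psi> + (-1) *\<^sub>C \<phi>) z
      - \<i> * G (\<psi> + \<i> *\<^sub>C \<phi>) z + \<i> * G (\<psi> + (- \<i>) *\<^sub>C \<phi>) z" for z
  have gt: "g (of_real t) = 4 * cinner \<psi> (T (t *\<^sub>R e) \<phi>)" for t
    unfolding g_def Gt polar ..
  have "g (of_real t) = 0"
  proof (rule half_plane_uniqueness[OF _ _ r(1)])
    show "continuous_on {z. Im z \<ge> 0} g" unfolding g_def by (intro continuous_intros Gc)
    show "g holomorphic_on {z. Im z > 0}" unfolding g_def by (intro holomorphic_intros Gh)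
  qed (simp add: gt r(2))
  then show ?thesis by (simp add: gt)
qed

end

subsection \<open>Translations\<close>

lemma translation_in_poincare: "(\<lambda>b. a + b) \<in> poincare_group"
proof -
  have "(\<lambda>b. b) \<in> proper_orthochronous_lorentz"
    by (auto simp: proper_orthochronous_lorentz_def linear_iff)
  then show ?thesis
    unfolding poincare_group_def by (intro CollectI exI[of _ a] exI[of _ "\<lambda>b. b"]) simp
qed

lemma unitary_repD:
  assumes "unitary_rep G gmul V"
  shows "g \<in> G \<Longrightarrow> unitary_op (V g)" "g \<in> G \<Longrightarrow> k \<in> G \<Longrightarrow> V (gmul g k) \<xi> = V g (V k \<xi>)"
    "continuous_on G (\<lambda>g. V g \<xi>)"
  using assms by (auto simp: unitary_rep_def)

context poincare_covariant_net
begin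

lemma transl_unitary: "unitary_op (transl U a)"
  unfolding transl_def by (rule unitary_repD(1)[OF representation translation_in_poincare])

lemma transl_add: "transl U (a + b) \<xi> = transl U a (transl U b \<xi>)"
  using unitary_repD(2)[OF representation translation_in_poincare[of a] translation_in_poincare[of b], of \<xi>]
  by (simp add: transl_def o_def add.assoc)

lemma transl_0: "transl U 0 \<xi> = \<xi>"
  using transl_add[of 0 0 \<xi>] unitary_opD(4)[OF transl_unitary[of 0]] by (metis add_0)

lemma transl_continuous: "continuous_on UNIV (\<lambda>a. transl U a \<xi>)"
  unfolding transl_def
  by (rule continuous_on_compose2[OF unitary_repD(3)[OF representation]])
    (auto intro!: continuous_on_coordinatewise_then_product continuous_intros translation_in_poincare)

lemma cadjoint_transl: "cadjoint (transl U a) = transl U (- a)"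
proof
  fix \<xi>
  have "cadjoint (transl U a) (transl U a (transl U (- a) \<xi>)) = transl U (- a) \<xi>"
    by (rule unitary_opD(4)[OF transl_unitary])
  then show "cadjoint (transl U a) \<xi> = transl U (- a) \<xi>"
    using transl_add[of a "- a" \<xi>] by (simp add: transl_0)
qed

lemma conj_transl: "conj_op (transl U a) x \<xi> = transl U a (x (transl U (- a) \<xi>))"
  by (simp add: conj_op_def cadjoint_transl)

lemma transl_covariance:
  "open S \<Longrightarrow> bounded S \<Longrightarrow> conj_op (transl U a) ` \<A> S = \<A> ((+) a ` S)"
  using covariance[OF translation_in_poincare, of S a] by (simp add: transl_def)

end

subsection \<open>Cyclicity of the vacuum for local algebras\<close>

text \<open>Words mixing translations with operators of one region. All translated copies of
  \<open>B\<close> map this set to itself, since a conjugate by a translation is translation,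
  operator, translation.\<close>

inductive_set word_orbit :: "(spacetime \<Rightarrow> 'h \<Rightarrow> 'h) \<Rightarrow> ('h \<Rightarrow> 'h) set \<Rightarrow> 'h \<Rightarrow> 'h set"
  for T B \<Omega> where
    base: "\<Omega> \<in> word_orbit T B \<Omega>"
  | transl: "\<phi> \<in> word_orbit T B \<Omega> \<Longrightarrow> T a \<phi> \<in> word_orbit T B \<Omega>"
  | op: "\<phi> \<in> word_orbit T B \<Omega> \<Longrightarrow> y \<in> B \<Longrightarrow> y \<phi> \<in> word_orbit T B \<Omega>"

context poincare_covariant_net
begin

text \<open>Induction on the word with \<open>\<psi>\<close> and \<open>a\<close> arbitrary. For
  small \<open>a\<close>, translating \<open>y \<phi>\<close> amounts to applying a conjugate of
  \<open>y\<close>, still in \<open>\<A> S\<close>, to the translated \<open>\<phi>\<close>. Its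
  adjoint moves to \<open>\<psi>\<close>, and the new vector is again orthogonal because
  \<open>\<A> S\<close> is an algebra. Positive energy then lifts the restriction on
  \<open>a\<close>.\<close>

lemma orthogonal_word_orbit:
  assumes S: "open S" "bounded S" and S0: "open S0" "bounded S0" and r: "r > 0"
    and sub: "\<And>a. norm a < r \<Longrightarrow> (+) a ` S0 \<subseteq> S"
    and \<Omega>: "\<And>a. transl U a \<Omega> = \<Omega>"
    and \<phi>: "\<phi> \<in> word_orbit (transl U) (\<A> S0) \<Omega>"
    and \<psi>: "\<And>y. y \<in> \<A> S \<Longrightarrow> cinner \<psi> (y \<Omega>) = 0"
  shows "cinner \<psi> (transl U a \<phi>) = 0"
  using \<phi> \<psi>
proof (induction arbitrary: \<psi> a)
  case base
  show ?case using base[OF von_neumann_algebraD(3)[OF local_algebra[OF S]]] by (simp add: \<Omega>)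
next
  case (transl \<phi> b)
  show ?case using transl.IH[of \<psi> "a + b"] transl.prems by (simp add: transl_add)
next
  case (op \<phi> y)
  obtain E where E: "joint_spectral_measure (transl U) E" "spectral_support E \<subseteq> forward_cone"
    using spectrum_condition by blast
  note uniq = positive_energy_uniqueness[OF E unitary_opD(1)[OF transl_unitary]]
  have small: "cinner \<psi> (transl U a (y \<phi>)) = 0" if a: "norm a < r" for a
  proof -
    let ?y = "conj_op (transl U a) y"
    have "?y \<in> \<A> ((+) a ` S0)" using op.hyps(2) transl_covariance[OF S0] by blast
    moreover have "\<A> ((+) a ` S0) \<subseteq> \<A> S"
      by (rule isotony[OF open_translation[OF S0(1)] bounded_translation[OF S0(2)] S sub[OF a]])
    ultimately have y: "?y \<in> \<A> S" by blast
    note bc = von_neumann_algebraD(1)[OF local_algebra[OF S] y]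
    have orth: "cinner (cadjoint ?y \<psi>) (z \<Omega>) = 0" if z: "z \<in> \<A> S" for z
      using op.prems[OF von_neumann_algebraD(4)[OF local_algebra[OF S] y z]]
      by (simp add: cinner_cadjoint[OF bc])
    have "cinner (cadjoint ?y \<psi>) (transl U a \<phi>) = 0" by (rule op.IH) (rule orth)
    then have "cinner \<psi> (?y (transl U a \<phi>)) = 0" by (simp add: cinner_cadjoint[OF bc])
    then show ?thesis
      using transl_add[of "- a" a \<phi>] by (simp add: conj_transl transl_0)
  qed
  \<comment> \<open>Two lightlike directions that span the plane and pair nonnegatively with the
    forward cone: one-variable uniqueness frees the coordinate along \<open>?m\<close> while the
    other is still small, then the coordinate along \<open>?p\<close>.\<close>
  let ?p = "(1, 1) :: spacetime" and ?m = "(1, -1) :: spacetime"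
  have cone: "mink q ?p \<ge> 0" "mink q ?m \<ge> 0" if "q \<in> forward_cone" for q
    using that by (auto simp: forward_cone_def mink_def)
  have 1: "cinner \<psi> (transl U (s *\<^sub>R ?p + t *\<^sub>R ?m) (y \<phi>)) = 0" if s: "\<bar>s\<bar> < r / 4" for s t
  proof -
    have eq: "cinner \<psi> (transl U (s *\<^sub>R ?p + t *\<^sub>R ?m) (y \<phi>)) =
        cinner (transl U (- (s *\<^sub>R ?p)) \<psi>) (transl U (t *\<^sub>R ?m) (y \<phi>))" for t
      unfolding transl_add cadjoint_transl[symmetric]
      by (rule cinner_cadjoint[OF unitary_opD(1)[OF transl_unitary], symmetric])
    have "cinner (transl U (- (s *\<^sub>R ?p)) \<psi>) (transl U (t *\<^sub>R ?m) (y \<phi>)) = 0"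
    proof (rule uniq[OF cone(2)])
      show "0 < r / 4" using r by simp
      fix t :: real assume t: "\<bar>t\<bar> < r / 4"
      have "norm (s *\<^sub>R ?p + t *\<^sub>R ?m) \<le> \<bar>s + t\<bar> + \<bar>s - t\<bar>"
        using norm_Pair_le[of "s + t" "s - t"] by simp
      also have "\<dots> < r" using s t by linarith
      finally show "cinner (transl U (- (s *\<^sub>R ?p)) \<psi>) (transl U (t *\<^sub>R ?m) (y \<phi>)) = 0"
        by (subst eq[symmetric]) (rule small)
    qed
    then show ?thesis unfolding eq .
  qed
  have 2: "cinner \<psi> (transl U (s *\<^sub>R ?p + t *\<^sub>R ?m) (y \<phi>)) = 0" for s t
    unfolding transl_add
  proof (rule uniq[OF cone(1)])
    show "0 < r / 4" using r by simp
    show "cinner \<psi> (transl U (s *\<^sub>R ?p) (transl U (t *\<^sub>R ?m) (y \<phi>))) = 0" if "\<bar>s\<bar> < r / 4" for s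
      using 1[OF that] unfolding transl_add .
  qed
  have "a = ((fst a + snd a) / 2) *\<^sub>R ?p + ((fst a - snd a) / 2) *\<^sub>R ?m"
    by (simp add: prod_eq_iff field_simps)
  then show ?case using 2[of "(fst a + snd a) / 2" "(fst a - snd a) / 2"] by argo
qed

text \<open>A vector orthogonal to the orbit of \<open>\<Omega>\<close> under \<open>\<A> S\<close>
  is orthogonal to all words over a smaller ball. The vectors with that property form a subspace
  invariant under every translate of the algebra of the ball, and these translates generate all
  local algebras, so cyclicity of \<open>\<Omega>\<close> leaves only zero.\<close>

theorem reeh_schlieder:
  assumes S: "open S" "bounded S" "S \<noteq> {}"
    and \<Omega>: "invariant_vector U \<Omega>"
    and cyclic: "closure {x \<Omega> | x. x \<in> vn_generated (\<Union>S\<in>{S. open S \<and> bounded S}. \<A> S)} = UNIV"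
  shows "closure {y \<Omega> | y. y \<in> \<A> S} = UNIV"
proof (rule dense_if_total[OF csubspace_orbit[OF local_algebra[OF S(1,2)]]])
  fix \<psi> assume \<psi>: "\<And>s. s \<in> {y \<Omega> | y. y \<in> \<A> S} \<Longrightarrow> cinner \<psi> s = 0"
  have \<Omega>': "transl U a \<Omega> = \<Omega>" for a
    using \<Omega> translation_in_poincare unfolding invariant_vector_def transl_def by blast
  obtain p where "p \<in> S" using S(3) by blast
  then obtain R where R: "R > 0" "ball p R \<subseteq> S" using S(1) openE by blast
  \<comment> \<open>The ball of radius \<open>r\<close> around \<open>p\<close>, moved by less than
    \<open>r\<close>, stays in the ball of radius \<open>R\<close>.\<close>
  define r where "r = R / 2"
  have r: "r > 0" using R by (simp add: r_def)
  define S0 where "S0 = ball p r"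
  have S0: "open S0" "bounded S0" by (auto simp: S0_def)
  have sub: "(+) a ` S0 \<subseteq> S" if "norm a < r" for a
  proof
    fix q assume "q \<in> (+) a ` S0"
    then obtain b where "q = a + b" "b \<in> S0" by blast
    then have b: "q = a + b" "dist p b < r" by (simp_all add: S0_def)
    have "dist p q \<le> dist p b + dist b q" by (rule dist_triangle)
    also have "dist b q = norm a" by (simp add: b dist_norm)
    finally have "dist p q < R" using that b(2) by (simp add: r_def)
    then show "q \<in> S" using R(2) by auto
  qed
  define L where "L = {\<psi>. \<forall>\<phi> \<in> word_orbit (transl U) (\<A> S0) \<Omega>. cinner \<psi> \<phi> = 0}"
  have \<psi>L: "\<psi> \<in> L"
    unfolding L_def
  proof (intro CollectI ballI)
    fix \<phi> assume "\<phi> \<in> word_orbit (transl U) (\<A> S0) \<Omega>"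
    then have "cinner \<psi> (transl U 0 \<phi>) = 0"
      using \<psi> by (intro orthogonal_word_orbit[OF S(1,2) S0 r sub \<Omega>']) blast+
    then show "cinner \<psi> \<phi> = 0" by (simp only: transl_0)
  qed
  have L: "csubspace L" by (auto simp: csubspace_def L_def cinner_add_left cinner_scaleC_left)
  have "L = {\<psi>. \<forall>\<phi>. \<phi> \<in> word_orbit (transl U) (\<A> S0) \<Omega> \<longrightarrow> cinner \<phi> \<psi> = 0}"
    unfolding L_def by (metis cinner_commute complex_cnj_zero)
  then have Lc: "closed L"
    by (simp only:) (intro closed_Collect_all closed_Collect_imp open_Collect_const closed_Collect_eq
        continuous_on_cinner_right continuous_on_id continuous_on_const)
  define X where "X = (\<Union>a. \<A> ((+) a ` S0))"
  have alg: "von_neumann_algebra (\<A> ((+) a ` S0))" for a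
    by (rule local_algebra[OF open_translation[OF S0(1)] bounded_translation[OF S0(2)]])
  have "\<exists>M. von_neumann_algebra M \<and> X \<subseteq> M \<and> (\<forall>x\<in>M. \<forall>\<psi>\<in>L. cinner \<psi> (x \<Omega>) = 0)"
  proof (rule von_neumann_algebra_orthogonal_vector[OF _ _ L Lc])
    show bX: "bounded_clinear x" "cadjoint x \<in> X" if x: "x \<in> X" for x
    proof -
      obtain a where "x \<in> \<A> ((+) a ` S0)" using x unfolding X_def by blast
      note v = von_neumann_algebraD(1,2)[OF alg this]
      show "bounded_clinear x" by (rule v)
      show "cadjoint x \<in> X" unfolding X_def by (rule UN_I[where a = a]) (rule UNIV_I, rule v(2))
    qed
    show "cinner \<psi> \<Omega> = 0" if "\<psi> \<in> L" for \<psi>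
      using that word_orbit.base[of \<Omega> "transl U" "\<A> S0"] unfolding L_def by simp
    show "x \<psi> \<in> L" if x: "x \<in> X" and \<psi>: "\<psi> \<in> L" for x \<psi>
      unfolding L_def
    proof (intro CollectI ballI)
      fix \<phi> assume \<phi>: "\<phi> \<in> word_orbit (transl U) (\<A> S0) \<Omega>"
      obtain a where "cadjoint x \<in> \<A> ((+) a ` S0)" using bX(2)[OF x] unfolding X_def by blast
      then obtain y where y: "y \<in> \<A> S0" "cadjoint x = conj_op (transl U a) y"
        using transl_covariance[OF S0, of a] by (metis imageE)
      have "cadjoint x \<phi> \<in> word_orbit (transl U) (\<A> S0) \<Omega>"
        unfolding y conj_transl
        by (rule word_orbit.transl[OF word_orbit.op[OF word_orbit.transl[OF \<phi>] y(1)]])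
      then have "cinner \<psi> (cadjoint x \<phi>) = 0" using \<psi> by (simp add: L_def)
      then show "cinner (x \<psi>) \<phi> = 0" by (simp add: cinner_cadjoint'[OF bX(1)[OF x]])
    qed
  qed
  then obtain M where M: "von_neumann_algebra M" "X \<subseteq> M" "\<And>x \<psi>. x \<in> M \<Longrightarrow> \<psi> \<in> L \<Longrightarrow> cinner \<psi> (x \<Omega>) = 0"
    by blast
  have "\<A> S' \<subseteq> M" if S': "open S'" "bounded S'" for S'
  proof -
    \<comment> \<open>Translates of the ball centered at all points of \<open>S'\<close>. Their
      union may exceed \<open>S'\<close> but is bounded, so isotony and additivity apply to
      it.\<close>
    define \<C> where "\<C> = (\<lambda>q. (+) (q - p) ` S0) ` S'"
    have op: "open C" if "C \<in> \<C>" for C using that open_translation[OF S0(1)] unfolding \<C>_def by blast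
    have cover: "S' \<subseteq> \<Union>\<C>"
    proof
      fix q assume "q \<in> S'"
      moreover have "q \<in> (+) (q - p) ` S0" using r by (auto simp: S0_def intro!: image_eqI[of _ _ p])
      ultimately show "q \<in> \<Union>\<C>" by (auto simp: \<C>_def)
    qed
    obtain B where B: "\<And>q. q \<in> S' \<Longrightarrow> norm q \<le> B" using S'(2) by (auto simp: bounded_iff)
    obtain B0 where B0: "\<And>b. b \<in> S0 \<Longrightarrow> norm b \<le> B0" using S0(2) by (auto simp: bounded_iff)
    have "norm c \<le> B + norm p + B0" if c: "c \<in> \<Union>\<C>" for c
    proof -
      obtain q b where q: "c = (q - p) + b" "q \<in> S'" "b \<in> S0" using c unfolding \<C>_def by blast
      show ?thesis
        using norm_triangle_ineq[of "q - p" b] norm_triangle_ineq4[of q p] B[OF q(2)] B0[OF q(3)]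
        unfolding q(1) by linarith
    qed
    then have bd: "bounded (\<Union>\<C>)" unfolding bounded_iff by blast
    have "\<A> S' \<subseteq> \<A> (\<Union>\<C>)" by (rule isotony[OF S' _ bd cover]) (use op in blast)
    also have "\<dots> = vn_generated (\<Union>C\<in>\<C>. \<A> C)" by (rule additivity[OF op bd])
    also have "(\<Union>C\<in>\<C>. \<A> C) \<subseteq> X" unfolding X_def \<C>_def by blast
    then have "vn_generated (\<Union>C\<in>\<C>. \<A> C) \<subseteq> M"
      unfolding vn_generated_def using M(1,2) by (intro Inter_lower) simp
    finally show ?thesis .
  qed
  then have "vn_generated (\<Union>S\<in>{S. open S \<and> bounded S}. \<A> S) \<subseteq> M"
    unfolding vn_generated_def using M(1) by (intro Inter_lower) auto
  then have "{x \<Omega> | x. x \<in> vn_generated (\<Union>S\<in>{S. open S \<and> bounded S}. \<A> S)} \<subseteq> {v. cinner \<psi> v = 0}"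
    using M(3)[OF _ \<psi>L] by blast
  moreover have "closed {v. cinner \<psi> v = 0}"
    by (intro closed_Collect_eq continuous_on_cinner_right continuous_on_id continuous_on_const)
  ultimately have "cinner \<psi> v = 0" for v using closure_minimal cyclic by blast
  then show "\<psi> = 0" by (metis cinner_self_eq_0)
qed

end

section \<open>The universal cover of the Moebius group\<close>

text \<open>Reduces identities in the universal cover to fractional linear computations near the
  point 0. Agreement there makes the two matrices proportional, so the lifts differ by multiples of
  \<open>pi\<close>; by continuity the multiple is constant, and at 0 it is 0.\<close>

lemma moebius_cover_eqI:
  assumes "f \<in> moebius_cover" "g \<in> moebius_cover"
    and r: "r > 0" and eq: "\<And>v. \<bar>v\<bar> < r \<Longrightarrow> f (arctan v) = g (arctan v)"
  shows "f = g"
proof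
  fix \<theta>
  obtain a b c d where f: "a * d - b * c = 1" "continuous_on UNIV f"
    "\<And>\<theta>. sin (f \<theta>) * (c * sin \<theta> + d * cos \<theta>) = cos (f \<theta>) * (a * sin \<theta> + b * cos \<theta>)"
    using assms(1) unfolding moebius_cover_def by blast
  obtain a' b' c' d' where g: "a' * d' - b' * c' = 1" "continuous_on UNIV g"
    "\<And>\<theta>. sin (g \<theta>) * (c' * sin \<theta> + d' * cos \<theta>) = cos (g \<theta>) * (a' * sin \<theta> + b' * cos \<theta>)"
    using assms(2) unfolding moebius_cover_def by blast
  \<comment> \<open>Coefficients of the quadratic form given by the cross product of the images of
    one vector under the two matrices; it vanishes identically when they are proportional.\<close>
  define A B C where "A = a * c' - c * a'" and "B = a * d' + b * c' - c * b' - d * a'" and "C = b * d' - d * b'"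
  have nz: "sin \<theta> \<noteq> 0 \<or> cos \<theta> \<noteq> (0::real)" for \<theta> using sin_zero_abs_cos_one by fastforce
  have quad: "A * v\<^sup>2 + B * v + C = 0" if "\<bar>v\<bar> < r" for v
  proof -
    let ?t = "arctan v"
    have s: "sin ?t = v * cos ?t" "cos ?t \<noteq> 0" by (simp_all add: sin_arctan cos_arctan)
      (smt (verit) not_sum_power2_lt_zero one_power2)
    have "cos ?t * (sin (f ?t) * (c * v + d) - cos (f ?t) * (a * v + b)) = 0"
      using f(3)[of ?t] by (simp add: s(1) algebra_simps)
    then have 1: "sin (f ?t) * (c * v + d) = cos (f ?t) * (a * v + b)" using s(2) by simp
    have "cos ?t * (sin (g ?t) * (c' * v + d') - cos (g ?t) * (a' * v + b')) = 0"
      using g(3)[of ?t] by (simp add: s(1) algebra_simps)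
    then have 2: "sin (f ?t) * (c' * v + d') = cos (f ?t) * (a' * v + b')" using s(2) eq[OF that] by simp
    define P Q P' Q' S K where "P = a * v + b" and "Q = c * v + d" and "P' = a' * v + b'"
      and "Q' = c' * v + d'" and "S = sin (f ?t)" and "K = cos (f ?t)"
    have poly: "A * v\<^sup>2 + B * v + C = P * Q' - Q * P'"
      by (simp add: A_def B_def C_def P_def Q_def P'_def Q'_def power2_eq_square algebra_simps)
    have "S * Q = K * P" "S * Q' = K * P'" using 1 2 by (simp_all add: P_def Q_def P'_def Q'_def S_def K_def)
    then have "S * (P * Q' - Q * P') = 0" "K * (P * Q' - Q * P') = 0" by algebra+
    then have "sin (f ?t) * (A * v\<^sup>2 + B * v + C) = 0" "cos (f ?t) * (A * v\<^sup>2 + B * v + C) = 0"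
      by (simp_all add: poly S_def K_def)
    then show ?thesis using nz[of "f ?t"] by auto
  qed
  have "C = 0" using quad[of 0] r by simp
  moreover have "A * (r / 2)\<^sup>2 + B * (r / 2) + C = 0" "A * (r / 2)\<^sup>2 - B * (r / 2) + C = 0"
    using quad[of "r / 2"] quad[of "- (r / 2)"] r by simp_all
  then have "B * (r / 2) = 0" "A * (r / 2)\<^sup>2 + C = 0" by linarith+
  ultimately have ABC: "A = 0" "B = 0" "C = 0" using r by auto
  have sin0: "sin (f \<theta> - g \<theta>) = 0" for \<theta>
  proof -
    let ?s = "sin \<theta>" and ?c = "cos \<theta>"
    define p q p' q' where "p = a * ?s + b * ?c" and "q = c * ?s + d * ?c"
      and "p' = a' * ?s + b' * ?c" and "q' = c' * ?s + d' * ?c"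
    have "p * q' - q * p' = A * ?s\<^sup>2 + B * ?s * ?c + C * ?c\<^sup>2"
      by (simp add: p_def q_def p'_def q'_def A_def B_def C_def power2_eq_square algebra_simps)
    then have pq: "p * q' = q * p'" by (simp add: ABC)
    have e: "sin (f \<theta>) * q = cos (f \<theta>) * p" "sin (g \<theta>) * q' = cos (g \<theta>) * p'"
      using f(3) g(3) by (simp_all add: p_def q_def p'_def q'_def)
    \<comment> \<open>Inverting the matrices recovers the unit vector of angle
      \<open>\<theta>\<close>, so neither image vector is zero.\<close>
    have "d * p - b * q = (a * d - b * c) * ?s" "a * q - c * p = (a * d - b * c) * ?c"
      "d' * p' - b' * q' = (a' * d' - b' * c') * ?s" "a' * q' - c' * p' = (a' * d' - b' * c') * ?c"
      by (simp_all add: p_def q_def p'_def q'_def algebra_simps)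
    then have "d * p - b * q = ?s" "a * q - c * p = ?c" "d' * p' - b' * q' = ?s" "a' * q' - c' * p' = ?c"
      by (simp_all add: f(1) g(1))
    then have n: "p \<noteq> 0 \<or> q \<noteq> 0" "p' \<noteq> 0 \<or> q' \<noteq> 0" using nz[of \<theta>] by auto
    define S K S' K' where "S = sin (f \<theta>)" and "K = cos (f \<theta>)" and "S' = sin (g \<theta>)" and "K' = cos (g \<theta>)"
    have e': "S * q = K * p" "S' * q' = K' * p'" using e by (simp_all add: S_def K_def S'_def K'_def)
    have "(S * K' - K * S') * (p * p') = 0" "(S * K' - K * S') * (p * q') = 0"
      "(S * K' - K * S') * (q * p') = 0" "(S * K' - K * S') * (q * q') = 0"
      using e' pq by algebra+
    moreover have "sin (f \<theta> - g \<theta>) = S * K' - K * S'" by (simp add: sin_diff S_def K_def S'_def K'_def)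
    ultimately show ?thesis using n by auto
  qed
  have int: "\<exists>n::int. f \<theta> - g \<theta> = of_int n * pi" for \<theta>
    using sin0[of \<theta>] by (auto simp: sin_zero_iff_int2)
  have "(\<lambda>\<theta>. (f \<theta> - g \<theta>) / pi) constant_on UNIV"
  proof (rule continuous_discrete_range_constant)
    show "continuous_on UNIV (\<lambda>\<theta>. (f \<theta> - g \<theta>) / pi)"
      using f(2) g(2) by (intro continuous_intros) auto
    show "\<exists>e>0. \<forall>y. y \<in> UNIV \<and> (f y - g y) / pi \<noteq> (f x - g x) / pi \<longrightarrow>
        e \<le> norm ((f y - g y) / pi - (f x - g x) / pi)" for x
    proof (intro exI[of _ 1] conjI allI impI)
      fix y assume y: "y \<in> UNIV \<and> (f y - g y) / pi \<noteq> (f x - g x) / pi"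
      obtain m n :: int where "f x - g x = of_int m * pi" "f y - g y = of_int n * pi" using int by metis
      then show "1 \<le> norm ((f y - g y) / pi - (f x - g x) / pi)"
        using y by (simp flip: of_int_diff of_int_abs)
    qed simp
  qed simp
  then obtain K where K: "\<And>\<theta>. (f \<theta> - g \<theta>) / pi = K" unfolding constant_on_def by auto
  have "f 0 = g 0" using eq[of 0] r by simp
  then have "K = 0" using K[of 0] by simp
  then show "f \<theta> = g \<theta>" using K[of \<theta>] by simp
qed

text \<open>
  The angle from \<open>(cos \<theta>, sin \<theta>)\<close> to its image under the matrix, computed from their cross and
  dot products; this is the lift close to the identity provided the dot product is positive.
\<close>

definition near_lift :: "real \<Rightarrow> real \<Rightarrow> real \<Rightarrow> real \<Rightarrow> real \<Rightarrow> real" where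
  "near_lift a b c d \<theta> = \<theta> + arctan
     (((a * sin \<theta> + b * cos \<theta>) * cos \<theta> - (c * sin \<theta> + d * cos \<theta>) * sin \<theta>) /
      ((a * sin \<theta> + b * cos \<theta>) * sin \<theta> + (c * sin \<theta> + d * cos \<theta>) * cos \<theta>))"

context
  fixes a b c d :: real
  assumes det: "a * d - b * c = 1"
    and dot: "\<And>\<theta>. (a * sin \<theta> + b * cos \<theta>) * sin \<theta> + (c * sin \<theta> + d * cos \<theta>) * cos \<theta> > 0"
begin

text \<open>Cross and dot product are the sine and cosine of the rotation angle times the length of
  the image vector; \<open>k\<close> is the reciprocal of that length.\<close>

lemma near_lift_sin_cos:
  obtains k where "k > 0" "sin (near_lift a b c d \<theta>) = k * (a * sin \<theta> + b * cos \<theta>)"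
    "cos (near_lift a b c d \<theta>) = k * (c * sin \<theta> + d * cos \<theta>)"
proof -
  define p q where "p = a * sin \<theta> + b * cos \<theta>" and "q = c * sin \<theta> + d * cos \<theta>"
  define \<phi> where "\<phi> = arctan ((p * cos \<theta> - q * sin \<theta>) / (p * sin \<theta> + q * cos \<theta>))"
  have D: "p * sin \<theta> + q * cos \<theta> > 0" using dot by (simp add: p_def q_def)
  define k where "k = cos \<phi> / (p * sin \<theta> + q * cos \<theta>)"
  have c: "cos \<phi> > 0" unfolding \<phi>_def by (simp add: cos_arctan add_pos_nonneg) 
  have k: "k > 0" using D c by (simp add: k_def)
  have 1: "cos \<phi> = k * (p * sin \<theta> + q * cos \<theta>)" using D by (simp add: k_def)
  have "tan \<phi> = (p * cos \<theta> - q * sin \<theta>) / (p * sin \<theta> + q * cos \<theta>)" by (simp add: \<phi>_def tan_arctan)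
  then have 2: "sin \<phi> = k * (p * cos \<theta> - q * sin \<theta>)" using c D by (simp add: k_def tan_def field_simps)
  have e: "near_lift a b c d \<theta> = \<theta> + \<phi>" by (simp add: near_lift_def \<phi>_def p_def q_def)
  have s: "(sin \<theta>)\<^sup>2 + (cos \<theta>)\<^sup>2 = 1" by simp
  have "sin (near_lift a b c d \<theta>) = k * p" "cos (near_lift a b c d \<theta>) = k * q"
    unfolding e sin_add cos_add 1 2 using s by algebra+
  then show thesis using that k by (simp add: p_def q_def)
qed

lemma near_lift_mem: "near_lift a b c d \<in> moebius_cover"
  unfolding moebius_cover_def
proof (intro CollectI conjI exI allI)
  show "continuous_on UNIV (near_lift a b c d)"
    unfolding near_lift_def[abs_def] using dot by (intro continuous_intros) (auto simp: less_le)
  show "sin (near_lift a b c d \<theta>) * (c * sin \<theta> + d * cos \<theta>) =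
      cos (near_lift a b c d \<theta>) * (a * sin \<theta> + b * cos \<theta>)" for \<theta>
    by (rule near_lift_sin_cos[of \<theta>]) simp
qed (rule det)

text \<open>As the sum of two values of \<open>arctan\<close>, the lift has modulus below
  \<open>pi\<close>; positivity of \<open>c * v + d\<close> makes its cosine positive and so selects
  the branch inside \<open>(- pi / 2, pi / 2)\<close>.\<close>

lemma near_lift_arctan:
  assumes "c * v + d > 0"
  shows "near_lift a b c d (arctan v) = arctan ((a * v + b) / (c * v + d))"
proof -
  let ?t = "arctan v" and ?f = "near_lift a b c d (arctan v)"
  obtain k where k: "k > 0" "sin ?f = k * (a * sin ?t + b * cos ?t)" "cos ?f = k * (c * sin ?t + d * cos ?t)"
    by (rule near_lift_sin_cos)
  have ct: "cos ?t > 0" by (simp add: cos_arctan add_pos_nonneg)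
  then have st: "sin ?t = v * cos ?t" using tan_arctan[of v] by (simp add: tan_def field_simps)
  have f: "sin ?f = (k * cos ?t) * (a * v + b)" "cos ?f = (k * cos ?t) * (c * v + d)"
    using k by (simp_all add: st algebra_simps)
  then have cf: "cos ?f > 0" using k(1) ct assms by simp
  have "\<bar>?f\<bar> < pi"
    using arctan_bounded[of v] arctan_bounded[of "((a * sin ?t + b * cos ?t) * cos ?t - (c * sin ?t + d * cos ?t) * sin ?t) /
      ((a * sin ?t + b * cos ?t) * sin ?t + (c * sin ?t + d * cos ?t) * cos ?t)"]
    unfolding near_lift_def by linarith
  then have "\<bar>?f\<bar> < pi / 2"
    using cf cos_monotone_0_pi_le[of "pi / 2" "\<bar>?f\<bar>"] by (cases "\<bar>?f\<bar> < pi / 2") auto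
  moreover have "tan ?f = (a * v + b) / (c * v + d)" using k(1) ct by (simp add: tan_def f)
  ultimately show ?thesis by (metis abs_less_iff arctan_tan minus_less_iff)
qed

end

section \<open>Lifts of dilations and of special conformal transformations\<close>

definition dilation_lift :: "real \<Rightarrow> real \<Rightarrow> real" where
  "dilation_lift s = near_lift (exp (s / 2)) 0 0 (exp (- s / 2))"

text \<open>The special conformal transformations \<open>v \<mapsto> v / (c * v + 1)\<close>, which
  fix 0; they are needed for the Mautner argument.\<close>

definition special_lift :: "real \<Rightarrow> real \<Rightarrow> real" where
  "special_lift c = near_lift 1 0 c 1"

lemma dilation_lift_dot:
  "(exp (s / 2) * sin \<theta> + 0 * cos \<theta>) * sin \<theta> + (0 * sin \<theta> + exp (- s / 2) * cos \<theta>) * cos \<theta> > (0::real)"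
proof -
  have "sin \<theta> \<noteq> 0 \<or> cos \<theta> \<noteq> 0" using sin_zero_abs_cos_one by fastforce
  then have "exp (s / 2) * (sin \<theta>)\<^sup>2 + exp (- s / 2) * (cos \<theta>)\<^sup>2 > 0"
    by (auto intro: add_pos_nonneg add_nonneg_pos)
  then show ?thesis by (simp add: power2_eq_square mult.assoc)
qed

text \<open>The expression equals \<open>1 + c * (sin \<theta> * cos \<theta>)\<close>, and the
  product of sine and cosine has modulus at most 1/2; hence the bound 2 on \<open>c\<close>.\<close>

lemma special_lift_dot:
  assumes "\<bar>c\<bar> < 2"
  shows "(1 * sin \<theta> + 0 * cos \<theta>) * sin \<theta> + (c * sin \<theta> + 1 * cos \<theta>) * cos \<theta> > (0::real)"
proof -
  have "\<bar>c * (sin \<theta> * cos \<theta>)\<bar> = \<bar>c\<bar> * (\<bar>sin (2 * \<theta>)\<bar> / 2)" by (simp add: sin_double abs_mult)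
  also have "\<dots> \<le> \<bar>c\<bar> * (1 / 2)" by (intro mult_left_mono) auto
  also have "\<dots> < 1" using assms by simp
  finally have "1 + c * (sin \<theta> * cos \<theta>) > 0" by linarith
  moreover have "(1 * sin \<theta> + 0 * cos \<theta>) * sin \<theta> + (c * sin \<theta> + 1 * cos \<theta>) * cos \<theta>
      = ((sin \<theta>)\<^sup>2 + (cos \<theta>)\<^sup>2) + c * (sin \<theta> * cos \<theta>)"
    by (simp add: power2_eq_square algebra_simps)
  ultimately show ?thesis by simp
qed

lemma dilation_lift_mem: "dilation_lift s \<in> moebius_cover"
  unfolding dilation_lift_def
  by (rule near_lift_mem[OF _ dilation_lift_dot]) (simp flip: exp_add)

lemma dilation_lift_arctan: "dilation_lift s (arctan v) = arctan (exp s * v)"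
proof -
  have "exp s = exp (s / 2) * exp (s / 2)" by (simp flip: exp_add)
  then have "exp (s / 2) * v / exp (- s / 2) = exp s * v" by (simp add: exp_minus field_simps)
  then show ?thesis
    unfolding dilation_lift_def
    by (subst near_lift_arctan[OF _ dilation_lift_dot]) (simp_all add: exp_minus)
qed

lemma special_lift_mem: "\<bar>c\<bar> < 2 \<Longrightarrow> special_lift c \<in> moebius_cover"
  unfolding special_lift_def by (rule near_lift_mem[OF _ special_lift_dot]) simp_all

lemma special_lift_arctan:
  "\<bar>c\<bar> < 2 \<Longrightarrow> c * v + 1 > 0 \<Longrightarrow> special_lift c (arctan v) = arctan (v / (c * v + 1))"
  unfolding special_lift_def by (subst near_lift_arctan[OF _ special_lift_dot]) simp_all

lemma dilation_lift_continuous: "continuous_on UNIV dilation_lift"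
proof (rule continuous_on_coordinatewise_then_product)
  fix \<theta>
  show "continuous_on UNIV (\<lambda>s. dilation_lift s \<theta>)"
    unfolding dilation_lift_def near_lift_def
    using dilation_lift_dot[of _ \<theta>] by (intro continuous_intros) (auto simp: less_le)
qed

lemma special_lift_continuous: "continuous_on {-2<..<2} special_lift"
proof (rule continuous_on_coordinatewise_then_product)
  fix \<theta>
  show "continuous_on {-2<..<2} (\<lambda>c. special_lift c \<theta>)"
    unfolding special_lift_def near_lift_def
  proof (intro continuous_intros ballI)
    fix c :: real assume "c \<in> {-2<..<2}"
    then have "\<bar>c\<bar> < 2" by auto
    from special_lift_dot[OF this, of \<theta>]
    show "(1 * sin \<theta> + 0 * cos \<theta>) * sin \<theta> + (c * sin \<theta> + 1 * cos \<theta>) * cos \<theta> \<noteq> 0" by linarith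
  qed
qed

lemma dilation_lift_0: "dilation_lift 0 = id"
  by (rule moebius_cover_eqI[OF dilation_lift_mem moebius_cover_id zero_less_one])
    (simp add: dilation_lift_arctan)

lemma special_lift_0: "special_lift 0 = id"
  by (rule moebius_cover_eqI[OF special_lift_mem moebius_cover_id zero_less_one])
    (simp_all add: special_lift_arctan)

lemma dilation_lift_add: "dilation_lift (s + t) = dilation_lift s \<circ> dilation_lift t"
  by (rule moebius_cover_eqI[OF dilation_lift_mem moebius_cover_comp[OF dilation_lift_mem dilation_lift_mem] zero_less_one])
    (simp add: dilation_lift_arctan exp_add mult.assoc)

text \<open>
  The matrix identity
  \<open>(1 a; 0 1) (1 0; c 1) (1 b; 0 1) = (\<lambda> 0; c 1/\<lambda>) = (\<lambda> 0; 0 1/\<lambda>) (1 0; \<lambda>c 1)\<close> for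
  \<open>a = (\<lambda> - 1)/c\<close>, \<open>b = - a/\<lambda>\<close> and \<open>\<lambda> = exp (s/2)\<close>.
\<close>

lemma mautner_identity:
  assumes \<tau>: "\<tau> \<in> moebius_cover" "\<And>x. \<tau> (arctan x) = arctan (x + a)"
    and \<tau>': "\<tau>' \<in> moebius_cover" "\<And>x. \<tau>' (arctan x) = arctan (x + b)"
    and c: "c \<noteq> 0" "\<bar>c\<bar> < 2" "\<bar>exp (s / 2) * c\<bar> < 2"
    and a: "a = (exp (s / 2) - 1) / c" and b: "b = - a / exp (s / 2)"
  shows "\<tau> \<circ> special_lift c \<circ> \<tau>' = dilation_lift s \<circ> special_lift (exp (s / 2) * c)"
proof -
  define l where "l = exp (s / 2)"
  have l: "l > 0" and ll: "exp s = l * l" by (simp_all add: l_def flip: exp_add)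
  have ac: "a * c = l - 1" and bl: "b * l = - a" using c l by (simp_all add: a b l_def)
  \<comment> \<open>For \<open>v\<close> below this bound \<open>l * c * v + 1\<close> is positive,
    so neither side meets infinity and both are given by their fractional linear formulas.\<close>
  define r where "r = 1 / (l * \<bar>c\<bar>)"
  have r: "r > 0" using l c by (simp add: r_def)
  show ?thesis
    unfolding l_def[symmetric]
  proof (rule moebius_cover_eqI[OF _ _ r])
    show "\<tau> \<circ> special_lift c \<circ> \<tau>' \<in> moebius_cover" "dilation_lift s \<circ> special_lift (l * c) \<in> moebius_cover"
      using \<tau>(1) \<tau>'(1) c by (auto intro!: moebius_cover_comp special_lift_mem dilation_lift_mem simp: l_def)
    fix v assume v: "\<bar>v\<bar> < r"
    have "\<bar>l * c * v\<bar> < 1" using v l c by (simp add: r_def abs_mult field_simps)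
    then have p1: "l * c * v + 1 > 0" by linarith
    have "l * (c * (v + b) + 1) = l * c * v + 1" using ac bl by algebra
    then have p2: "c * (v + b) + 1 > 0" using p1 l by (metis zero_less_mult_pos)
    have "(v + b) + a * (c * (v + b) + 1) = l * v" using ac bl l by algebra
    then have "(v + b) / (c * (v + b) + 1) + a = l * v / (c * (v + b) + 1)"
      using p2 by (simp add: field_simps)
    also have "\<dots> = l * (l * v) / (l * (c * (v + b) + 1))" using l by simp
    also have "\<dots> = exp s * (v / (l * c * v + 1))"
      unfolding \<open>l * (c * (v + b) + 1) = l * c * v + 1\<close> by (simp add: ll)
    finally show "(\<tau> \<circ> special_lift c \<circ> \<tau>') (arctan v) = (dilation_lift s \<circ> special_lift (l * c)) (arctan v)"
      using c p1 p2 by (simp add: \<tau>(2) \<tau>'(2) special_lift_arctan dilation_lift_arctan l_def)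
  qed
qed

section \<open>Moebius covariant nets\<close>

text \<open>
  The flag \<open>\<sigma>\<close> selects the light ray that is acted upon: \<open>L\<^sub>-\<close>, with coordinate \<open>a\<^sub>0 + a\<^sub>1\<close>, if it
  is true, and \<open>L\<^sub>+\<close> otherwise.
\<close>

definition one_sided :: "bool \<Rightarrow> (real \<Rightarrow> real) \<Rightarrow> (real \<Rightarrow> real) \<times> (real \<Rightarrow> real)" where
  "one_sided \<sigma> f = (if \<sigma> then (id, f) else (f, id))"

definition light_ray :: "bool \<Rightarrow> real \<Rightarrow> spacetime" where
  "light_ray \<sigma> t = (t, if \<sigma> then t else - t)"

text \<open>\<open>B\<close> always lies on the ray that is acted upon and \<open>A\<close> on the
  other, so that both rays are treated by one proof.\<close>

definition ray_cone :: "bool \<Rightarrow> real set \<Rightarrow> real set \<Rightarrow> spacetime set" where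
  "ray_cone \<sigma> A B = (if \<sigma> then double_cone A B else double_cone B A)"

lemma one_sided_mem: "f \<in> moebius_cover \<Longrightarrow> one_sided \<sigma> f \<in> conformal_group"
  by (simp add: one_sided_def moebius_cover_id)

lemma one_sided_comp: "conformal_mult (one_sided \<sigma> f) (one_sided \<sigma> g) = one_sided \<sigma> (f \<circ> g)"
  by (simp add: one_sided_def conformal_mult_def)

lemma one_sided_continuous:
  "continuous_on S f \<Longrightarrow> continuous_on S (\<lambda>s. one_sided \<sigma> (f s))"
  by (cases \<sigma>) (auto simp: one_sided_def intro!: continuous_intros)

text \<open>Moving by \<open>light_ray \<sigma> t\<close> changes time and space by \<open>t\<close>
  each, hence one light-ray coordinate by \<open>2 * t\<close> and the other not at all.\<close>

lemma one_sided_lifts_translation: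
  assumes "f \<in> moebius_cover" "\<And>x. f (arctan x) = arctan (x + 2 * t)"
  shows "lifts_poincare (one_sided \<sigma> f) (\<lambda>b. light_ray \<sigma> t + b)"
  unfolding lifts_poincare_def
  using one_sided_mem[OF assms(1), of \<sigma>] translation_in_poincare assms(2)
  by (auto simp: one_sided_def light_ray_def compactify_def add_ac algebra_simps)

lemma light_ray_add: "light_ray \<sigma> (s + t) = light_ray \<sigma> s + light_ray \<sigma> t"
  by (simp add: light_ray_def)

lemma mem_translation_iff: "v \<in> (+) c ` B \<longleftrightarrow> v - c \<in> B" for c :: "'a::ab_group_add"
proof
  show "v \<in> (+) c ` B" if "v - c \<in> B" using that by (intro image_eqI[of _ _ "v - c"]) simp_all
qed auto

lemma light_ray_translate_cone: "(+) (light_ray \<sigma> t) ` ray_cone \<sigma> A B = ray_cone \<sigma> A ((+) (2 * t) ` B)"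
proof -
  have "a \<in> (+) (light_ray \<sigma> t) ` ray_cone \<sigma> A B \<longleftrightarrow> a \<in> ray_cone \<sigma> A ((+) (2 * t) ` B)" for a
    by (cases \<sigma>; simp only: mem_translation_iff ray_cone_def double_cone_def if_True if_False mem_Collect_eq;
      simp add: light_ray_def algebra_simps)
  then show ?thesis by blast
qed

lemma open_cone: "open A \<Longrightarrow> open B \<Longrightarrow> open (ray_cone \<sigma> A B)"
proof -
  have "open (double_cone A B)" if "open A" "open B" for A B
  proof -
    have "double_cone A B = (\<lambda>a. fst a - snd a) -` A \<inter> (\<lambda>a. fst a + snd a) -` B"
      by (auto simp: double_cone_def)
    then show ?thesis using that by (auto intro!: open_Int open_vimage continuous_intros)
  qed
  then show "open A \<Longrightarrow> open B \<Longrightarrow> open (ray_cone \<sigma> A B)" by (simp add: ray_cone_def)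
qed

lemma bounded_cone: "bounded A \<Longrightarrow> bounded B \<Longrightarrow> bounded (ray_cone \<sigma> A B)"
proof -
  have "bounded (double_cone A B)" if AB: "bounded A" "bounded B" for A B
  proof -
    obtain a b where a: "\<And>x. x \<in> A \<Longrightarrow> \<bar>x\<bar> \<le> a" and b: "\<And>x. x \<in> B \<Longrightarrow> \<bar>x\<bar> \<le> b"
      using AB by (auto simp: bounded_iff)
    have "norm p \<le> a + b" if "p \<in> double_cone A B" for p
    proof -
      have "\<bar>fst p - snd p\<bar> \<le> a" "\<bar>fst p + snd p\<bar> \<le> b" using that a b by (auto simp: double_cone_def)
      then have "\<bar>fst p\<bar> + \<bar>snd p\<bar> \<le> a + b" by linarith
      then show ?thesis using norm_Pair_le[of "fst p" "snd p"] by simp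
    qed
    then show ?thesis unfolding bounded_iff by blast
  qed
  then show "bounded A \<Longrightarrow> bounded B \<Longrightarrow> bounded (ray_cone \<sigma> A B)" by (simp add: ray_cone_def)
qed

lemma cone_nonempty: "A \<noteq> {} \<Longrightarrow> B \<noteq> {} \<Longrightarrow> ray_cone \<sigma> A B \<noteq> {}"
proof -
  have "double_cone A B \<noteq> {}" if AB: "A \<noteq> {}" "B \<noteq> {}" for A B
  proof -
    obtain a b where "a \<in> A" "b \<in> B" using AB by blast
    moreover have "(a + b) / 2 - (b - a) / 2 = a" "(a + b) / 2 + (b - a) / 2 = b" by (simp_all add: field_simps)
    ultimately have "((a + b) / 2, (b - a) / 2) \<in> double_cone A B"
      unfolding double_cone_def by (simp only: fst_conv snd_conv mem_Collect_eq)
    then show ?thesis by blast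
  qed
  then show "A \<noteq> {} \<Longrightarrow> B \<noteq> {} \<Longrightarrow> ray_cone \<sigma> A B \<noteq> {}" by (simp add: ray_cone_def)
qed

text \<open>The Minkowski form is the product of the differences of the two light-ray coordinates;
  opposite orders on the two rays make it negative.\<close>

lemma cone_spacelike:
  assumes "(\<forall>a\<in>A. \<forall>a'\<in>A'. a < a') \<and> (\<forall>b\<in>B. \<forall>b'\<in>B'. b' < b) \<or>
    (\<forall>a\<in>A. \<forall>a'\<in>A'. a' < a) \<and> (\<forall>b\<in>B. \<forall>b'\<in>B'. b < b')"
  shows "spacelike_separated (ray_cone \<sigma> A B) (ray_cone \<sigma> A' B')"
  unfolding spacelike_separated_def
proof (intro ballI)
  fix p q assume pq: "p \<in> ray_cone \<sigma> A B" "q \<in> ray_cone \<sigma> A' B'"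
  have "mink (p - q) (p - q) = ((fst p - snd p) - (fst q - snd q)) * ((fst p + snd p) - (fst q + snd q))"
    by (simp add: mink_def algebra_simps)
  also have "\<dots> < 0"
    using pq assms by (cases \<sigma>) (auto simp: ray_cone_def double_cone_def mult_less_0_iff)
  finally show "mink (p - q) (p - q) < 0" .
qed

text \<open>A one-sided dilation sends no point of Minkowski space to infinity, so its local action
  is the image under a genuine point map, multiplication of one light-ray coordinate.\<close>

lemma local_action_dilation:
  "local_action (one_sided \<sigma> (dilation_lift s)) (ray_cone \<sigma> A B) = ray_cone \<sigma> A ((*) (exp s) ` B)"
proof -
  let ?g = "one_sided \<sigma> (dilation_lift s)"
  \<comment> \<open>That point map in time and space coordinates: half the sum and half the
    difference of the new light-ray coordinates.\<close>
  define m where "m r a = (if \<sigma> then ((fst a - snd a + r * (fst a + snd a)) / 2, (r * (fst a + snd a) - (fst a - snd a)) / 2)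
    else ((r * (fst a - snd a) + (fst a + snd a)) / 2, ((fst a + snd a) - r * (fst a - snd a)) / 2))" for r :: real and a :: spacetime
  have mu: "fst (m r a) - snd (m r a) = (if \<sigma> then fst a - snd a else r * (fst a - snd a))"
    and mv: "fst (m r a) + snd (m r a) = (if \<sigma> then r * (fst a + snd a) else fst a + snd a)" for r a
    by (cases \<sigma>; simp add: m_def field_simps)+
  have eqI: "a = b" if "fst a - snd a = fst b - snd b" "fst a + snd a = fst b + snd b" for a b :: spacetime
    using that by (simp add: prod_eq_iff)
  have m: "map_prod (fst ?g) (snd ?g) (compactify a) = compactify (m (exp s) a)" for a
    by (cases \<sigma>) (simp_all add: one_sided_def compactify_def mu mv dilation_lift_arctan)
  have inj: "compactify a = compactify b \<longleftrightarrow> a = b" for a b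
    unfolding compactify_def prod.inject arctan_eq_iff using eqI by blast
  have "a \<in> local_action ?g (ray_cone \<sigma> A B) \<longleftrightarrow> a \<in> m (exp s) ` ray_cone \<sigma> A B" for a
    unfolding local_action_def image_image m by (auto simp: inj)
  then have "local_action ?g (ray_cone \<sigma> A B) = m (exp s) ` ray_cone \<sigma> A B" by blast
  also have "\<dots> = ray_cone \<sigma> A ((*) (exp s) ` B)"
  proof (intro subset_antisym subsetI)
    fix a assume "a \<in> m (exp s) ` ray_cone \<sigma> A B"
    then obtain b where "a = m (exp s) b" "b \<in> ray_cone \<sigma> A B" by blast
    then show "a \<in> ray_cone \<sigma> A ((*) (exp s) ` B)"
      by (cases \<sigma>) (simp_all add: ray_cone_def double_cone_def mu mv)
  next
    fix a assume a: "a \<in> ray_cone \<sigma> A ((*) (exp s) ` B)"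
    have e: "exp (- s) * (exp s * b) = b" "exp s * (exp (- s) * b) = b" for b
      by (simp_all add: exp_minus)
    have "m (exp (- s)) a \<in> ray_cone \<sigma> A B"
      using a by (cases \<sigma>) (auto simp: ray_cone_def double_cone_def mu mv e)
    moreover have "m (exp s) (m (exp (- s)) a) = a"
      by (rule eqI) (simp_all add: mu mv e)
    ultimately show "a \<in> m (exp s) ` ray_cone \<sigma> A B" by (metis imageI)
  qed
  finally show ?thesis .
qed

lemma conj_op_add:
  assumes "unitary_group W"
  shows "conj_op (W (s + t)) x = conj_op (W s) (conj_op (W t) x)"
proof
  fix \<xi>
  have "W (- (s + t)) \<xi> = W (- t) (W (- s) \<xi>)"
    using unitary_groupD(2)[OF assms, of "- t" "- s" \<xi>] by (simp add: add.commute)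
  then show "conj_op (W (s + t)) x \<xi> = conj_op (W s) (conj_op (W t) x) \<xi>"
    by (simp add: conj_op_unitary_group[OF assms] unitary_groupD(2)[OF assms])
qed

context poincare_covariant_net
begin

lemma light_ray_unitary_group: "unitary_group (\<lambda>t. transl U (light_ray \<sigma> t))"
  unfolding unitary_group_def
proof (intro conjI allI)
  show "unitary_op (transl U (light_ray \<sigma> t))" for t by (rule transl_unitary)
  show "transl U (light_ray \<sigma> (s + t)) = transl U (light_ray \<sigma> s) \<circ> transl U (light_ray \<sigma> t)" for s t
    by (auto simp: light_ray_add transl_add)
  show "continuous_on UNIV (\<lambda>t. transl U (light_ray \<sigma> t) \<xi>)" for \<xi>
  proof (rule continuous_on_compose2[OF transl_continuous _ subset_UNIV])
    show "continuous_on UNIV (light_ray \<sigma>)"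
      unfolding light_ray_def[abs_def] by (cases \<sigma>) (auto intro!: continuous_intros)
  qed
qed

end

context moebius_covariant_net
begin

section \<open>One-sided dilations: invariant vectors and covariance\<close>

context
  fixes V :: "(real \<Rightarrow> real) \<times> (real \<Rightarrow> real) \<Rightarrow> 'a \<Rightarrow> 'a" and \<sigma> :: bool
  assumes V: "unitary_rep conformal_group conformal_mult V"
    and VU: "\<And>g p. lifts_poincare g p \<Longrightarrow> V g = U p"
    and local: "\<And>S. open S \<Longrightarrow> bounded S \<Longrightarrow>
      \<exists>N. open N \<and> (id, id) \<in> N \<and> (\<forall>g\<in>N \<inter> conformal_group. stays_in_minkowski g S \<and>
        conj_op (V g) ` \<A> S = \<A> (local_action g S))"
begin

definition dil :: "real \<Rightarrow> 'a \<Rightarrow> 'a" where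
  "dil s = V (one_sided \<sigma> (dilation_lift s))"

abbreviation ray :: "real \<Rightarrow> 'a \<Rightarrow> 'a" where
  "ray t \<equiv> transl U (light_ray \<sigma> t)"

lemma V_one_sided_comp:
  "f \<in> moebius_cover \<Longrightarrow> g \<in> moebius_cover \<Longrightarrow>
    V (one_sided \<sigma> (f \<circ> g)) \<xi> = V (one_sided \<sigma> f) (V (one_sided \<sigma> g) \<xi>)"
  using unitary_repD(2)[OF V one_sided_mem one_sided_mem, of f g \<sigma> \<sigma> \<xi>] by (simp add: one_sided_comp)

lemma V_translation:
  "f \<in> moebius_cover \<Longrightarrow> (\<And>x. f (arctan x) = arctan (x + 2 * t)) \<Longrightarrow> V (one_sided \<sigma> f) = ray t"
  unfolding transl_def by (rule VU[OF one_sided_lifts_translation])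

lemma dil_unitary_group: "unitary_group dil"
  unfolding unitary_group_def dil_def
proof (intro conjI allI)
  show "unitary_op (V (one_sided \<sigma> (dilation_lift s)))" for s
    by (intro unitary_repD(1)[OF V] one_sided_mem dilation_lift_mem)
  show "V (one_sided \<sigma> (dilation_lift (s + t))) = V (one_sided \<sigma> (dilation_lift s)) \<circ> V (one_sided \<sigma> (dilation_lift t))" for s t
    by (simp add: fun_eq_iff dilation_lift_add V_one_sided_comp dilation_lift_mem)
  show "continuous_on UNIV (\<lambda>s. V (one_sided \<sigma> (dilation_lift s)) \<xi>)" for \<xi>
    by (rule continuous_on_compose2[OF unitary_repD(3)[OF V] one_sided_continuous[OF dilation_lift_continuous]],
        rule image_subsetI) (rule one_sided_mem[OF dilation_lift_mem])
qed

text \<open>The conjugated lift is again the lift of a translation, and on such lifts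
  \<open>V\<close> is determined by \<open>U\<close>.\<close>

lemma dil_ray_conjugate: "dil s (ray t (dil (- s) \<xi>)) = ray (exp s * t) \<xi>"
proof -
  obtain \<tau> where \<tau>: "\<tau> \<in> moebius_cover" "\<And>x. \<tau> (arctan x) = arctan (x + 2 * t)"
    using affine_lift_exists[of 1 "2 * t"] by auto
  let ?f = "\<tau> \<circ> dilation_lift (- s)"
  have f: "?f \<in> moebius_cover" "dilation_lift s \<circ> ?f \<in> moebius_cover"
    by (intro moebius_cover_comp dilation_lift_mem \<tau>(1))+
  have "exp s * (exp (- s) * x + 2 * t) = x + 2 * (exp s * t)" for x
    by (simp add: distrib_left exp_minus)
  then have "V (one_sided \<sigma> (dilation_lift s \<circ> ?f)) = ray (exp s * t)"
    by (intro V_translation[OF f(2)]) (simp add: dilation_lift_arctan \<tau>(2))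
  then have "ray (exp s * t) \<xi> = V (one_sided \<sigma> (dilation_lift s)) (V (one_sided \<sigma> ?f) \<xi>)"
    using V_one_sided_comp[OF dilation_lift_mem f(1), of s \<xi>] by simp
  also have "V (one_sided \<sigma> ?f) \<xi> = V (one_sided \<sigma> \<tau>) (V (one_sided \<sigma> (dilation_lift (- s))) \<xi>)"
    by (rule V_one_sided_comp[OF \<tau>(1) dilation_lift_mem])
  also have "V (one_sided \<sigma> \<tau>) = ray t" by (rule V_translation[OF \<tau>])
  finally show ?thesis by (simp add: dil_def)
qed

text \<open>The Mautner argument. In \<open>mautner_identity\<close> the translations drop out of
  the matrix element in \<open>\<xi>\<close>, while both special conformal transformations tend to
  the identity as \<open>c\<close> tends to 0. The dilation is what survives, so
  \<open>cinner \<xi> (dil s \<xi>) = cinner \<xi> \<xi>\<close>.\<close>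

lemma dil_invariant_if_ray_invariant:
  assumes \<xi>: "\<xi> \<in> invariants ray"
  shows "dil s \<xi> = \<xi>"
proof -
  let ?l = "exp (s / 2)"
  have inv: "ray t \<xi> = \<xi>" for t using \<xi> by (simp add: invariants_def)
  define P where "P c = V (one_sided \<sigma> (special_lift c)) \<xi>" for c
  have P: "(P \<longlongrightarrow> \<xi>) (at 0)"
  proof -
    have "continuous_on {-2<..<2} P" unfolding P_def
      by (rule continuous_on_compose2[OF unitary_repD(3)[OF V] one_sided_continuous[OF special_lift_continuous]],
          rule image_subsetI) (auto intro: one_sided_mem[OF special_lift_mem])
    then have "(P \<longlongrightarrow> P 0) (at 0)"
      by (simp add: continuous_on_eq_continuous_at continuous_at isContD)
    moreover have "P 0 = \<xi>"
      using V_translation[OF moebius_cover_id, of 0] inv[of 0] by (simp add: P_def special_lift_0)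
    ultimately show ?thesis by simp
  qed
  have eq: "cinner \<xi> (P c) = cinner \<xi> (dil s (P (?l * c)))" if c: "c \<noteq> 0" "\<bar>c\<bar> < 2" "\<bar>?l * c\<bar> < 2" for c
  proof -
    \<comment> \<open>For \<open>s \<noteq> 0\<close> these parameters diverge as \<open>c\<close>
      tends to 0. This is harmless: one translation acts on \<open>\<xi>\<close> itself and the
      other is moved to the left argument, which is also \<open>\<xi>\<close>.\<close>
    define a where "a = (?l - 1) / c"
    define b where "b = - a / ?l"
    obtain \<tau> where \<tau>: "\<tau> \<in> moebius_cover" "\<And>x. \<tau> (arctan x) = arctan (x + a)"
      using affine_lift_exists[of 1 a] by auto
    obtain \<tau>' where \<tau>': "\<tau>' \<in> moebius_cover" "\<And>x. \<tau>' (arctan x) = arctan (x + b)"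
      using affine_lift_exists[of 1 b] by auto
    have V\<tau>: "V (one_sided \<sigma> \<tau>) = ray (a / 2)" "V (one_sided \<sigma> \<tau>') = ray (b / 2)"
      using \<tau> \<tau>' by (auto intro!: V_translation)
    have mem: "special_lift c \<in> moebius_cover" "special_lift (?l * c) \<in> moebius_cover"
      using c by (auto intro: special_lift_mem)
    have "V (one_sided \<sigma> (\<tau> \<circ> special_lift c \<circ> \<tau>')) \<xi> = V (one_sided \<sigma> (dilation_lift s \<circ> special_lift (?l * c))) \<xi>"
      by (simp only: mautner_identity[OF \<tau> \<tau>' c a_def b_def])
    then have "ray (a / 2) (P c) = dil s (P (?l * c))"
      by (simp add: V_one_sided_comp moebius_cover_comp mem \<tau>(1) \<tau>'(1) dilation_lift_mem V\<tau> inv P_def dil_def)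
    moreover have "cinner \<xi> (ray (a / 2) (P c)) = cinner \<xi> (P c)"
      using unitary_groupD(6)[OF light_ray_unitary_group, of \<sigma> "- (a / 2)" \<xi> "P c"] by (simp add: inv)
    ultimately show ?thesis by simp
  qed
  have "((\<lambda>c. cinner \<xi> (P c)) \<longlongrightarrow> cinner \<xi> \<xi>) (at 0)" by (intro tendsto_cinner_right P)
  moreover have "((\<lambda>c. cinner \<xi> (P c)) \<longlongrightarrow> cinner \<xi> (dil s \<xi>)) (at 0)"
  proof (rule Lim_transform_eventually)
    have "filterlim (\<lambda>c. ?l * c) (at 0) (at 0)"
      by (auto simp: filterlim_at eventually_at_filter intro!: tendsto_eq_intros)
    then have "((\<lambda>c. P (?l * c)) \<longlongrightarrow> \<xi>) (at 0)" by (rule filterlim_compose[OF P])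
    then show "((\<lambda>c. cinner \<xi> (dil s (P (?l * c)))) \<longlongrightarrow> cinner \<xi> (dil s \<xi>)) (at 0)"
      by (intro tendsto_cinner_right bounded_linear.tendsto[OF unitary_groupD(8)[OF dil_unitary_group]])
    have "\<forall>\<^sub>F c in at (0::real). c \<noteq> 0 \<and> \<bar>c\<bar> < 2 \<and> \<bar>?l * c\<bar> < 2"
    proof (intro eventually_conj)
      show "\<forall>\<^sub>F c in at (0::real). c \<noteq> 0" by (simp add: eventually_at_filter)
      have "((\<lambda>c. \<bar>c\<bar>) \<longlongrightarrow> \<bar>0\<bar>) (at (0::real))" "((\<lambda>c. \<bar>?l * c\<bar>) \<longlongrightarrow> \<bar>?l * 0\<bar>) (at (0::real))"
        by (intro tendsto_intros)+
      then show "\<forall>\<^sub>F c in at (0::real). \<bar>c\<bar> < 2" "\<forall>\<^sub>F c in at (0::real). \<bar>?l * c\<bar> < 2"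
        by (auto dest: order_tendstoD(2)[where a = 2])
    qed
    then show "\<forall>\<^sub>F c in at 0. cinner \<xi> (dil s (P (?l * c))) = cinner \<xi> (P c)"
      by eventually_elim (use eq in auto)
  qed
  ultimately have "cinner \<xi> \<xi> = cinner \<xi> (dil s \<xi>)" by (rule tendsto_unique[OF at_neq_bot])
  then have "inner \<xi> (dil s \<xi>) = inner \<xi> \<xi>" by (simp flip: Re_cinner)
  moreover have "norm (dil s \<xi>) = norm \<xi>" by (rule unitary_groupD(7)[OF dil_unitary_group])
  \<comment> \<open>Two vectors of equal norm whose inner product is the square of that norm
    coincide.\<close>
  ultimately have "(norm (dil s \<xi> - \<xi>))\<^sup>2 = 0"
    by (simp add: power2_norm_eq_inner inner_diff inner_commute norm_eq_sqrt_inner)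
  then show ?thesis by simp
qed

text \<open>Dilations contract every translation to the identity, yet on a dilation invariant vector
  they do not change how far the translation moves it; this distance is therefore 0.\<close>

lemma ray_invariant_if_dil_invariant:
  assumes \<xi>: "\<xi> \<in> invariants dil"
  shows "ray t \<xi> = \<xi>"
proof -
  have inv: "dil s \<xi> = \<xi>" for s using \<xi> by (simp add: invariants_def)
  have const: "norm (ray (exp s * t) \<xi> - \<xi>) = norm (ray t \<xi> - \<xi>)" for s
  proof -
    have "ray (exp s * t) \<xi> - \<xi> = dil s (ray t \<xi> - \<xi>)"
      using dil_ray_conjugate[of s t \<xi>] linear_diff[OF bounded_linear.linear[OF unitary_groupD(8)[OF dil_unitary_group]]]
      by (simp add: inv)
    then show ?thesis by (simp add: unitary_groupD(7)[OF dil_unitary_group])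
  qed
  have e: "((\<lambda>s. exp s * t) \<longlongrightarrow> 0 * t) at_bot" by (intro tendsto_intros exp_at_bot)
  have "((\<lambda>s. ray (exp s * t) \<xi>) \<longlongrightarrow> ray 0 \<xi>) at_bot"
    by (rule continuous_on_tendsto_compose[OF unitary_groupD(3)[OF light_ray_unitary_group]]) (use e in auto)
  then have "((\<lambda>s. norm (ray (exp s * t) \<xi> - \<xi>)) \<longlongrightarrow> norm (ray 0 \<xi> - \<xi>)) at_bot" by (intro tendsto_intros)
  then have "norm (ray t \<xi> - \<xi>) = norm (ray 0 \<xi> - \<xi>)"
    unfolding const by (simp add: tendsto_const_iff)
  then show ?thesis by (simp add: unitary_groupD(4)[OF light_ray_unitary_group])
qed

lemma invariants_dil: "invariants dil = invariants ray"
  using dil_invariant_if_ray_invariant ray_invariant_if_dil_invariant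
  by (auto simp: invariants_def)

text \<open>Covariance is given near the identity only, with a neighborhood depending on the region.
  It defines an equivalence relation between dilation parameters whose classes are open, and the
  real line is connected.\<close>

lemma dil_covariance:
  assumes A: "open A" "bounded A" and B: "open B" "bounded B"
  shows "conj_op (dil s) ` \<A> (ray_cone \<sigma> A B) = \<A> (ray_cone \<sigma> A ((*) (exp s) ` B))"
proof -
  define C where "C s = ray_cone \<sigma> A ((*) (exp s) ` B)" for s
  have C: "open (C s)" "bounded (C s)" for s
    unfolding C_def
    using open_scaling[of "exp s" B] bounded_scaling[of B "exp s"] A B by (auto intro!: open_cone bounded_cone)
  have CC: "local_action (one_sided \<sigma> (dilation_lift r)) (C s) = C (r + s)" for r s
    unfolding C_def local_action_dilation by (simp add: image_image exp_add mult.assoc)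
  define R where "R s t \<longleftrightarrow> conj_op (dil (t - s)) ` \<A> (C s) = \<A> (C t)" for s t
  note add = conj_op_add[OF dil_unitary_group]
  have "R 0 s"
  proof (rule connected_equivalence_relation[of UNIV _ _ R])
    show "R y x" if "R x y" for x y
    proof -
      have "conj_op (dil (x - y)) ` \<A> (C y) = conj_op (dil (x - y)) ` conj_op (dil (y - x)) ` \<A> (C x)"
        using that by (simp add: R_def)
      also have "\<dots> = conj_op (dil 0) ` \<A> (C x)" by (simp add: image_image flip: add)
      also have "\<dots> = \<A> (C x)"
        by (simp add: conj_op_unitary_group[OF dil_unitary_group, abs_def] unitary_groupD(4)[OF dil_unitary_group]
            cong: image_cong)
      finally show ?thesis by (simp add: R_def)
    qed
    show "R x z" if "R x y" "R y z" for x y z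
    proof -
      have "\<A> (C z) = conj_op (dil (z - y)) ` conj_op (dil (y - x)) ` \<A> (C x)"
        using that by (simp add: R_def)
      then show ?thesis by (simp add: R_def image_image flip: add)
    qed
    show "\<exists>T. openin (top_of_set UNIV) T \<and> a \<in> T \<and> (\<forall>x\<in>T. R a x)" for a
    proof -
      obtain N where N: "open N" "(id, id) \<in> N"
        "\<And>g. g \<in> N \<inter> conformal_group \<Longrightarrow> conj_op (V g) ` \<A> (C a) = \<A> (local_action g (C a))"
        using local[OF C[of a]] by blast
      define T where "T = (\<lambda>t. one_sided \<sigma> (dilation_lift (t - a))) -` N"
      have "continuous_on UNIV (\<lambda>t. one_sided \<sigma> (dilation_lift (t - a)))"
        by (intro one_sided_continuous continuous_on_compose2[OF dilation_lift_continuous] continuous_intros) auto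
      then have "open T" unfolding T_def using N(1) by (simp add: open_vimage)
      moreover have "a \<in> T" using N(2) by (simp add: T_def dilation_lift_0 one_sided_def)
      moreover have "R a t" if "t \<in> T" for t
        using N(3)[of "one_sided \<sigma> (dilation_lift (t - a))"] that one_sided_mem[OF dilation_lift_mem]
        by (simp add: T_def R_def dil_def CC)
      ultimately show ?thesis by (auto intro!: exI[of _ T])
    qed
  qed auto
  then show ?thesis by (simp add: R_def C_def)
qed

lemma light_ray_averages_converge:
  assumes h: "averaging h \<epsilon>" and ab: "a1 < a2" "b1 < b2"
    and x: "x \<in> \<A> (ray_cone \<sigma> {a1<..<a2} {b1<..<b2})"
  shows "\<exists>\<eta>. ((\<lambda>\<T>. averaging.avg h \<epsilon> \<T> (\<lambda>t. conj_op (ray t) x \<xi>)) \<longlongrightarrow> \<eta>) at_top \<and>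
             ((\<lambda>\<T>. averaging.avg h \<epsilon> \<T> (\<lambda>t. conj_op (ray t) x \<xi>)) \<longlongrightarrow> \<eta>) at_bot"
proof -
  let ?A = "{a1<..<a2}" and ?B = "{b1<..<b2}"
  \<comment> \<open>On the other ray these regions lie on opposite sides of \<open>?A\<close>. On
    the ray acted upon they leave the window from -1 to 1 free, and once a contraction has brought
    \<open>?B\<close> into it, the cone is spacelike to both.\<close>
  let ?SY = "ray_cone \<sigma> {a2<..<a2 + 1} {-2<..<-1::real}" and ?SZ = "ray_cone \<sigma> {a1 - 1<..<a1} {1<..<2::real}"
  have oc: "open (ray_cone \<sigma> {l<..<u} {l'<..<u'})" "bounded (ray_cone \<sigma> {l<..<u} {l'<..<u'})" for l u l' u' :: real
    by (intro open_cone bounded_cone; simp)+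
  obtain \<Omega> where \<Omega>: "invariant_vector U \<Omega>"
    "closure {x \<Omega> | x. x \<in> vn_generated (\<Union>S\<in>{S. open S \<and> bounded S}. \<A> S)} = UNIV"
    using vacuum by blast
  have \<Omega>_inv: "\<Omega> \<in> invariants ray"
    using \<Omega>(1) translation_in_poincare unfolding invariants_def invariant_vector_def transl_def by blast
  have ray_mem: "conj_op (ray t) x \<in> \<A> (ray_cone \<sigma> ?A {b1 + 2 * t<..<b2 + 2 * t})" for t
  proof -
    have "conj_op (ray t) x \<in> \<A> ((+) (light_ray \<sigma> t) ` ray_cone \<sigma> ?A ?B)"
      using transl_covariance[OF oc] x by blast
    moreover have "(+) (2 * t) ` ?B = {b1 + 2 * t<..<b2 + 2 * t}"
      by (intro set_eqI) (simp only: mem_translation_iff greaterThanLessThan_iff less_diff_eq diff_less_eq)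
    ultimately show ?thesis by (simp only: light_ray_translate_cone)
  qed
  have dil_mem: "conj_op (dil s) x \<in> \<A> (ray_cone \<sigma> ?A {exp s * b1<..<exp s * b2})" for s
  proof -
    have "(*) (exp s) ` ?B = {exp s * b1<..<exp s * b2}"
    proof (intro subset_antisym subsetI)
      show "v \<in> (*) (exp s) ` ?B" if "v \<in> {exp s * b1<..<exp s * b2}" for v
        using that by (intro image_eqI[of _ _ "v / exp s"]) (auto simp: pos_less_divide_eq pos_divide_less_eq mult.commute)
    qed auto
    then show ?thesis using dil_covariance[of ?A ?B s] x by auto
  qed
  have comm: "y \<circ> z = z \<circ> y"
    if "y \<in> \<A> (ray_cone \<sigma> {l<..<u} {l'<..<u'})" "z \<in> \<A> (ray_cone \<sigma> {k<..<v} {k'<..<v'})"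
      "u \<le> k \<and> v' \<le> l' \<or> v \<le> l \<and> u' \<le> k'" for y z l u l' u' k v k' v'
    by (rule locality[OF oc oc cone_spacelike that(1,2)]) (use that(3) in auto)
  have dense: "closure {y \<Omega> | y. y \<in> \<A> (ray_cone \<sigma> {l<..<u} {l'<..<u'})} = UNIV"
    if "l < u" "l' < u'" for l u l' u'
    by (rule reeh_schlieder[OF oc cone_nonempty \<Omega>]) (use that in auto)
  note alg = local_algebra[OF oc]
  show ?thesis
  proof (rule averaging.averaged_orbit_limits_agree[OF h light_ray_unitary_group dil_unitary_group
        invariants_dil \<Omega>_inv von_neumann_algebraD(1)[OF alg x] alg _ alg])
    show "closure {y \<Omega> | y. y \<in> \<A> ?SY} = UNIV" "closure {z \<Omega> | z. z \<in> \<A> ?SZ} = UNIV"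
      by (rule dense; simp)+
    show "\<exists>t0. \<forall>t\<ge>t0. conj_op (ray t) x \<circ> y = y \<circ> conj_op (ray t) x" if "y \<in> \<A> ?SY" for y
    \<comment> \<open>From this time on \<open>b1 + 2 * t \<ge> - 1\<close>: the moved interval is
      past that of \<open>?SY\<close>.\<close>
    proof (intro exI[of _ "(- 1 - b1) / 2"] allI impI)
      fix t :: real assume "t \<ge> (- 1 - b1) / 2"
      then show "conj_op (ray t) x \<circ> y = y \<circ> conj_op (ray t) x"
        by (intro comm[OF ray_mem that]) (auto simp: field_simps)
    qed
    show "\<exists>t0. \<forall>t\<le>t0. conj_op (ray t) x \<circ> z = z \<circ> conj_op (ray t) x" if "z \<in> \<A> ?SZ" for z
    \<comment> \<open>Up to this time \<open>b2 + 2 * t \<le> 1\<close>: the moved interval has not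
      reached that of \<open>?SZ\<close>.\<close>
    proof (intro exI[of _ "(1 - b2) / 2"] allI impI)
      fix t :: real assume "t \<le> (1 - b2) / 2"
      then show "conj_op (ray t) x \<circ> z = z \<circ> conj_op (ray t) x"
        by (intro comm[OF ray_mem that]) (auto simp: field_simps)
    qed
    show "\<exists>t0. \<forall>t\<le>t0. conj_op (dil t) x \<circ> y = y \<circ> conj_op (dil t) x" if y: "y \<in> \<A> ?SY \<union> \<A> ?SZ" for y
    \<comment> \<open>Below this parameter both endpoints are scaled into the window from -1 to 1;
      the summand 1 keeps the argument of \<open>ln\<close> positive.\<close>
    proof (intro exI[of _ "- ln (1 + \<bar>b1\<bar> + \<bar>b2\<bar>)"] allI impI)
      fix s :: real assume s: "s \<le> - ln (1 + \<bar>b1\<bar> + \<bar>b2\<bar>)"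
      have "exp s \<le> exp (- ln (1 + \<bar>b1\<bar> + \<bar>b2\<bar>))" using s by simp
      also have "\<dots> = 1 / (1 + \<bar>b1\<bar> + \<bar>b2\<bar>)" by (simp add: exp_minus divide_inverse)
      finally have "exp s * (1 + \<bar>b1\<bar> + \<bar>b2\<bar>) \<le> 1" by (simp add: pos_le_divide_eq)
      moreover have "\<bar>exp s * b1\<bar> \<le> exp s * (1 + \<bar>b1\<bar> + \<bar>b2\<bar>)" "\<bar>exp s * b2\<bar> \<le> exp s * (1 + \<bar>b1\<bar> + \<bar>b2\<bar>)"
        by (auto simp: abs_mult)
      ultimately have b: "- 1 \<le> exp s * b1" "exp s * b2 \<le> 1" by linarith+
      show "conj_op (dil s) x \<circ> y = y \<circ> conj_op (dil s) x"
        using y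
      proof
        assume "y \<in> \<A> ?SY" then show ?thesis using b by (intro comm[OF dil_mem]) auto
      next
        assume "y \<in> \<A> ?SZ" then show ?thesis using b by (intro comm[OF dil_mem]) auto
      qed
    qed
  qed
qed

end

lemma asymptotic_fields_agree:
  assumes h: "averaging h \<epsilon>" and ab: "a1 < a2" "b1 < b2"
    and x: "x \<in> \<A> (ray_cone \<sigma> {a1<..<a2} {b1<..<b2})"
  shows "\<exists>\<eta>. ((\<lambda>\<T>. light_ray_average U h \<epsilon> (if \<sigma> then 1 else -1) x \<T> \<xi>) \<longlongrightarrow> \<eta>) at_top \<and>
             ((\<lambda>\<T>. light_ray_average U h \<epsilon> (if \<sigma> then 1 else -1) x \<T> \<xi>) \<longlongrightarrow> \<eta>) at_bot"
proof -
  obtain V where V: "unitary_rep conformal_group conformal_mult V"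
    "\<forall>g p. lifts_poincare g p \<longrightarrow> V g = U p"
    "\<forall>S. open S \<and> bounded S \<longrightarrow>
      (\<exists>N. open N \<and> (id, id) \<in> N \<and> (\<forall>g\<in>N \<inter> conformal_group. stays_in_minkowski g S \<and>
        conj_op (V g) ` \<A> S = \<A> (local_action g S)))"
    using conformal_extension by (elim exE conjE)
  note V' = V(1) V(2)[THEN spec, THEN spec, THEN mp] V(3)[THEN spec, THEN mp, OF conjI]
  have eq: "light_ray_average U h \<epsilon> (if \<sigma> then 1 else -1) x \<T> \<xi> =
      averaging.avg h \<epsilon> \<T> (\<lambda>t. conj_op (transl U (light_ray \<sigma> t)) x \<xi>)" for \<T>
    unfolding light_ray_average_def averaging.avg_def[OF h] translate_op_def light_ray_def
    by (cases \<sigma>) simp_all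
  show ?thesis unfolding eq by (rule light_ray_averages_converge[OF V' h ab x])
qed

end

theorem theorem5p10:
  fixes \<A> :: "spacetime set \<Rightarrow> ('h::{chilbert_space, second_countable_topology} \<Rightarrow> 'h) set"
    and U :: "(spacetime \<Rightarrow> spacetime) \<Rightarrow> 'h \<Rightarrow> 'h"
    and h :: "real \<Rightarrow> real" and \<epsilon> i1 i2 j1 j2 :: real
  assumes "moebius_covariant_net \<A> U"
    and "0 < \<epsilon>" and "\<epsilon> < 1" and "averaging_function h"
    and "i1 < i2" and "j1 < j2"
    and "x \<in> \<A> (double_cone {i1<..<i2} {j1<..<j2})"
  shows "(\<forall>\<sigma>\<in>{1, -1}.
            strongly_convergent (light_ray_average U h \<epsilon> \<sigma> x) at_bot \<and>
            strongly_convergent (light_ray_average U h \<epsilon> \<sigma> x) at_top) \<and>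
         Phi_out U h \<epsilon> 1 x = Phi_in U h \<epsilon> 1 x \<and>
         Phi_out U h \<epsilon> (-1) x = Phi_in U h \<epsilon> (-1) x"
proof -
  interpret moebius_covariant_net \<A> U by fact
  have h: "averaging h \<epsilon>" using assms(2-4) by unfold_locales
  have lim: "\<exists>\<eta>. ((\<lambda>\<T>. light_ray_average U h \<epsilon> \<sigma> x \<T> \<xi>) \<longlongrightarrow> \<eta>) at_top \<and>
      ((\<lambda>\<T>. light_ray_average U h \<epsilon> \<sigma> x \<T> \<xi>) \<longlongrightarrow> \<eta>) at_bot" if \<sigma>: "\<sigma> \<in> {1, -1}" for \<sigma> \<xi>
  proof -
    consider "\<sigma> = 1" | "\<sigma> = -1" using \<sigma> by blast
    then show ?thesis
    proof cases
      case 1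
      then show ?thesis using asymptotic_fields_agree[OF h assms(5,6), of x True] assms(7) by (simp add: ray_cone_def)
    next
      case 2
      \<comment> \<open>For the sign -1 the ray acted upon is the one carrying the first interval,
        so the two intervals change roles.\<close>
      then show ?thesis using asymptotic_fields_agree[OF h assms(6,5), of x False] assms(7) by (simp add: ray_cone_def)
    qed
  qed
  have "strongly_convergent (light_ray_average U h \<epsilon> \<sigma> x) at_bot"
    "strongly_convergent (light_ray_average U h \<epsilon> \<sigma> x) at_top" if "\<sigma> \<in> {1, -1}" for \<sigma>
    using lim[OF that] unfolding strongly_convergent_def by meson+
  moreover have "Phi_out U h \<epsilon> \<sigma> x = Phi_in U h \<epsilon> \<sigma> x" if \<sigma>: "\<sigma> \<in> {1, -1}" for \<sigma>
  proof
    fix \<xi>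
    obtain \<eta> where "((\<lambda>\<T>. light_ray_average U h \<epsilon> \<sigma> x \<T> \<xi>) \<longlongrightarrow> \<eta>) at_top"
      "((\<lambda>\<T>. light_ray_average U h \<epsilon> \<sigma> x \<T> \<xi>) \<longlongrightarrow> \<eta>) at_bot"
      using lim[OF \<sigma>, of \<xi>] by (elim exE conjE)
    then show "Phi_out U h \<epsilon> \<sigma> x \<xi> = Phi_in U h \<epsilon> \<sigma> x \<xi>"
      by (simp add: Phi_out_def Phi_in_def strong_limit_def tendsto_Lim)
  qed
  ultimately show ?thesis by simp
qed

end
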